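(* Let $n$ be a positive integer. If $n\notin\{1,2,11,29,47,56,67,79,104,121,134,191\}$, then there is no almost perfect linear Lee code of packing radius $2$ in $\mathbb{Z}^n$.
   Context: The Lee metric on $\mathbb{Z}^n$ is $d_L(x,y)=\sum_{i=1}^n|x_i-y_i|$. The Lee sphere of radius $r$ is $S(n,r)=\{x\in\mathbb{Z}^n:\sum_{i=1}^n|x_i|\le r\}$; in particular $|S(n,2)|=2n^2+2n+1$. A linear Lee code is a lattice $\mathcal{C}\subseteq\mathbb{Z}^n$ (an additive subgroup of finite index). It gives a packing of $\mathbb{Z}^n$ by $S(n,r)$ if the translates $S(n,r)+c$, $c\in\mathcal{C}$, are pairwise disjoint; the density of this lattice packing is $|S(n,r)|/[\mathbb{Z}^n:\mathcal{C}]$. An almost perfect linear Lee code of packing radius $r$ is a lattice $\mathcal{C}$ giving a packing of $\mathbb{Z}^n$ by $S(n,r)$ with density $\frac{|S(n,r)|}{|S(n,r)|+1}$, i.e. with $[\mathbb{Z}^n:\mathcal{C}]=|S(n,r)|+1$. *)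

theory Defs
  imports
    "HOL-Algebra.Product_Groups"
    "HOL-Library.Disjoint_Sets"
    Complex_Main
begin

text \<open>
  Points of \<open>\<int>\<^sup>n\<close> are extensional functions on \<open>{1..n}\<close>: they take the value
  \<^const>\<open>undefined\<close> outside the index set.
\<close>

definition Zn :: "nat \<Rightarrow> (nat \<Rightarrow> int) monoid" where
  "Zn n = product_group {1..n} (\<lambda>_. integer_group)"

definition lee_sphere :: "nat \<Rightarrow> nat \<Rightarrow> (nat \<Rightarrow> int) set" where
  "lee_sphere n r = {x \<in> carrier (Zn n). (\<Sum>i\<in>{1..n}. \<bar>x i\<bar>) \<le> int r}"

definition linear_lee_code :: "nat \<Rightarrow> (nat \<Rightarrow> int) set \<Rightarrow> bool" where
  "linear_lee_code n C \<longleftrightarrow> subgroup C (Zn n) \<and> finite (rcosets\<^bsub>Zn n\<^esub> C)"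

text \<open>
  The coset notation \<open>S #> c\<close> is defined for an arbitrary set \<open>S\<close>; for a Lee sphere
  it is the translate by \<open>c\<close>.
\<close>

definition lattice_packing :: "nat \<Rightarrow> nat \<Rightarrow> (nat \<Rightarrow> int) set \<Rightarrow> bool" where
  "lattice_packing n r C \<longleftrightarrow>
     linear_lee_code n C \<and>
     disjoint_family_on (\<lambda>c. lee_sphere n r #>\<^bsub>Zn n\<^esub> c) C"

definition packing_density :: "nat \<Rightarrow> nat \<Rightarrow> (nat \<Rightarrow> int) set \<Rightarrow> real" where
  "packing_density n r C =
     real (card (lee_sphere n r)) / real (card (rcosets\<^bsub>Zn n\<^esub> C))"

definition almost_perfect_linear_lee_code :: "nat \<Rightarrow> nat \<Rightarrow> (nat \<Rightarrow> int) set \<Rightarrow> bool" where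
  "almost_perfect_linear_lee_code n r C \<longleftrightarrow>
     lattice_packing n r C \<and>
     packing_density n r C =
       real (card (lee_sphere n r)) / (real (card (lee_sphere n r)) + 1)"

end

theory Submission
  imports
    Defs
    "HOL-Library.Poly_Mapping"
    "HOL-Library.Function_Algebras"
    "HOL-Number_Theory.Cong"
begin

text \<open>
  The quotient of \<open>\<int>\<^sup>n\<close> by the code has even order \<open>2 (n\<^sup>2 + n + 1)\<close>, and the one coset missed by the
  sphere is its unique involution \<open>f\<close>. Splitting the unit cross \<open>{0, \<plusminus>e\<^sub>i}\<close> into the part in the
  subgroup of index 2 and the part outside of it, and dividing by \<open>f\<close>, one gets symmetric sets \<open>U\<close> and \<open>V\<close>
  with \<open>n\<close> and \<open>n + 1\<close> elements in an abelian group \<open>H\<close> of order \<open>n\<^sup>2 + n + 1\<close> such that in the group ring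
  \<open>U V = H - 1\<close> and \<open>U\<^sup>2 + V\<^sup>2 + U\<^sup>(\<^sup>2\<^sup>) + V\<^sup>(\<^sup>2\<^sup>) = 2 H + 2 n\<close>, where \<open>X\<^sup>(\<^sup>k\<^sup>)\<close> is the image of \<open>X\<close> under
  multiplication by \<open>k\<close>. Modulo \<open>H\<close> the element \<open>V\<close> is thus the negated inverse of \<open>U\<close>.

  If \<open>n \<equiv> 1 (mod 3)\<close>, the images of \<open>U\<close> and \<open>V\<close> in the quotient of order 3 are determined by two
  integers with product \<open>-1\<close>, which forces \<open>n = 1\<close>. Otherwise let \<open>B = U + V\<close> and consider the
  coefficients \<open>a\<close>, \<open>b\<close> of \<open>U B\<^sup>(\<^sup>2\<^sup>)\<close>, \<open>V B\<^sup>(\<^sup>2\<^sup>)\<close> and \<open>d\<close>, \<open>e\<close> of \<open>U B\<^sup>(\<^sup>4\<^sup>)\<close>, \<open>V B\<^sup>(\<^sup>4\<^sup>)\<close>. From \<open>U\<^sup>3 \<equiv> U\<^sup>(\<^sup>3\<^sup>) (mod 3)\<close>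
  one gets \<open>a\<close> and \<open>b\<close> modulo 3, and from \<open>U\<^sup>5 \<equiv> U\<^sup>(\<^sup>5\<^sup>) (mod 5)\<close> one gets \<open>d\<close> and \<open>e\<close> modulo 5 in terms
  of \<open>a\<close> and \<open>b\<close>. The first and second moments of \<open>a\<close>, \<open>b\<close>, \<open>d\<close>, \<open>e\<close> are known, and they
  contradict these residues for all but a few small \<open>n\<close>. Of those, \<open>3\<close> is excluded by hand, and \<open>5\<close> and \<open>8\<close>,
  where \<open>|H|\<close> is prime, by the dynamics of \<open>y \<mapsto> 2 n - 2 - y\<^sup>2\<close>, which describes the action of doubling
  on \<open>B\<close>.
\<close>

section \<open>Group rings modulo a subgroup of finite index\<close>

text \<open>The generators span the free abelian group, so additive statements about the group ring
  reduce to single group elements.\<close>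

lemma frag_induct [case_names zero one diff]:
  fixes P :: "'b \<Rightarrow>\<^sub>0 int"
  assumes "Q 0" "\<And>x. Q (frag_of x)" "\<And>a b. Q a \<Longrightarrow> Q b \<Longrightarrow> Q (a - b)"
  shows "Q P"
  by (rule frag_induction[of P UNIV Q]) (use assms in auto)

text \<open>
  Only the additive group of the ring \<open>'a\<close> matters; its multiplication merely provides the multiples
  \<open>of_nat k * x\<close>.
\<close>

locale finite_index_subgroup =
  fixes K :: "'a::comm_ring_1 set"
  assumes zero_mem: "0 \<in> K"
    and diff_mem: "x \<in> K \<Longrightarrow> y \<in> K \<Longrightarrow> x - y \<in> K"
    and finite_cover: "\<exists>F. finite F \<and> (\<forall>x. \<exists>r\<in>F. x - r \<in> K)"
begin

lemma minus_mem: "x \<in> K \<Longrightarrow> - x \<in> K"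
  using diff_mem[OF zero_mem] by simp

lemma minus_mem_iff: "- x \<in> K \<longleftrightarrow> x \<in> K"
  using minus_mem[of x] minus_mem[of "- x"] by auto

lemma add_mem: "x \<in> K \<Longrightarrow> y \<in> K \<Longrightarrow> x + y \<in> K"
  using diff_mem[of x "- y"] minus_mem by simp

lemma diff_swap: "x - y \<in> K \<longleftrightarrow> y - x \<in> K"
  using minus_mem[of "x - y"] minus_mem[of "y - x"] by auto

lemma diff_trans: "x - y \<in> K \<Longrightarrow> y - z \<in> K \<Longrightarrow> x - z \<in> K"
  using add_mem[of "x - y" "y - z"] by simp

lemma add_mem_cancel: "y \<in> K \<Longrightarrow> x + y \<in> K \<longleftrightarrow> x \<in> K"
  using add_mem[of x y] diff_mem[of "x + y" y] by auto

lemma of_nat_mult_mem: "x \<in> K \<Longrightarrow> of_nat k * x \<in> K"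
  by (induction k) (auto simp: zero_mem distrib_right intro: add_mem)

section \<open>Coset representatives\<close>

definition rep :: "'a \<Rightarrow> 'a" where
  "rep x = (SOME r. r - x \<in> K)"

lemma rep_diff: "rep x - x \<in> K"
  unfolding rep_def by (rule someI[where x = x]) (simp add: zero_mem)

lemma rep_eq_iff: "rep x = rep y \<longleftrightarrow> x - y \<in> K"
proof
  assume "rep x = rep y"
  then show "x - y \<in> K"
    using rep_diff[of x] rep_diff[of y] diff_swap diff_trans by metis
next
  assume "x - y \<in> K"
  \<comment> \<open>The two choice predicates are the same function, so they choose the same
    element.\<close>
  then have "(\<lambda>r. r - x \<in> K) = (\<lambda>r. r - y \<in> K)"
    using diff_trans diff_swap by blast
  then show "rep x = rep y"
    by (simp add: rep_def)
qed

lemma rep_rep: "rep (rep x) = rep x"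
  by (simp add: rep_eq_iff rep_diff)

definition reps :: "'a set" where
  "reps = range rep"

lemma rep_in_reps [simp]: "rep x \<in> reps"
  by (simp add: reps_def)

lemma rep_of_reps: "r \<in> reps \<Longrightarrow> rep r = r"
  by (auto simp: reps_def rep_rep)

lemma finite_reps [simp]: "finite reps"
proof -
  obtain F where F: "finite F" "\<And>x. \<exists>r\<in>F. x - r \<in> K"
    using finite_cover by blast
  have "reps \<subseteq> rep ` F"
    unfolding reps_def using F(2) by (auto simp: image_iff rep_eq_iff)
  then show ?thesis
    using F(1) finite_subset by blast
qed

definition index :: nat where
  "index = card reps"

lemma index_pos: "index > 0"
  unfolding index_def by (metis card_gt_0_iff empty_iff finite_reps rep_in_reps)

lemma sum_reps_delta:
  assumes "\<And>x y. x - y \<in> K \<Longrightarrow> f x = f y"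
  shows "(\<Sum>r\<in>reps. (if r - y \<in> K then f r else 0)) = (f y :: int)"
proof -
  have "(\<Sum>r\<in>reps. (if r - y \<in> K then f r else 0)) = (\<Sum>r\<in>reps. (if r = rep y then f r else 0))"
    by (intro sum.cong) (auto simp: rep_eq_iff[symmetric] rep_of_reps)
  also have "\<dots> = f (rep y)"
    by simp
  finally show ?thesis
    using assms rep_diff by metis
qed

lemma bij_betw_translate: "bij_betw (\<lambda>r. rep (r + y)) reps reps"
proof (rule bij_betwI[where g = "\<lambda>r. rep (r - y)"])
  fix r assume "r \<in> reps"
  then have r: "rep r = r" by (rule rep_of_reps)
  have "(rep (r + y) - y) - r \<in> K" "(rep (r - y) + y) - r \<in> K"
    using rep_diff[of "r + y"] rep_diff[of "r - y"] by (simp_all add: algebra_simps)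
  then show "rep (rep (r + y) - y) = r" "rep (rep (r - y) + y) = r"
    by (metis r rep_eq_iff)+
qed auto

lemma sum_reps_translate:
  assumes "\<And>x y. x - y \<in> K \<Longrightarrow> f x = f y"
  shows "(\<Sum>r\<in>reps. f (r + y)) = (\<Sum>r\<in>reps. f r)"
proof -
  have "(\<Sum>r\<in>reps. f (r + y)) = (\<Sum>r\<in>reps. f (rep (r + y)))"
    using assms rep_diff by (intro sum.cong) metis+
  also have "\<dots> = (\<Sum>r\<in>reps. f r)"
    by (rule sum.reindex_bij_betw[OF bij_betw_translate])
  finally show ?thesis .
qed

lemma sum_diff_mem: "finite A \<Longrightarrow> (\<And>x. x \<in> A \<Longrightarrow> f x - g x \<in> K) \<Longrightarrow> sum f A - sum g A \<in> K"
proof (induction A rule: finite_induct)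
  case (insert x A)
  have "(f x - g x) + (sum f A - sum g A) \<in> K"
    using insert by (intro add_mem) auto
  then show ?case
    using insert by (simp add: algebra_simps)
qed (simp add: zero_mem)

text \<open>Translation by \<open>x\<close> permutes the cosets, so the sum over \<open>reps\<close>
  is unchanged modulo \<open>K\<close>; on the other hand it grows by
  \<open>of_nat index * x\<close>.\<close>

lemma index_mult_mem: "of_nat index * x \<in> K"
proof -
  have "(\<Sum>r\<in>reps. r) = (\<Sum>r\<in>reps. rep (r + x))"
    by (rule sum.reindex_bij_betw[OF bij_betw_translate, symmetric])
  then have "(\<Sum>r\<in>reps. r) - (\<Sum>r\<in>reps. r + x) \<in> K"
    using sum_diff_mem[OF finite_reps, of "\<lambda>r. rep (r + x)" "\<lambda>r. r + x"] rep_diff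
    by (simp del: sum.distrib)
  then have "- (of_nat index * x) \<in> K"
    by (simp add: sum.distrib index_def)
  then show ?thesis
    by (simp add: minus_mem_iff)
qed

text \<open>Since \<open>index\<close> annihilates the quotient, an inverse of \<open>k\<close>
  modulo \<open>index\<close> undoes multiplication by \<open>k\<close>.\<close>

lemma coprime_index_inverse:
  assumes "coprime k index"
  shows "\<exists>j. \<forall>x. of_nat j * (of_nat k * x) - x \<in> K"
proof -
  obtain j where "[k * j = Suc 0] (mod index)"
    using assms coprime_iff_invertible_nat by blast
  then have "[j * k = 1] (mod index)"
    by (simp add: mult.commute)
  then obtain a b where ab: "j * k + index * a = 1 + index * b"
    using cong_iff_lin_nat by (metis mult.commute)
  have "of_nat j * (of_nat k * x) - x \<in> K" for x
  proof -
    have "(of_nat (j * k + index * a) :: 'a) * x = of_nat (1 + index * b) * x"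
      by (simp only: ab)
    then have "of_nat j * (of_nat k * x) - x = of_nat b * (of_nat index * x) - of_nat a * (of_nat index * x)"
      by (simp add: algebra_simps)
    also have "\<dots> \<in> K"
      by (intro diff_mem of_nat_mult_mem index_mult_mem)
    finally show ?thesis .
  qed
  then show ?thesis
    by blast
qed

lemma coprime_index_mem:
  assumes "coprime k index" and "of_nat k * x \<in> K"
  shows "x \<in> K"
proof -
  obtain j where "of_nat j * (of_nat k * x) - x \<in> K"
    using coprime_index_inverse[OF assms(1)] by blast
  from diff_mem[OF of_nat_mult_mem[OF assms(2), of j] this] show ?thesis
    by simp
qed

text \<open>
  The coefficient of the coset of \<open>x\<close> in the image of \<open>P\<close> under the projection of the group
  ring of \<open>'a\<close> onto that of the quotient by \<open>K\<close>.
\<close>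

definition coef :: "('a \<Rightarrow>\<^sub>0 int) \<Rightarrow> 'a \<Rightarrow> int" where
  "coef P x = poly_mapping.lookup (frag_extend (\<lambda>y. frag_of (rep y)) P) (rep x)"

lemma coef_frag_of: "coef (frag_of y) x = of_bool (x - y \<in> K)"
  by (auto simp: coef_def lookup_single rep_eq_iff diff_swap when_def)

lemma coef_0 [simp]: "coef 0 x = 0"
  by (simp add: coef_def)

lemma coef_add: "coef (P + Q) x = coef P x + coef Q x"
  by (simp add: coef_def frag_extend_add lookup_add)

lemma coef_diff: "coef (P - Q) x = coef P x - coef Q x"
  by (simp add: coef_def frag_extend_diff lookup_minus)

lemma coef_minus: "coef (- P) x = - coef P x"
  using coef_diff[of 0 P x] by simp

lemma coef_sum: "coef (\<Sum>i\<in>I. f i) x = (\<Sum>i\<in>I. coef (f i) x)"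
  by (induction I rule: infinite_finite_induct) (auto simp: coef_add)

lemma coef_of_nat_mult: "coef (of_nat k * P) x = int k * coef P x"
  by (induction k) (auto simp: coef_add distrib_right)

lemma coef_of_int_mult: "coef (of_int k * P) x = k * coef P x"
  by (cases k rule: int_cases2) (simp_all add: coef_minus coef_of_nat_mult)

lemma coef_numeral_mult: "coef (numeral k * P) x = numeral k * coef P x"
  using coef_of_int_mult[of "numeral k" P x] by simp

lemma coef_1: "coef 1 x = of_bool (x \<in> K)"
  using coef_frag_of[of 0 x] by simp

lemma coef_of_int: "coef (of_int k) x = k * of_bool (x \<in> K)"
  using coef_of_int_mult[of k 1 x] by (simp add: coef_1)

lemma coef_of_nat: "coef (of_nat k) x = int k * of_bool (x \<in> K)"
  using coef_of_int[of "int k" x] by simp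

lemma coef_cong: "x - y \<in> K \<Longrightarrow> coef P x = coef P y"
  unfolding coef_def by (metis rep_eq_iff)

lemma coef_frag_mult: "coef (frag_of y * Q) x = coef Q (x - y)"
  by (induction Q rule: frag_induct)
    (simp_all add: mult_single coef_frag_of right_diff_distrib coef_diff algebra_simps)

lemma coef_mult: "coef (P * Q) x = (\<Sum>r\<in>reps. coef P r * coef Q (x - r))"
proof (induction P rule: frag_induct)
  case (one y)
  have "coef Q (x - r) = coef Q (x - r')" if "r - r' \<in> K" for r r'
    using that by (intro coef_cong) (simp add: diff_swap)
  from sum_reps_delta[of "\<lambda>r. coef Q (x - r)" y, OF this]
  show ?case
    by (simp add: coef_frag_mult coef_frag_of of_bool_def if_distrib[of "\<lambda>u. u * _"] cong: if_cong)
next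
  case (diff a b)
  then show ?case
    by (simp add: left_diff_distrib coef_diff sum_subtractf)
qed simp

section \<open>Augmentation and congruence up to constants\<close>

definition aug :: "('a \<Rightarrow>\<^sub>0 int) \<Rightarrow> int" where
  "aug P = (\<Sum>r\<in>reps. coef P r)"

lemma aug_frag_of [simp]: "aug (frag_of y) = 1"
  using sum_reps_delta[of "\<lambda>_. 1" y] by (simp add: aug_def coef_frag_of of_bool_def)

lemma aug_add: "aug (P + Q) = aug P + aug Q"
  by (simp add: aug_def coef_add sum.distrib)

lemma aug_diff: "aug (P - Q) = aug P - aug Q"
  by (simp add: aug_def coef_diff sum_subtractf)

lemma aug_minus: "aug (- P) = - aug P"
  by (simp add: aug_def coef_minus sum_negf)

lemma aug_0 [simp]: "aug 0 = 0"
  by (simp add: aug_def)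

lemma aug_1 [simp]: "aug 1 = 1"
  using aug_frag_of[of 0] by simp

lemma aug_sum: "aug (\<Sum>i\<in>I. f i) = (\<Sum>i\<in>I. aug (f i))"
  by (induction I rule: infinite_finite_induct) (auto simp: aug_add)

lemma aug_mult: "aug (P * Q) = aug P * aug Q"
proof (induction P rule: frag_induct)
  case (one y)
  have "(\<Sum>r\<in>reps. coef Q (r + - y)) = (\<Sum>r\<in>reps. coef Q r)"
    by (rule sum_reps_translate) (rule coef_cong)
  then show ?case
    by (simp add: aug_def[of "_ * _"] aug_def[of Q] coef_frag_mult)
qed (simp_all add: left_diff_distrib aug_diff)

lemma aug_power: "aug (P ^ k) = aug P ^ k"
  by (induction k) (simp_all add: aug_mult)

lemma aug_of_nat [simp]: "aug (of_nat k) = int k"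
  by (induction k) (simp_all add: aug_add)

lemma aug_of_int [simp]: "aug (of_int k) = k"
  by (cases k rule: int_cases2) (simp_all add: aug_minus)

text \<open>A lift of the sum of all elements of the quotient, the \<open>H\<close> in the relations
  of the overview.\<close>

definition coset_sum :: "'a \<Rightarrow>\<^sub>0 int" where
  "coset_sum = (\<Sum>r\<in>reps. frag_of r)"

lemma coef_coset_sum [simp]: "coef coset_sum x = 1"
  using sum_reps_delta[of "\<lambda>_. 1" x]
  by (simp add: coset_sum_def coef_sum coef_frag_of of_bool_def diff_swap[of x])

lemma coef_coset_sum_mult: "coef (coset_sum * P) x = aug P"
proof -
  have "coef (P * coset_sum) x = aug P"
    by (simp add: coef_mult aug_def)
  then show ?thesis
    by (simp add: mult.commute)
qed

text \<open>The kernel of the projection onto the group ring of the quotient.\<close>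

definition null :: "('a \<Rightarrow>\<^sub>0 int) \<Rightarrow> bool" where
  "null P \<longleftrightarrow> (\<forall>x. coef P x = 0)"

text \<open>
  Congruence modulo \<open>m\<close> to a multiple of \<open>coset_sum\<close>; for \<open>m = 0\<close> this is equality.
\<close>

definition const_mod :: "int \<Rightarrow> ('a \<Rightarrow>\<^sub>0 int) \<Rightarrow> bool" where
  "const_mod m P \<longleftrightarrow> (\<exists>k. \<forall>x. [coef P x = k] (mod m))"

lemma null_coef_mult: "null P \<Longrightarrow> coef (P * Q) x = 0"
  by (simp add: null_def coef_mult)

lemma const_modI: "(\<And>x. coef P x = k) \<Longrightarrow> const_mod m P"
  unfolding const_mod_def by (metis cong_refl)

lemma const_mod_multiple: "const_mod m (of_int m * P)"
  by (auto simp: const_mod_def coef_of_int_mult cong_def intro!: exI[of _ 0])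

lemma const_mod_add: "const_mod m P \<Longrightarrow> const_mod m Q \<Longrightarrow> const_mod m (P + Q)"
  unfolding const_mod_def coef_add by (meson cong_add)

lemma const_mod_diff: "const_mod m P \<Longrightarrow> const_mod m Q \<Longrightarrow> const_mod m (P - Q)"
  unfolding const_mod_def coef_diff by (meson cong_diff)

text \<open>A product with \<open>coset_sum\<close> sees only the augmentation of the other factor,
  so these elements form an ideal and the relations can be handled as polynomial
  congruences.\<close>

lemma const_mod_mult: "const_mod m P \<Longrightarrow> const_mod m (P * Q)"
proof -
  assume "const_mod m P"
  then obtain k where k: "\<And>x. [coef P x = k] (mod m)"
    by (auto simp: const_mod_def)
  have "[coef (P * Q) x = k * aug Q] (mod m)" for x
    unfolding mult.commute[of P] coef_mult mult.commute[of k] aug_def sum_distrib_right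
    by (intro cong_sum cong_mult k) simp
  then show ?thesis
    by (auto simp: const_mod_def)
qed

end

section \<open>Dilations and reflections\<close>

definition dilate :: "nat \<Rightarrow> ('a::comm_ring_1 \<Rightarrow>\<^sub>0 int) \<Rightarrow> ('a \<Rightarrow>\<^sub>0 int)" where
  "dilate k = frag_extend (\<lambda>y. frag_of (of_nat k * y))"

lemma dilate_frag_of [simp]: "dilate k (frag_of y) = frag_of (of_nat k * y)"
  by (simp add: dilate_def)

lemma dilate_0 [simp]: "dilate k 0 = 0"
  by (simp add: dilate_def)

lemma dilate_add: "dilate k (P + Q) = dilate k P + dilate k Q"
  by (simp add: dilate_def frag_extend_add)

lemma dilate_diff: "dilate k (P - Q) = dilate k P - dilate k Q"
  by (simp add: dilate_def frag_extend_diff)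

lemma dilate_minus: "dilate k (- P) = - dilate k P"
  using dilate_diff[of k 0 P] by simp

lemma dilate_1 [simp]: "dilate k 1 = 1"
  using dilate_frag_of[of k 0] by simp

lemma dilate_sum: "dilate k (\<Sum>i\<in>I. f i) = (\<Sum>i\<in>I. dilate k (f i))"
  by (induction I rule: infinite_finite_induct) (auto simp: dilate_add)

lemma dilate_of_nat [simp]: "dilate k (of_nat m) = of_nat m"
  by (induction m) (auto simp: dilate_add)

lemma dilate_of_int [simp]: "dilate k (of_int m) = of_int m"
  by (cases m rule: int_cases2) (simp_all add: dilate_minus)

lemma dilate_numeral [simp]: "dilate k (numeral m) = numeral m"
  using dilate_of_int[of k "numeral m"] by simp

text \<open>Multiplication by \<open>k\<close> is an endomorphism of the additive group, so it
  induces a ring endomorphism of the group ring.\<close>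

lemma dilate_mult: "dilate k (P * Q) = dilate k P * dilate k Q"
proof (induction P rule: frag_induct)
  case (one y)
  show ?case
    by (induction Q rule: frag_induct)
      (simp_all add: mult_single dilate_diff right_diff_distrib distrib_left)
qed (simp_all add: dilate_diff left_diff_distrib)

lemma dilate_dilate: "dilate k (dilate l P) = dilate (k * l) P"
  by (induction P rule: frag_induct) (simp_all add: dilate_diff mult.assoc)

text \<open>The standard involution of the group ring; it fixes sums over symmetric sets.\<close>

definition reflect :: "('a::comm_ring_1 \<Rightarrow>\<^sub>0 int) \<Rightarrow> ('a \<Rightarrow>\<^sub>0 int)" where
  "reflect = frag_extend (\<lambda>y. frag_of (- y))"

lemma reflect_frag_of [simp]: "reflect (frag_of y) = frag_of (- y)"
  by (simp add: reflect_def)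

lemma reflect_0 [simp]: "reflect 0 = 0"
  by (simp add: reflect_def)

lemma reflect_add: "reflect (P + Q) = reflect P + reflect Q"
  by (simp add: reflect_def frag_extend_add)

lemma reflect_diff: "reflect (P - Q) = reflect P - reflect Q"
  by (simp add: reflect_def frag_extend_diff)

lemma reflect_sum: "reflect (\<Sum>i\<in>I. f i) = (\<Sum>i\<in>I. reflect (f i))"
  by (induction I rule: infinite_finite_induct) (auto simp: reflect_add)

lemma reflect_mult: "reflect (P * Q) = reflect P * reflect Q"
proof (induction P rule: frag_induct)
  case (one y)
  show ?case
    by (induction Q rule: frag_induct) (simp_all add: mult_single reflect_diff right_diff_distrib)
qed (simp_all add: reflect_diff left_diff_distrib)

lemma reflect_dilate: "reflect (dilate k P) = dilate k (reflect P)"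
  by (induction P rule: frag_induct) (simp_all add: reflect_diff dilate_diff)

context finite_index_subgroup
begin

text \<open>For \<open>k\<close> coprime to the index, multiplication by \<open>k\<close> is
  injective on cosets, so that a dilation only permutes coefficients.\<close>

lemma coef_dilate:
  assumes "coprime k index"
  shows "coef (dilate k P) (of_nat k * x) = coef P x"
proof (induction P rule: frag_induct)
  case (one y)
  have "of_nat k * x - of_nat k * y \<in> K \<longleftrightarrow> x - y \<in> K"
    using coprime_index_mem[OF assms, of "x - y"] of_nat_mult_mem[of "x - y" k]
    by (auto simp: right_diff_distrib)
  then show ?case
    by (simp add: coef_frag_of)
qed (simp_all add: dilate_diff coef_diff)

lemma coprime_index_surj:
  assumes "coprime k index"
  obtains y where "x - of_nat k * y \<in> K"
proof -
  obtain j where "\<And>x. of_nat j * (of_nat k * x) - x \<in> K"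
    using coprime_index_inverse[OF assms] by blast
  then have "x - of_nat k * (of_nat j * x) \<in> K"
    by (subst diff_swap) (metis mult.left_commute)
  then show ?thesis
    by (rule that)
qed

lemma coef_dilate_ex:
  assumes "coprime k index"
  obtains y where "\<And>P. coef (dilate k P) x = coef P y"
proof -
  obtain y where "x - of_nat k * y \<in> K"
    using assms by (rule coprime_index_surj)
  then have "coef (dilate k P) x = coef P y" for P
    using coef_cong coef_dilate[OF assms] by metis
  then show ?thesis
    by (rule that)
qed

lemma null_dilate: "coprime k index \<Longrightarrow> null P \<Longrightarrow> null (dilate k P)"
  unfolding null_def by (metis coef_dilate_ex)

lemma aug_dilate [simp]: "aug (dilate k P) = aug P"
  by (induction P rule: frag_induct) (simp_all add: dilate_diff aug_diff)

lemma coef_reflect: "coef (reflect P) x = coef P (- x)"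
proof (induction P rule: frag_induct)
  case (one y)
  have "x - - y \<in> K \<longleftrightarrow> - x - y \<in> K"
    using minus_mem_iff[of "x + y"] by simp
  then show ?case
    by (simp add: coef_frag_of)
qed (simp_all add: reflect_diff coef_diff)

text \<open>With \<open>Q\<close> symmetric, convolution at \<open>0\<close> becomes a scalar
  product of coefficient vectors. The second moments below are computed in this way.\<close>

lemma sum_coef_mult_coef:
  assumes "reflect Q = Q"
  shows "(\<Sum>r\<in>reps. coef P r * coef Q r) = coef (P * Q) 0"
  using coef_reflect[of Q] assms by (simp add: coef_mult)

end

section \<open>Frobenius congruences\<close>

lemma power_add_prime:
  fixes x y :: "'a::comm_ring_1"
  assumes "prime p"
  obtains w where "(x + y) ^ p = x ^ p + y ^ p + of_nat p * w"
proof -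
  have "\<exists>w. of_nat (p choose k) * x ^ k * y ^ (p - k) = of_nat p * w" if "k \<in> {..p} - {0, p}" for k
  proof -
    \<comment> \<open>The inner binomial coefficients are multiples of \<open>p\<close>.\<close>
    have "p dvd (p choose k)"
      using that assms by (intro dvd_choose_prime) auto
    then obtain j where "p choose k = p * j" by blast
    then have "of_nat (p choose k) * x ^ k * y ^ (p - k) = of_nat p * (of_nat j * x ^ k * y ^ (p - k))"
      by (simp add: mult.assoc)
    then show ?thesis by blast
  qed
  then obtain w where w: "\<And>k. k \<in> {..p} - {0, p} \<Longrightarrow> of_nat (p choose k) * x ^ k * y ^ (p - k) = of_nat p * w k"
    by metis
  have p: "p \<noteq> 0" using assms by auto
  have "(x + y) ^ p = (\<Sum>k\<le>p. of_nat (p choose k) * x ^ k * y ^ (p - k))"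
    by (rule binomial_ring)
  also have "\<dots> = (\<Sum>k\<in>{0, p}. of_nat (p choose k) * x ^ k * y ^ (p - k))
      + (\<Sum>k\<in>{..p} - {0, p}. of_nat (p choose k) * x ^ k * y ^ (p - k))"
    by (subst add.commute, rule sum.subset_diff) auto
  also have "(\<Sum>k\<in>{..p} - {0, p}. of_nat (p choose k) * x ^ k * y ^ (p - k)) = of_nat p * (\<Sum>k\<in>{..p} - {0, p}. w k)"
    using w by (simp add: sum_distrib_left)
  also have "(\<Sum>k\<in>{0, p}. of_nat (p choose k) * x ^ k * y ^ (p - k)) = x ^ p + y ^ p"
    using p by (simp add: add.commute)
  finally show ?thesis
    by (rule that)
qed

lemma power_sum_prime:
  fixes f :: "'b \<Rightarrow> 'a::comm_ring_1"
  assumes "prime p" and "finite I"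
  obtains w where "(\<Sum>i\<in>I. f i) ^ p = (\<Sum>i\<in>I. f i ^ p) + of_nat p * w"
proof -
  have "\<exists>w. (\<Sum>i\<in>I. f i) ^ p = (\<Sum>i\<in>I. f i ^ p) + of_nat p * w"
    using assms(2)
  proof (induction I rule: finite_induct)
    case empty
    show ?case
      using prime_gt_0_nat[OF assms(1)] by (auto simp: zero_power intro!: exI[of _ 0])
  next
    case (insert i I)
    then obtain w where w: "(\<Sum>i\<in>I. f i) ^ p = (\<Sum>i\<in>I. f i ^ p) + of_nat p * w"
      by blast
    obtain u where "(f i + (\<Sum>i\<in>I. f i)) ^ p = f i ^ p + (\<Sum>i\<in>I. f i) ^ p + of_nat p * u"
      using assms(1) by (rule power_add_prime)
    then show ?case
      using insert w by (auto simp: algebra_simps intro!: exI[of _ "u + w"])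
  qed
  then show ?thesis
    using that by blast
qed

lemma frag_of_power: "frag_of (y::'a::comm_ring_1) ^ k = frag_of (of_nat k * y)"
  by (induction k) (simp_all add: mult_single distrib_right)

definition set_sum :: "'a set \<Rightarrow> ('a::comm_ring_1 \<Rightarrow>\<^sub>0 int)" where
  "set_sum A = (\<Sum>a\<in>A. frag_of a)"

text \<open>The \<open>p\<close>-th power of a single group element is its multiple by
  \<open>p\<close>, and taking \<open>p\<close>-th powers is additive modulo
  \<open>p\<close>.\<close>

lemma set_sum_power_prime:
  assumes "prime p" and "finite A"
  obtains w where "set_sum A ^ p = dilate p (set_sum A) + of_nat p * w"
proof -
  obtain w where "(\<Sum>a\<in>A. frag_of a) ^ p = (\<Sum>a\<in>A. frag_of a ^ p) + of_nat p * w"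
    using assms by (rule power_sum_prime)
  then show ?thesis
    by (intro that[of w]) (simp add: set_sum_def frag_of_power dilate_sum)
qed

lemma reflect_set_sum:
  assumes "\<And>x. x \<in> A \<Longrightarrow> - x \<in> A"
  shows "reflect (set_sum A) = set_sum A"
proof -
  have "bij_betw uminus A A"
    by (rule bij_betwI[where g = uminus]) (use assms in auto)
  from sum.reindex_bij_betw[OF this, of frag_of] show ?thesis
    by (simp add: set_sum_def reflect_sum)
qed

context finite_index_subgroup
begin

lemma aug_set_sum: "aug (set_sum A) = int (card A)"
  by (simp add: set_sum_def aug_sum)

lemma coef_set_sum: "finite A \<Longrightarrow> coef (set_sum A) x = int (card {a \<in> A. x - a \<in> K})"
  by (simp add: set_sum_def coef_sum coef_frag_of of_bool_def sum.If_cases Int_def)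

lemma coef_dilate_set_sum_nonneg: "coef (dilate k (set_sum A)) x \<ge> 0"
  by (auto simp: set_sum_def dilate_sum coef_sum coef_frag_of intro!: sum_nonneg)

lemma coef_mult_nonneg: "(\<And>x. coef P x \<ge> 0) \<Longrightarrow> (\<And>x. coef Q x \<ge> 0) \<Longrightarrow> coef (P * Q) x \<ge> 0"
  by (simp add: coef_mult sum_nonneg)

text \<open>Summation over the quotient equates \<open>index\<close> times the constant with the
  augmentation modulo \<open>m\<close>; as \<open>index\<close> is a unit modulo \<open>m\<close>,
  this fixes the constant.\<close>

lemma const_mod_residue:
  assumes "const_mod m P" and "[int index * k = aug P] (mod m)" and "coprime (int index) m"
  shows "[coef P x = k] (mod m)"
proof -
  obtain l where l: "\<And>x. [coef P x = l] (mod m)"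
    using assms(1) by (auto simp: const_mod_def)
  have "[aug P = (\<Sum>r\<in>reps. l)] (mod m)"
    unfolding aug_def by (intro cong_sum l)
  then have "[aug P = int index * l] (mod m)"
    by (simp add: index_def)
  from cong_sym[OF cong_trans[OF assms(2) this]]
  have "[int index * l = int index * k] (mod m)" .
  then have "[l = k] (mod m)"
    using assms(3) cong_mult_lcancel by blast
  then show ?thesis
    using l cong_trans by blast
qed

end

section \<open>Pairs of symmetric sets\<close>

text \<open>Here \<open>b\<close>, \<open>c\<close>, \<open>s\<close> stand for \<open>B2\<close>,
  \<open>B4\<close> and \<open>2 n\<close>. The factors \<open>b ^ 2 - s + 2 + c\<close>,
  \<open>x ^ 2 + y ^ 2 + b - s\<close> and \<open>x * y + 1\<close> are relations known to be
  constant, so the right side is constant as well.\<close>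

lemma quintic_expansion:
  fixes x y b c s :: "'b::comm_ring_1"
  shows "(b ^ 2 - s + 2 + c) * x
      + (x ^ 2 + y ^ 2 + b - s) * (2 * x * (x ^ 2 + y ^ 2) - x * (x ^ 2 + y ^ 2 + b - s) + y)
      - (x * y + 1) * (x * (2 * (x * y + 1) - 3) + y ^ 3)
    = x * c + 2 * s * x * b + y * b + x ^ 5 - (s ^ 2 + s - 3) * x - s * y"
  by (simp add: algebra_simps eval_nat_numeral)

text \<open>The quotient by \<open>K\<close> is the group \<open>H\<close> of the overview, and
  \<open>prod_UV\<close>, \<open>squares_UV\<close> are its two relations. A symmetric set contains
  \<open>0\<close> exactly if its size is odd, whence \<open>zero_in_odd\<close>; the position of
  \<open>0\<close> matters for \<open>n = 3\<close> and \<open>n = 23\<close>.\<close>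

locale lee_pair = finite_index_subgroup K for K :: "'a::comm_ring_1 set" +
  fixes n :: nat and U V :: "'a set"
  assumes finite_U: "finite U" and finite_V: "finite V"
    and card_U: "card U = n" and card_V: "card V = n + 1"
    and index_eq: "index = n ^ 2 + n + 1"
    and minus_U: "x \<in> U \<Longrightarrow> - x \<in> U" and minus_V: "x \<in> V \<Longrightarrow> - x \<in> V"
    and distinct: "x \<in> U \<union> V \<Longrightarrow> y \<in> U \<union> V \<Longrightarrow> x - y \<in> K \<Longrightarrow> x = y"
    and disjoint: "U \<inter> V = {}"
    and zero_in: "0 \<in> U \<union> V" and zero_in_odd: "odd n \<Longrightarrow> 0 \<in> U"
    and prod_UV: "coef (set_sum U * set_sum V) x = 1 - of_bool (x \<in> K)"
    and squares_UV: "coef (set_sum U ^ 2 + set_sum V ^ 2 + dilate 2 (set_sum U + set_sum V)) x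
      = 2 + 2 * int n * of_bool (x \<in> K)"
begin

abbreviation "u \<equiv> set_sum U"
abbreviation "v \<equiv> set_sum V"
abbreviation "B \<equiv> u + v"
abbreviation "B2 \<equiv> dilate 2 B"
abbreviation "B4 \<equiv> dilate 4 B"
abbreviation "B8 \<equiv> dilate 8 B"
abbreviation "s \<equiv> of_nat (2 * n) :: 'a \<Rightarrow>\<^sub>0 int"

lemma coprime_index_two: "coprime 2 index"
  by (simp add: index_eq power2_eq_square)

lemma coprime_index_four: "coprime 4 index"
proof -
  have "coprime (2 ^ 2) index"
    using coprime_index_two coprime_power_left_iff by blast
  then show ?thesis by simp
qed

lemma reflect_u: "reflect u = u" and reflect_v: "reflect v = v"
  using minus_U minus_V by (simp_all add: reflect_set_sum)

lemma aug_u [simp]: "aug u = int n" and aug_v [simp]: "aug v = int n + 1"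
  by (simp_all add: aug_set_sum card_U card_V)

lemma null_prod: "null (u * v - coset_sum + 1)"
  by (simp add: null_def coef_add coef_diff prod_UV coef_1)

lemma null_squares: "null (u ^ 2 + v ^ 2 + B2 - 2 * coset_sum - s)"
  using squares_UV by (simp add: null_def coef_add coef_diff coef_numeral_mult coef_of_nat)

lemma null_add: "null P \<Longrightarrow> null Q \<Longrightarrow> null (P + Q)"
  by (simp add: null_def coef_add)

lemma null_mult: "null P \<Longrightarrow> null (P * Q)"
  using null_coef_mult by (simp add: null_def)

lemma null_const_mod: "null P \<Longrightarrow> const_mod m P"
  by (auto simp: null_def intro: const_modI)

text \<open>Twice the product relation completes the sum of squares to \<open>B ^ 2\<close>. Up to
  \<open>coset_sum\<close> this reads \<open>B2 = 2 n - 2 - B ^ 2\<close>: doubling acts on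
  \<open>B\<close> as a quadratic polynomial.\<close>

lemma null_B_square: "null (B ^ 2 - 4 * coset_sum - s + 2 + B2)"
proof -
  have "null ((u ^ 2 + v ^ 2 + B2 - 2 * coset_sum - s) + (u * v - coset_sum + 1) * 2)"
    by (intro null_add null_mult null_prod null_squares)
  then show ?thesis
    by (simp add: algebra_simps power2_eq_square)
qed

text \<open>The dilated representatives again meet each coset once but need not be the chosen ones,
  hence equality only up to \<open>null\<close>.\<close>

lemma null_dilate_coset_sum: "coprime k index \<Longrightarrow> null (dilate k coset_sum - coset_sum)"
  unfolding null_def by (metis coef_coset_sum coef_diff coef_dilate_ex diff_self)

lemma null_dilate_B_square:
  assumes "coprime k index"
  shows "null (dilate k B ^ 2 - 4 * coset_sum - s + 2 + dilate (2 * k) B)"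
proof -
  have "null (dilate k (B ^ 2 - 4 * coset_sum - s + 2 + B2) + (dilate k coset_sum - coset_sum) * 4)"
    using assms by (intro null_add null_mult null_dilate null_B_square null_dilate_coset_sum)
  then show ?thesis
    by (simp add: power2_eq_square dilate_mult dilate_add dilate_diff dilate_dilate algebra_simps
        del: of_nat_mult)
qed

lemma const_mod_coset_sum_mult: "const_mod m (coset_sum * P)"
  by (rule const_modI) (rule coef_coset_sum_mult)

lemma const_prod: "const_mod m (u * v + 1)"
proof -
  have "const_mod m ((u * v - coset_sum + 1) + coset_sum * 1)"
    by (intro const_mod_add null_const_mod null_prod const_mod_coset_sum_mult)
  then show ?thesis by simp
qed

lemma const_squares: "const_mod m (u ^ 2 + v ^ 2 + B2 - s)"
proof -
  have "const_mod m ((u ^ 2 + v ^ 2 + B2 - 2 * coset_sum - s) + coset_sum * 2)"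
    by (intro const_mod_add null_const_mod null_squares const_mod_coset_sum_mult)
  then show ?thesis by (simp add: algebra_simps)
qed

lemma const_dilate_B_square:
  assumes "coprime k index"
  shows "const_mod m (dilate k B ^ 2 - s + 2 + dilate (2 * k) B)"
proof -
  have "const_mod m ((dilate k B ^ 2 - 4 * coset_sum - s + 2 + dilate (2 * k) B) + coset_sum * 4)"
    by (intro const_mod_add null_const_mod null_dilate_B_square assms const_mod_coset_sum_mult)
  then show ?thesis by (simp add: algebra_simps)
qed

lemma const_B2_square: "const_mod m (B2 ^ 2 - s + 2 + B4)"
  using const_dilate_B_square[OF coprime_index_two] by simp

text \<open>The square relation times \<open>x\<close>, with \<open>x * y ^ 2\<close> replaced by
  \<open>- y\<close> through the product relation.\<close>

lemma cubic_identity: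
  "const_mod m (x * B2 - s * x - y + x ^ 3)" if "(x, y) = (u, v) \<or> (x, y) = (v, u)"
proof -
  have XY: "const_mod m (x * y + 1)" "const_mod m (x ^ 2 + y ^ 2 + B2 - s)"
    using that const_prod const_squares by (auto simp: algebra_simps)
  have "const_mod m ((x ^ 2 + y ^ 2 + B2 - s) * x - (x * y + 1) * y)"
    by (intro const_mod_diff const_mod_mult XY)
  also have "(x ^ 2 + y ^ 2 + B2 - s) * x - (x * y + 1) * y = x * B2 - s * x - y + x ^ 3"
    by (simp add: algebra_simps power2_eq_square power3_eq_cube)
  finally show ?thesis .
qed

text \<open>In \<open>x * B4 = (s - 2) * x - x * B2 ^ 2\<close>, valid up to constants,
  \<open>(B2 - s) ^ 2\<close> becomes \<open>(x ^ 2 + y ^ 2) ^ 2\<close>. Times \<open>x\<close> and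
  with \<open>x * y = - 1\<close> this is \<open>x ^ 5 + 2 * x - y ^ 3\<close>, and
  \<open>y ^ 3\<close> is removed by the cubic identity for \<open>y\<close>.\<close>

lemma quintic_identity:
  "const_mod m (x * B4 + 2 * s * x * B2 + y * B2 + x ^ 5 - (s ^ 2 + s - 3) * x - s * y)"
  if "(x, y) = (u, v) \<or> (x, y) = (v, u)"
proof -
  define X where "X = x * y + 1"
  define Y where "Y = x ^ 2 + y ^ 2 + B2 - s"
  define Z where "Z = B2 ^ 2 - s + 2 + B4"
  have XY: "const_mod m X" "const_mod m Y" "const_mod m Z"
    using that const_prod const_squares const_B2_square by (auto simp: X_def Y_def Z_def algebra_simps)
  have "const_mod m (Z * x + Y * (2 * x * (x ^ 2 + y ^ 2) - x * Y + y) - X * (x * (2 * X - 3) + y ^ 3))"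
    by (intro const_mod_diff const_mod_add const_mod_mult XY)
  also have "Z * x + Y * (2 * x * (x ^ 2 + y ^ 2) - x * Y + y) - X * (x * (2 * X - 3) + y ^ 3)
    = x * B4 + 2 * s * x * B2 + y * B2 + x ^ 5 - (s ^ 2 + s - 3) * x - s * y"
    unfolding X_def Y_def Z_def by (rule quintic_expansion)
  finally show ?thesis .
qed

end

section \<open>Coefficients and their moments\<close>

context lee_pair
begin

lemma B_eq_set_sum: "B = set_sum (U \<union> V)"
  unfolding set_sum_def using finite_U finite_V disjoint by (simp add: sum.union_disjoint)

lemma reflect_B: "reflect B = B"
  by (simp add: reflect_add reflect_u reflect_v)

lemma coef_u_nonneg: "coef u x \<ge> 0" and coef_v_nonneg: "coef v x \<ge> 0"
  by (simp_all add: coef_set_sum finite_U finite_V)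

lemma coef_B_nonneg: "coef B x \<ge> 0"
  by (simp add: coef_add coef_u_nonneg coef_v_nonneg)

lemma coef_B_le: "coef B x \<le> 1"
proof -
  have "card {a \<in> U \<union> V. x - a \<in> K} \<le> 1"
  proof (rule card_le_Suc0_iff_eq[THEN iffD2, unfolded One_nat_def[symmetric]])
    show "\<forall>a\<in>{a \<in> U \<union> V. x - a \<in> K}. \<forall>b\<in>{a \<in> U \<union> V. x - a \<in> K}. a = b"
      using distinct diff_swap diff_trans by blast
  qed (use finite_U finite_V in simp)
  then show ?thesis
    unfolding B_eq_set_sum by (simp add: coef_set_sum finite_U finite_V)
qed

lemma coef_B_0: "coef B 0 = 1"
proof -
  have "0 \<in> {a \<in> U \<union> V. 0 - a \<in> K}"
    using zero_in zero_mem by simp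
  then have "card {a \<in> U \<union> V. 0 - a \<in> K} > 0"
    using finite_U finite_V card_gt_0_iff by (metis (no_types, lifting) empty_iff finite_Un finite_subset mem_Collect_eq subsetI)
  then have "coef B 0 \<ge> 1"
    unfolding B_eq_set_sum using finite_U finite_V by (simp add: coef_set_sum)
  then show ?thesis
    using coef_B_le[of 0] by simp
qed

lemma coef_dilate_0: "coprime k index \<Longrightarrow> coef (dilate k P) 0 = coef P 0"
  using coef_dilate[of k P 0] by simp

lemma coef_dilate_B_le: "coprime k index \<Longrightarrow> coef (dilate k u) x + coef (dilate k v) x \<le> 1"
  by (metis coef_B_le coef_add coef_dilate_ex)

lemma coef_dilate_B_nonneg: "coef (dilate k B) x \<ge> 0"
  unfolding dilate_add coef_add by (intro add_nonneg_nonneg coef_dilate_set_sum_nonneg)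

text \<open>Up to \<open>null\<close>, \<open>u * v\<close> is \<open>coset_sum - 1\<close>, and all
  coefficients of a product with \<open>coset_sum\<close> equal the augmentation of the other
  factor. The next two lemmas substitute the other relations likewise.\<close>

lemma coef_prod_mult: "coef (u * v * Y) 0 = aug Y - coef Y 0"
proof -
  have "u * v * Y = (u * v - coset_sum + 1) * Y + coset_sum * Y - Y"
    by (simp add: algebra_simps)
  then show ?thesis
    by (simp only: coef_add coef_diff null_coef_mult[OF null_prod] coef_coset_sum_mult)
qed

lemma coef_squares_mult:
  "coef ((u ^ 2 + v ^ 2) * Y) 0 = 2 * aug Y + 2 * int n * coef Y 0 - coef (B2 * Y) 0"
proof -
  have "(u ^ 2 + v ^ 2) * Y = (u ^ 2 + v ^ 2 + B2 - 2 * coset_sum - s) * Y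
      + 2 * (coset_sum * Y) + of_nat (2 * n) * Y - B2 * Y"
    by (simp add: algebra_simps)
  then show ?thesis
    by (simp add: coef_add coef_diff null_coef_mult[OF null_squares] coef_coset_sum_mult
        coef_of_nat_mult coef_numeral_mult del: of_nat_mult)
qed

lemma coef_dilate_B_square_mult:
  assumes "coprime k index"
  shows "coef (dilate k B ^ 2 * Y) 0
    = 4 * aug Y + (2 * int n - 2) * coef Y 0 - coef (dilate (2 * k) B * Y) 0"
proof -
  have "dilate k B ^ 2 * Y = (dilate k B ^ 2 - 4 * coset_sum - s + 2 + dilate (2 * k) B) * Y
      + 4 * (coset_sum * Y) + of_nat (2 * n) * Y - 2 * Y - dilate (2 * k) B * Y"
    by (simp add: algebra_simps)
  then show ?thesis
    by (simp only: coef_add coef_diff null_coef_mult[OF null_dilate_B_square[OF assms]]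
        coef_coset_sum_mult coef_of_nat_mult coef_numeral_mult) (simp add: algebra_simps)
qed

definition a :: "'a \<Rightarrow> int" where "a x = coef (u * B2) x"
definition b :: "'a \<Rightarrow> int" where "b x = coef (v * B2) x"
definition d :: "'a \<Rightarrow> int" where "d x = coef (u * B4) x"
definition e :: "'a \<Rightarrow> int" where "e x = coef (v * B4) x"

lemma aug_B [simp]: "aug (dilate k B) = 2 * int n + 1"
  by (simp add: aug_add)

lemma nonneg: "a x \<ge> 0" "b x \<ge> 0" "d x \<ge> 0" "e x \<ge> 0"
  unfolding a_def b_def d_def e_def
  by (intro coef_mult_nonneg coef_u_nonneg coef_v_nonneg coef_dilate_B_nonneg)+

lemma sum_a: "sum a reps = int n * (2 * int n + 1)"
  and sum_b: "sum b reps = (int n + 1) * (2 * int n + 1)"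
  and sum_d: "sum d reps = int n * (2 * int n + 1)"
  and sum_e: "sum e reps = (int n + 1) * (2 * int n + 1)"
  unfolding a_def b_def d_def e_def aug_def[symmetric] by (simp_all only: aug_mult aug_u aug_v aug_B)

lemma reflect_dilate_B: "reflect (dilate k B) = dilate k B"
  by (simp only: reflect_dilate reflect_B)

lemma coef_B2_square_0: "coef (B2 ^ 2) 0 = 2 * int n + 1"
  using coef_dilate_B_square_mult[OF coprime_index_two, of 1]
  by (simp add: coef_1 zero_mem coef_dilate_0 coprime_index_four coef_B_0 del: coef_add)
    
lemma coprime_index_eight: "coprime 8 index"
  using coprime_index_two coprime_power_left_iff[of 2 3 index] by simp

lemma coef_B4_square_0: "coef (B4 ^ 2) 0 = 2 * int n + 1"
  using coef_dilate_B_square_mult[OF coprime_index_four, of 1]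
  by (simp add: coef_1 zero_mem coef_dilate_0 coprime_index_eight coef_B_0)

text \<open>Symmetry turns the sum into the coefficient of \<open>u * v * B2 ^ 2\<close> at
  \<open>0\<close>, where \<open>u * v\<close> can be eliminated.\<close>

lemma sum_ab: "(\<Sum>r\<in>reps. a r * b r) = 4 * int n ^ 2 + 2 * int n"
proof -
  have "(\<Sum>r\<in>reps. a r * b r) = coef (u * B2 * (v * B2)) 0"
    unfolding a_def b_def
    by (rule sum_coef_mult_coef) (simp only: reflect_mult reflect_v reflect_dilate_B)
  also have "u * B2 * (v * B2) = u * v * B2 ^ 2"
    by (simp add: power2_eq_square algebra_simps)
  also have "coef \<dots> 0 = (2 * int n + 1) ^ 2 - (2 * int n + 1)"
    by (simp only: coef_prod_mult coef_B2_square_0 aug_power aug_B)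
  finally show ?thesis
    by (simp add: power2_eq_square algebra_simps)
qed

lemma sum_squares:
  assumes "reflect Y = Y"
  shows "(\<Sum>r\<in>reps. coef (u * Y) r ^ 2 + coef (v * Y) r ^ 2) = coef ((u ^ 2 + v ^ 2) * Y ^ 2) 0"
proof -
  have "(\<Sum>r\<in>reps. coef (u * Y) r ^ 2 + coef (v * Y) r ^ 2)
      = coef (u * Y * (u * Y)) 0 + coef (v * Y * (v * Y)) 0"
    using assms by (simp add: power2_eq_square sum.distrib sum_coef_mult_coef reflect_mult reflect_u reflect_v)
  also have "\<dots> = coef (u * Y * (u * Y) + v * Y * (v * Y)) 0"
    by (simp add: coef_add)
  also have "u * Y * (u * Y) + v * Y * (v * Y) = (u ^ 2 + v ^ 2) * Y ^ 2"
    by (simp add: power2_eq_square algebra_simps)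
  finally show ?thesis .
qed

text \<open>Eliminating \<open>u ^ 2 + v ^ 2\<close> and then \<open>B2 ^ 2\<close> leaves the
  coefficient of \<open>B4 * B2\<close> at \<open>0\<close>. Since \<open>B4 * B2\<close> is the
  dilation of \<open>B2 * B\<close> by 2, this is \<open>a 0 + b 0\<close>, the one unknown that
  remains.\<close>

lemma sum_a2_b2: "(\<Sum>r\<in>reps. a r ^ 2 + b r ^ 2) = 12 * int n ^ 2 + (a 0 + b 0)"
proof -
  have "coef (B4 * B2) 0 = coef (dilate 2 (B2 * B)) 0"
    by (simp add: dilate_mult dilate_dilate)
  also have "\<dots> = a 0 + b 0"
    unfolding a_def b_def coef_add[symmetric] coef_dilate_0[OF coprime_index_two]
    by (simp add: algebra_simps)
  finally have B42: "coef (B4 * B2) 0 = a 0 + b 0" .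
  have B2: "coef (B2 ^ 2 * B2) 0 = 4 * (2 * int n + 1) + (2 * int n - 2) - (a 0 + b 0)"
    using coef_dilate_B_square_mult[OF coprime_index_two, of B2]
    by (simp only: B42 aug_B coef_dilate_0[OF coprime_index_two] coef_B_0 mult_2 numeral_Bit0[symmetric]) simp
  have "(\<Sum>r\<in>reps. a r ^ 2 + b r ^ 2) = 2 * (2 * int n + 1) ^ 2 + 2 * int n * (2 * int n + 1)
     - (4 * (2 * int n + 1) + (2 * int n - 2) - (a 0 + b 0))"
    unfolding a_def b_def sum_squares[OF reflect_dilate_B] coef_squares_mult
    by (simp only: aug_power aug_B coef_B2_square_0 B2[unfolded mult.commute[of "B2 ^ 2"] a_def b_def])
  then show ?thesis
    by (simp add: power2_eq_square algebra_simps)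
qed

lemma coef_mult_B_le:
  assumes "\<And>x. coef P x \<ge> 0"
  shows "coef (P * B) x \<le> aug P"
proof -
  have "coef (P * B) x \<le> (\<Sum>r\<in>reps. coef P r * 1)"
    unfolding coef_mult by (intro sum_mono mult_left_mono coef_B_le assms)
  then show ?thesis
    by (simp add: aug_def)
qed

lemma a0_b0_le: "a 0 + b 0 \<le> 2 * int n + 1"
proof -
  have "a 0 + b 0 = coef (B2 * B) 0"
    unfolding a_def b_def coef_add[symmetric] by (simp add: algebra_simps)
  also have "\<dots> \<le> aug B2"
    by (intro coef_mult_B_le coef_dilate_B_nonneg)
  finally show ?thesis
    by (simp only: aug_B)
qed

text \<open>The same elimination ends at \<open>B8 * B2\<close>, the dilation of
  \<open>B4 * B\<close> by 2, whose coefficient at \<open>0\<close> is estimated by the augmentation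
  of \<open>B4\<close>.\<close>

lemma sum_d2_e2: "(\<Sum>r\<in>reps. d r ^ 2 + e r ^ 2) \<le> 12 * int n ^ 2 + 2 * int n + 1"
proof -
  have "coef (B8 * B2) 0 = coef (dilate 2 (B4 * B)) 0"
    by (simp add: dilate_mult dilate_dilate)
  also have "\<dots> \<le> aug B4"
    unfolding coef_dilate_0[OF coprime_index_two] by (intro coef_mult_B_le coef_dilate_B_nonneg)
  finally have B82: "coef (B8 * B2) 0 \<le> 2 * int n + 1"
    by (simp only: aug_B)
  have B4: "coef (B4 ^ 2 * B2) 0 = 4 * (2 * int n + 1) + (2 * int n - 2) - coef (B8 * B2) 0"
    using coef_dilate_B_square_mult[OF coprime_index_four, of B2]
    by (simp only: aug_B coef_dilate_0[OF coprime_index_two] coef_B_0) simp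
  have "(\<Sum>r\<in>reps. d r ^ 2 + e r ^ 2) = 2 * (2 * int n + 1) ^ 2 + 2 * int n * (2 * int n + 1)
     - (4 * (2 * int n + 1) + (2 * int n - 2) - coef (B8 * B2) 0)"
    unfolding d_def e_def sum_squares[OF reflect_dilate_B] coef_squares_mult
    by (simp only: aug_power aug_B coef_B4_square_0 B4[unfolded mult.commute[of "B4 ^ 2"]])
  also have "\<dots> \<le> 12 * int n ^ 2 + 2 * int n + 1"
    using B82 by (simp add: power2_eq_square algebra_simps)
  finally show ?thesis .
qed

text \<open>These mixed moments sum the products \<open>coef v x * a x\<close> and
  \<open>coef u x * b x\<close> in \<open>bound_2_3\<close>.\<close>

lemma sum_v_a: "(\<Sum>r\<in>reps. coef v r * a r) = 2 * int n"
  and sum_u_b: "(\<Sum>r\<in>reps. coef u r * b r) = 2 * int n"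
proof -
  have *: "coef (u * v * B2) 0 = 2 * int n"
    by (simp only: coef_prod_mult aug_B coef_dilate_0[OF coprime_index_two] coef_B_0)
  have "(\<Sum>r\<in>reps. coef v r * a r) = coef (v * (u * B2)) 0"
    unfolding a_def by (rule sum_coef_mult_coef) (simp only: reflect_mult reflect_u reflect_dilate_B)
  also have "v * (u * B2) = u * v * B2"
    by (simp add: algebra_simps)
  finally show "(\<Sum>r\<in>reps. coef v r * a r) = 2 * int n"
    using * by simp
  have "(\<Sum>r\<in>reps. coef u r * b r) = coef (u * (v * B2)) 0"
    unfolding b_def by (rule sum_coef_mult_coef) (simp only: reflect_mult reflect_v reflect_dilate_B)
  also have "u * (v * B2) = u * v * B2"
    by (simp add: algebra_simps)
  finally show "(\<Sum>r\<in>reps. coef u r * b r) = 2 * int n"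
    using * by simp
qed

lemma sum_dilate_u: "(\<Sum>r\<in>reps. coef (dilate k u) r) = int n"
  and sum_dilate_v: "(\<Sum>r\<in>reps. coef (dilate k v) r) = int n + 1"
  by (simp_all add: aug_def[symmetric])

lemma sum_u: "(\<Sum>r\<in>reps. coef u r) = int n"
  and sum_v: "(\<Sum>r\<in>reps. coef v r) = int n + 1"
  by (simp_all add: aug_def[symmetric])

lemma set_sum_power_prime_UV:
  assumes "prime p" and "(x, y, cx, cy) = (u, v, int n, int n + 1) \<or> (x, y, cx, cy) = (v, u, int n + 1, int n)"
  obtains w where "x ^ p = dilate p x + of_int (int p) * w"
proof -
  have "x = set_sum U \<or> x = set_sum V"
    using assms(2) by auto
  then show ?thesis
    using set_sum_power_prime[OF assms(1) finite_U] set_sum_power_prime[OF assms(1) finite_V] that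
    by (metis of_int_of_nat_eq)
qed

text \<open>Modulo 3 the term \<open>x ^ 3\<close> of the cubic identity is the dilation of
  \<open>x\<close> by 3; comparing augmentations then gives the constant \<open>k\<close>.\<close>

lemma residue_mod_3:
  assumes "\<not> 3 dvd int index"
    and xy: "(x, y, cx, cy) = (u, v, int n, int n + 1) \<or> (x, y, cx, cy) = (v, u, int n + 1, int n)"
    and "[int index * k = int n - 1] (mod 3)"
  shows "[coef (x * B2) z = k + 2 * int n * coef x z + coef y z - coef (dilate 3 x) z] (mod 3)"
proof -
  have [simp]: "aug x = cx" "aug y = cy" and cy: "cy = 2 * int n + 1 - cx"
    and xy': "(x, y) = (u, v) \<or> (x, y) = (v, u)"
    using xy by auto
  obtain w where w: "x ^ 3 = dilate 3 x + of_int (int 3) * w"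
    using set_sum_power_prime_UV[OF _ xy, of 3] by auto
  have "const_mod 3 (x * B2 - s * x - y + x ^ 3 - of_int 3 * w)"
    by (intro const_mod_diff cubic_identity xy' const_mod_multiple)
  then have c: "const_mod 3 (x * B2 - s * x - y + dilate 3 x)"
    by (simp add: w algebra_simps)
  have "aug (x * B2 - s * x - y + dilate 3 x) = cx * (int n + (int n + 1)) - int (2 * n) * cx - cy + cx"
    by (simp only: aug_add aug_diff aug_mult aug_dilate aug_of_nat aug_u aug_v \<open>aug x = cx\<close> \<open>aug y = cy\<close>)
  \<comment> \<open>Exchanging \<open>u\<close> and \<open>v\<close> changes the augmentation by a
    multiple of 3, so one \<open>k\<close> serves both \<open>a\<close> and
    \<open>b\<close>.\<close>
  also have "\<dots> = int n - 1 + 3 * (cx - int n)"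
    unfolding cy by (simp add: algebra_simps)
  finally have "aug (x * B2 - s * x - y + dilate 3 x) = int n - 1 + 3 * (cx - int n)" .
  moreover have "[int n - 1 = int n - 1 + 3 * (cx - int n)] (mod 3)"
    unfolding cong_def by presburger
  ultimately have "[int index * k = aug (x * B2 - s * x - y + dilate 3 x)] (mod 3)"
    using cong_trans[OF assms(3)] by simp
  moreover have "coprime (int index) 3"
    using assms(1) prime_imp_coprime[of 3 "int index"] by (simp add: coprime_commute)
  ultimately have "[coef (x * B2 - s * x - y + dilate 3 x) z = k] (mod 3)"
    by (intro const_mod_residue c)
  then have "[coef (x * B2) z - int (2 * n) * coef x z - coef y z + coef (dilate 3 x) z = k] (mod 3)"
    by (simp only: coef_add coef_diff coef_of_nat_mult)
  then show ?thesis
    by (simp add: cong_iff_dvd_diff algebra_simps)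
qed

text \<open>The quintic identity replaces the cubic one. Its augmentation modulo 5 differs for
  \<open>u\<close> and \<open>v\<close>, so \<open>d\<close> and \<open>e\<close> get separate
  constants.\<close>

lemma residue_mod_5:
  assumes "\<not> 5 dvd int index"
    and xy: "(x, y, cx, cy) = (u, v, int n, int n + 1) \<or> (x, y, cx, cy) = (v, u, int n + 1, int n)"
    and "[int index * k = cx * (4 * int n ^ 2 + 4 * int n) + cy] (mod 5)"
  shows "[coef (x * B4) z = k - 4 * int n * coef (x * B2) z - coef (y * B2) z - coef (dilate 5 x) z
    + (4 * int n ^ 2 + 2 * int n - 3) * coef x z + 2 * int n * coef y z] (mod 5)"
proof -
  have [simp]: "aug x = cx" "aug y = cy" and xy': "(x, y) = (u, v) \<or> (x, y) = (v, u)"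
    using xy by auto
  define P where "P = x * B4 + of_nat (4 * n) * (x * B2) + y * B2 + dilate 5 x
    - of_int (4 * int n ^ 2 + 2 * int n - 3) * x - s * y"
  obtain w where w: "x ^ 5 = dilate 5 x + of_int (int 5) * w"
    using set_sum_power_prime_UV[OF _ xy, of 5] by auto
  have "const_mod 5 (x * B4 + 2 * s * x * B2 + y * B2 + x ^ 5 - (s ^ 2 + s - 3) * x - s * y - of_int 5 * w)"
    by (intro const_mod_diff[OF quintic_identity] xy' const_mod_multiple)
  also have "x * B4 + 2 * s * x * B2 + y * B2 + x ^ 5 - (s ^ 2 + s - 3) * x - s * y - of_int 5 * w = P"
    by (simp add: w P_def algebra_simps power2_eq_square)
  finally have c: "const_mod 5 P" .
  have "aug P = cx * (2 * int n + 1) + int (4 * n) * (cx * (2 * int n + 1)) + cy * (2 * int n + 1) + cx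
     - (4 * int n ^ 2 + 2 * int n - 3) * cx - int (2 * n) * cy"
    unfolding P_def
    by (simp only: aug_add aug_diff aug_mult aug_dilate aug_of_nat aug_of_int aug_u aug_v \<open>aug x = cx\<close> \<open>aug y = cy\<close>)
      (simp add: algebra_simps)
  also have "\<dots> = cx * (4 * int n ^ 2 + 4 * int n) + cy + 5 * cx"
    by (simp add: algebra_simps power2_eq_square)
  finally have "[int index * k = aug P] (mod 5)"
    using assms(3) by (simp add: cong_def)
  moreover have "coprime (int index) 5"
    using assms(1) prime_imp_coprime[of 5 "int index"] by (simp add: coprime_commute)
  ultimately have "[coef P z = k] (mod 5)"
    by (intro const_mod_residue c)
  then have "[coef (x * B4) z + int (4 * n) * coef (x * B2) z + coef (y * B2) z + coef (dilate 5 x) z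
      - (4 * int n ^ 2 + 2 * int n - 3) * coef x z - int (2 * n) * coef y z = k] (mod 5)"
    unfolding P_def by (simp only: coef_add coef_diff coef_of_nat_mult coef_of_int_mult)
  then show ?thesis
    by (simp add: cong_iff_dvd_diff algebra_simps)
qed

end

section \<open>Lower bounds for single coefficients\<close>

text \<open>
  In the names \<open>bound_i_j\<close> and \<open>not_i_j\<close> the digits are the residues of \<open>n\<close> modulo 3 and 5. The
  coefficients of the bounds come from solving the duals of linear programs that minimise a combination of
  the moments of \<open>d\<close> and \<open>e\<close> subject to the residues and the known moments.
\<close>

definition unit_pairs :: "(int \<times> int) list" where
  "unit_pairs = [(0, 0), (0, 1), (1, 0)]"

lemma unit_pairs_intro:
  fixes x y :: int
  assumes "x \<ge> 0" "y \<ge> 0" "x + y \<le> 1"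
  shows "(x, y) \<in> set unit_pairs"
proof -
  have "(x = 0 \<and> y = 0) \<or> (x = 0 \<and> y = 1) \<or> (x = 1 \<and> y = 0)"
    using assms by linarith
  then show ?thesis
    by (auto simp: unit_pairs_def)
qed

context lee_pair
begin

abbreviation "u3 \<equiv> dilate 3 u"
abbreviation "v3 \<equiv> dilate 3 v"
abbreviation "u5 \<equiv> dilate 5 u"
abbreviation "v5 \<equiv> dilate 5 v"

lemma int_index: "int index = int n ^ 2 + int n + 1"
  by (simp add: index_eq)

lemma not_dvd_3_index:
  assumes "int n mod 3 \<noteq> 1"
  shows "\<not> 3 dvd int index"
proof -
  have "int n mod 3 = 0 \<or> int n mod 3 = 2"
    using assms by presburger
  then obtain q where "int n = 3 * q \<or> int n = 3 * q + 2"
    by (metis add.right_neutral mult_div_mod_eq)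
  then have "int index = 3 * (3 * q * q + q) + 1 \<or> int index = 3 * (3 * q * q + 5 * q + 2) + 1"
    by (auto simp: int_index power2_eq_square algebra_simps)
  then show ?thesis
    by presburger
qed

text \<open>The polynomial \<open>r ^ 2 + r + 1\<close> has discriminant \<open>- 3\<close>, a
  nonresidue modulo 5.\<close>

lemma not_dvd_5_index: "\<not> 5 dvd int index"
proof -
  define q where "q = int n div 5"
  have "int n = 5 * q \<or> int n = 5 * q + 1 \<or> int n = 5 * q + 2 \<or> int n = 5 * q + 3 \<or> int n = 5 * q + 4"
    unfolding q_def by presburger
  then have "int index = 5 * (5 * q * q + q) + 1 \<or> int index = 5 * (5 * q * q + 3 * q) + 3
    \<or> int index = 5 * (5 * q * q + 5 * q + 1) + 2 \<or> int index = 5 * (5 * q * q + 7 * q + 2) + 3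
    \<or> int index = 5 * (5 * q * q + 9 * q + 4) + 1"
    by (auto simp: int_index power2_eq_square algebra_simps)
  then show ?thesis
    by presburger
qed

lemma coprime_index_three: "int n mod 3 \<noteq> 1 \<Longrightarrow> coprime 3 index"
  using not_dvd_3_index prime_imp_coprime[of 3 index] int_dvd_int_iff[of 3 index] by simp

lemma coprime_index_five: "coprime 5 index"
  using not_dvd_5_index prime_imp_coprime[of 5 index] int_dvd_int_iff[of 5 index] by simp

lemma uv_units: "(coef u x, coef v x) \<in> set unit_pairs"
  using coef_B_le[of x] by (intro unit_pairs_intro coef_u_nonneg coef_v_nonneg) (simp add: coef_add)

lemma dilate_units: "coprime k index \<Longrightarrow> (coef (dilate k u) x, coef (dilate k v) x) \<in> set unit_pairs"
  by (intro unit_pairs_intro coef_dilate_set_sum_nonneg coef_dilate_B_le)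

lemma a_b_mod_3:
  assumes n: "int n mod 3 = r" and k: "((r ^ 2 + r + 1) * k) mod 3 = (r - 1) mod 3" and "r \<noteq> 1"
  shows "a x mod 3 = (k + 2 * r * coef u x + coef v x - coef u3 x) mod 3"
    and "b x mod 3 = (k + 2 * r * coef v x + coef u x - coef v3 x) mod 3"
proof -
  have nr: "[int n = r] (mod 3)"
    using n by (auto simp: cong_def)
  have "[int index * k = (r ^ 2 + r + 1) * k] (mod 3)"
    unfolding int_index by (intro cong_mult cong_add cong_pow nr cong_refl)
  moreover have "[(r ^ 2 + r + 1) * k = r - 1] (mod 3)"
    using k by (simp add: cong_def)
  moreover have "[r - 1 = int n - 1] (mod 3)"
    by (intro cong_diff cong_sym[OF nr] cong_refl)
  ultimately have k': "[int index * k = int n - 1] (mod 3)"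
    using cong_trans by blast
  have nd: "\<not> 3 dvd int index"
    using not_dvd_3_index assms by simp
  have r: "[k + 2 * int n * p + q - t = k + 2 * r * p + q - t] (mod 3)" for p q t
    by (intro cong_mult cong_add cong_diff nr cong_refl)
  show "a x mod 3 = (k + 2 * r * coef u x + coef v x - coef u3 x) mod 3"
    using cong_trans[OF residue_mod_3[OF nd _ k', of u v "int n" "int n + 1" x] r]
    by (simp add: cong_def a_def)
  show "b x mod 3 = (k + 2 * r * coef v x + coef u x - coef v3 x) mod 3"
    using cong_trans[OF residue_mod_3[OF nd _ k', of v u "int n + 1" "int n" x] r]
    by (simp add: cong_def b_def)
qed

lemma d_e_mod_5:
  assumes n: "int n mod 5 = r"
  shows "((r ^ 2 + r + 1) * k) mod 5 = (r * (4 * r ^ 2 + 4 * r) + (r + 1)) mod 5 \<Longrightarrow>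
     d x mod 5 = (k - 4 * r * a x - b x - coef u5 x + (4 * r ^ 2 + 2 * r - 3) * coef u x + 2 * r * coef v x) mod 5"
    and "((r ^ 2 + r + 1) * k) mod 5 = ((r + 1) * (4 * r ^ 2 + 4 * r) + r) mod 5 \<Longrightarrow>
     e x mod 5 = (k - 4 * r * b x - a x - coef v5 x + (4 * r ^ 2 + 2 * r - 3) * coef v x + 2 * r * coef u x) mod 5"
proof -
  have nr: "[int n = r] (mod 5)"
    using n by (auto simp: cong_def)
  have k': "[int index * k = cx * (4 * int n ^ 2 + 4 * int n) + cy] (mod 5)"
    if "((r ^ 2 + r + 1) * k) mod 5 = (c * (4 * r ^ 2 + 4 * r) + c') mod 5"
      and c: "[cx = c] (mod 5)" "[cy = c'] (mod 5)" for cx cy c c'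
  proof -
    have "[int index * k = (r ^ 2 + r + 1) * k] (mod 5)"
      unfolding int_index by (intro cong_mult cong_add cong_pow nr cong_refl)
    moreover have "[(r ^ 2 + r + 1) * k = c * (4 * r ^ 2 + 4 * r) + c'] (mod 5)"
      using that(1) by (simp add: cong_def)
    moreover have "[cx * (4 * int n ^ 2 + 4 * int n) + cy = c * (4 * r ^ 2 + 4 * r) + c'] (mod 5)"
      by (intro cong_mult cong_add cong_pow nr cong_refl c)
    ultimately show ?thesis
      using cong_trans cong_sym by blast
  qed
  have r: "[k - 4 * int n * p - q - t + (4 * int n ^ 2 + 2 * int n - 3) * w + 2 * int n * z
     = k - 4 * r * p - q - t + (4 * r ^ 2 + 2 * r - 3) * w + 2 * r * z] (mod 5)" for p q t w z
    by (intro cong_mult cong_add cong_diff cong_pow nr cong_refl)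
  have n1: "[int n + 1 = r + 1] (mod 5)"
    by (intro cong_add nr cong_refl)
  show "d x mod 5 = (k - 4 * r * a x - b x - coef u5 x + (4 * r ^ 2 + 2 * r - 3) * coef u x + 2 * r * coef v x) mod 5"
    if "((r ^ 2 + r + 1) * k) mod 5 = (r * (4 * r ^ 2 + 4 * r) + (r + 1)) mod 5"
    using cong_trans[OF residue_mod_5[OF not_dvd_5_index _ k'[OF that nr n1], of u v x] r]
    by (simp add: cong_def a_def b_def d_def)
  show "e x mod 5 = (k - 4 * r * b x - a x - coef v5 x + (4 * r ^ 2 + 2 * r - 3) * coef v x + 2 * r * coef u x) mod 5"
    if "((r ^ 2 + r + 1) * k) mod 5 = ((r + 1) * (4 * r ^ 2 + 4 * r) + r) mod 5"
    using cong_trans[OF residue_mod_5[OF not_dvd_5_index _ k'[OF that n1 nr], of v u x] r]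
    by (simp add: cong_def a_def b_def e_def)
qed

text \<open>Rules that turn a bound summed over \<open>reps\<close> into a polynomial inequality in
  \<open>n\<close>.\<close>

lemmas sum_rules = sum.distrib sum_subtractf sum_distrib_left[symmetric] sum_a sum_b sum_d sum_e
  sum_u sum_v sum_dilate_u sum_dilate_v sum_constant index_def[symmetric] int_index sum_ab sum_v_a sum_u_b

end

section \<open>Bounds at a single coset, by residue class\<close>

lemma bound_0_1_check:
  "\<forall>a\<in>set [0..7]. \<forall>b\<in>set [0..10].
    \<forall>(u, v)\<in>set unit_pairs. \<forall>(u3, v3)\<in>set unit_pairs. \<forall>(u5, v5)\<in>set unit_pairs.
    a mod 3 = (2 + v - u3) mod 3 \<longrightarrow> b mod 3 = (2 + u - v3) mod 3 \<longrightarrow>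
    22 - 3 * a - 2 * b - 4 * u - 6 * v - 15 * u3 - 5 * v3 - 3 * v5 \<le> 3 * ((4 - 4 * b - a - v5 + 3 * v + 2 * u) mod 5)"
  by code_simp

text \<open>Being nonnegative, \<open>e x\<close> is at least \<open>e x mod 5\<close>, which is a
  function of \<open>a x\<close>, \<open>b x\<close> and unit coefficients;
  \<open>bound_0_1_check\<close> runs through these. Beyond its ranges \<open>22 - 3 * a x\<close>
  or \<open>22 - 2 * b x\<close> is at most 0, and so is the whole left side. The other bounds vary
  this pattern.\<close>

lemma (in lee_pair) bound_0_1:
  assumes n: "int n mod 3 = 0" "int n mod 5 = 1"
  shows "22 - 3 * a x - 2 * b x - 4 * coef u x - 6 * coef v x - 15 * coef u3 x - 5 * coef v3 x - 3 * coef v5 x \<le> 3 * e x"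
proof (cases "a x \<le> 7 \<and> b x \<le> 10")
  case True
  have a: "a x mod 3 = (2 + coef v x - coef u3 x) mod 3"
    and b: "b x mod 3 = (2 + coef u x - coef v3 x) mod 3"
    using a_b_mod_3[OF n(1), of 2] by simp_all
  have E: "e x mod 5 = (4 - 4 * b x - a x - coef v5 x + 3 * coef v x + 2 * coef u x) mod 5"
    using d_e_mod_5(2)[OF n(2), of 4] by simp
  have c: "coprime 3 index" "coprime 5 index"
    using coprime_index_three coprime_index_five n by simp_all
  have ab: "a x \<in> set [0..7]" "b x \<in> set [0..10]"
    using True nonneg by auto
  have "22 - 3 * a x - 2 * b x - 4 * coef u x - 6 * coef v x - 15 * coef u3 x - 5 * coef v3 x - 3 * coef v5 x \<le> 3 * (e x mod 5)"
    using bound_0_1_check[THEN bspec, OF ab(1), THEN bspec, OF ab(2), THEN bspec, OF uv_units[of x],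
        unfolded prod.case, THEN bspec, OF dilate_units[OF c(1)], unfolded prod.case,
        THEN bspec, OF dilate_units[OF c(2)], unfolded prod.case, THEN mp, OF a, THEN mp, OF b]
    by (simp only: E)
  also have "\<dots> \<le> 3 * e x"
    using zmod_le_nonneg_dividend[of "e x" 5] nonneg by simp
  finally show ?thesis .
next
  case False
  have c: "0 \<le> coef u x" "0 \<le> coef v x" "0 \<le> coef u3 x" "0 \<le> coef v3 x" "0 \<le> coef u5 x" "0 \<le> coef v5 x"
    by (intro coef_u_nonneg coef_v_nonneg coef_dilate_set_sum_nonneg)+
  from False have "a x > 7 \<or> b x > 10"
    by linarith
  then show ?thesis
    using c nonneg[of x] by (elim disjE) linarith+
qed

lemma bound_0_2_check:
  "\<forall>a\<in>set [0..8]. \<forall>b\<in>set [0..6].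
    \<forall>(u, v)\<in>set unit_pairs. \<forall>(u3, v3)\<in>set unit_pairs. \<forall>(u5, v5)\<in>set unit_pairs.
    a mod 3 = (2 + v - u3) mod 3 \<longrightarrow> b mod 3 = (2 + u - v3) mod 3 \<longrightarrow>
    26 - 3 * a - 4 * b - 8 * u - 9 * v - 15 * u3 - 10 * v3 - 3 * v5 \<le> 3 * ((2 - 8 * b - a - v5 + 17 * v + 4 * u) mod 5)"
  by code_simp

lemma (in lee_pair) bound_0_2:
  assumes n: "int n mod 3 = 0" "int n mod 5 = 2"
  shows "26 - 3 * a x - 4 * b x - 8 * coef u x - 9 * coef v x - 15 * coef u3 x - 10 * coef v3 x - 3 * coef v5 x \<le> 3 * e x"
proof (cases "a x \<le> 8 \<and> b x \<le> 6")
  case True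
  have a: "a x mod 3 = (2 + coef v x - coef u3 x) mod 3"
    and b: "b x mod 3 = (2 + coef u x - coef v3 x) mod 3"
    using a_b_mod_3[OF n(1), of 2] by simp_all
  have E: "e x mod 5 = (2 - 8 * b x - a x - coef v5 x + 17 * coef v x + 4 * coef u x) mod 5"
    using d_e_mod_5(2)[OF n(2), of 2] by simp
  have c: "coprime 3 index" "coprime 5 index"
    using coprime_index_three coprime_index_five n by simp_all
  have ab: "a x \<in> set [0..8]" "b x \<in> set [0..6]"
    using True nonneg by auto
  have "26 - 3 * a x - 4 * b x - 8 * coef u x - 9 * coef v x - 15 * coef u3 x - 10 * coef v3 x - 3 * coef v5 x \<le> 3 * (e x mod 5)"
    using bound_0_2_check[THEN bspec, OF ab(1), THEN bspec, OF ab(2), THEN bspec, OF uv_units[of x],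
        unfolded prod.case, THEN bspec, OF dilate_units[OF c(1)], unfolded prod.case,
        THEN bspec, OF dilate_units[OF c(2)], unfolded prod.case, THEN mp, OF a, THEN mp, OF b]
    by (simp only: E)
  also have "\<dots> \<le> 3 * e x"
    using zmod_le_nonneg_dividend[of "e x" 5] nonneg by simp
  finally show ?thesis .
next
  case False
  have c: "0 \<le> coef u x" "0 \<le> coef v x" "0 \<le> coef u3 x" "0 \<le> coef v3 x" "0 \<le> coef u5 x" "0 \<le> coef v5 x"
    by (intro coef_u_nonneg coef_v_nonneg coef_dilate_set_sum_nonneg)+
  from False have "a x > 8 \<or> b x > 6"
    by linarith
  then show ?thesis
    using c nonneg[of x] by (elim disjE) linarith+
qed

lemma bound_0_3_check:
  "\<forall>a\<in>set [0..6]. \<forall>b\<in>set [0..19].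
    \<forall>(u, v)\<in>set unit_pairs. \<forall>(u3, v3)\<in>set unit_pairs. \<forall>(u5, v5)\<in>set unit_pairs.
    a mod 3 = (2 + v - u3) mod 3 \<longrightarrow> b mod 3 = (2 + u - v3) mod 3 \<longrightarrow>
    20 - 3 * a - b - 2 * u - 18 * v - 15 * u3 - 10 * v3 - 3 * v5 \<le> 3 * ((- 12 * b - a - v5 + 39 * v + 6 * u) mod 5)"
  by code_simp

lemma (in lee_pair) bound_0_3:
  assumes n: "int n mod 3 = 0" "int n mod 5 = 3"
  shows "20 - 3 * a x - b x - 2 * coef u x - 18 * coef v x - 15 * coef u3 x - 10 * coef v3 x - 3 * coef v5 x \<le> 3 * e x"
proof (cases "a x \<le> 6 \<and> b x \<le> 19")
  case True
  have a: "a x mod 3 = (2 + coef v x - coef u3 x) mod 3"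
    and b: "b x mod 3 = (2 + coef u x - coef v3 x) mod 3"
    using a_b_mod_3[OF n(1), of 2] by simp_all
  have E: "e x mod 5 = (- 12 * b x - a x - coef v5 x + 39 * coef v x + 6 * coef u x) mod 5"
    using d_e_mod_5(2)[OF n(2), of 0] by simp
  have c: "coprime 3 index" "coprime 5 index"
    using coprime_index_three coprime_index_five n by simp_all
  have ab: "a x \<in> set [0..6]" "b x \<in> set [0..19]"
    using True nonneg by auto
  have "20 - 3 * a x - b x - 2 * coef u x - 18 * coef v x - 15 * coef u3 x - 10 * coef v3 x - 3 * coef v5 x \<le> 3 * (e x mod 5)"
    using bound_0_3_check[THEN bspec, OF ab(1), THEN bspec, OF ab(2), THEN bspec, OF uv_units[of x],
        unfolded prod.case, THEN bspec, OF dilate_units[OF c(1)], unfolded prod.case,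
        THEN bspec, OF dilate_units[OF c(2)], unfolded prod.case, THEN mp, OF a, THEN mp, OF b]
    by (simp only: E)
  also have "\<dots> \<le> 3 * e x"
    using zmod_le_nonneg_dividend[of "e x" 5] nonneg by simp
  finally show ?thesis .
next
  case False
  have c: "0 \<le> coef u x" "0 \<le> coef v x" "0 \<le> coef u3 x" "0 \<le> coef v3 x" "0 \<le> coef u5 x" "0 \<le> coef v5 x"
    by (intro coef_u_nonneg coef_v_nonneg coef_dilate_set_sum_nonneg)+
  from False have "a x > 6 \<or> b x > 19"
    by linarith
  then show ?thesis
    using c nonneg[of x] by (elim disjE) linarith+
qed

lemma bound_2_0_check:
  "\<forall>a\<in>set [0..9]. \<forall>b\<in>set [0..9].
    \<forall>(u, v)\<in>set unit_pairs. \<forall>(u3, v3)\<in>set unit_pairs. \<forall>(u5, v5)\<in>set unit_pairs.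
    a mod 3 = (1 + 4 * u + v - u3) mod 3 \<longrightarrow> b mod 3 = (1 + 4 * v + u - v3) mod 3 \<longrightarrow>
    -10 + 19 * a + 25 * b - 20 * u - 38 * v - 10 * u3 - 10 * v3 - 6 * v5 - 5 * (a * a + b * b) \<le> 6 * ((- a - v5 - 3 * v) mod 5)"
  by code_simp

text \<open>The quadratic terms let the second moments of \<open>a\<close> and \<open>b\<close>
  contribute to the summed inequality.\<close>

lemma (in lee_pair) bound_2_0:
  assumes n: "int n mod 3 = 2" "int n mod 5 = 0"
  shows "-10 + 19 * a x + 25 * b x - 20 * coef u x - 38 * coef v x - 10 * coef u3 x - 10 * coef v3 x - 6 * coef v5 x - 5 * (a x * a x + b x * b x) \<le> 6 * e x"
proof (cases "a x \<le> 9 \<and> b x \<le> 9")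
  case True
  have a: "a x mod 3 = (1 + 4 * coef u x + coef v x - coef u3 x) mod 3"
    and b: "b x mod 3 = (1 + 4 * coef v x + coef u x - coef v3 x) mod 3"
    using a_b_mod_3[OF n(1), of 1] by simp_all
  have E: "e x mod 5 = (- a x - coef v5 x - 3 * coef v x) mod 5"
    using d_e_mod_5(2)[OF n(2), of 0] by simp
  have c: "coprime 3 index" "coprime 5 index"
    using coprime_index_three coprime_index_five n by simp_all
  have ab: "a x \<in> set [0..9]" "b x \<in> set [0..9]"
    using True nonneg by auto
  have "-10 + 19 * a x + 25 * b x - 20 * coef u x - 38 * coef v x - 10 * coef u3 x - 10 * coef v3 x - 6 * coef v5 x - 5 * (a x * a x + b x * b x) \<le> 6 * (e x mod 5)"
    using bound_2_0_check[THEN bspec, OF ab(1), THEN bspec, OF ab(2), THEN bspec, OF uv_units[of x],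
        unfolded prod.case, THEN bspec, OF dilate_units[OF c(1)], unfolded prod.case,
        THEN bspec, OF dilate_units[OF c(2)], unfolded prod.case, THEN mp, OF a, THEN mp, OF b]
    by (simp only: E)
  also have "\<dots> \<le> 6 * e x"
    using zmod_le_nonneg_dividend[of "e x" 5] nonneg by simp
  finally show ?thesis .
next
  case False
  have c: "0 \<le> coef u x" "0 \<le> coef v x" "0 \<le> coef u3 x" "0 \<le> coef v3 x" "0 \<le> coef u5 x" "0 \<le> coef v5 x"
    by (intro coef_u_nonneg coef_v_nonneg coef_dilate_set_sum_nonneg)+
  \<comment> \<open>The squares bound \<open>19 * a - 5 * a ^ 2\<close> and
    \<open>25 * b - 5 * b ^ 2\<close> by their maxima; a variable that is at least 10 makes its own
    terms outweigh the rest.\<close>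
  have sa: "0 \<le> 100 * (a x * a x) - 380 * a x + 361"
    using zero_le_power2[of "10 * a x - 19"] by (simp add: power2_eq_square algebra_simps)
  have sb: "0 \<le> 4 * (b x * b x) - 20 * b x + 25"
    using zero_le_power2[of "2 * b x - 5"] by (simp add: power2_eq_square algebra_simps)
  from False consider "a x \<ge> 10" | "b x \<ge> 10"
    by linarith
  then show ?thesis
  proof cases
    case 1
    then have "10 * a x \<le> a x * a x"
      by (intro mult_right_mono) simp_all
    then show ?thesis
      using 1 sb c nonneg[of x] unfolding distrib_left by linarith
  next
    case 2
    then have "10 * b x \<le> b x * b x"
      by (intro mult_right_mono) simp_all
    then show ?thesis
      using 2 sa c nonneg[of x] unfolding distrib_left by linarith
  qed
qed

lemma bound_2_2_check:
  "\<forall>a\<in>set [0..9]. \<forall>b\<in>set [0..9].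
    \<forall>(u, v)\<in>set unit_pairs. \<forall>(u3, v3)\<in>set unit_pairs. \<forall>(u5, v5)\<in>set unit_pairs.
    a mod 3 = (1 + 4 * u + v - u3) mod 3 \<longrightarrow> b mod 3 = (1 + 4 * v + u - v3) mod 3 \<longrightarrow>
    -18 + 19 * a + 27 * b - 16 * u - 28 * v - 10 * u3 - 20 * v3 - 6 * v5 - 5 * (a * a + b * b) \<le> 6 * ((2 - 8 * b - a - v5 + 17 * v + 4 * u) mod 5)"
  by code_simp

lemma (in lee_pair) bound_2_2:
  assumes n: "int n mod 3 = 2" "int n mod 5 = 2"
  shows "-18 + 19 * a x + 27 * b x - 16 * coef u x - 28 * coef v x - 10 * coef u3 x - 20 * coef v3 x - 6 * coef v5 x - 5 * (a x * a x + b x * b x) \<le> 6 * e x"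
proof (cases "a x \<le> 9 \<and> b x \<le> 9")
  case True
  have a: "a x mod 3 = (1 + 4 * coef u x + coef v x - coef u3 x) mod 3"
    and b: "b x mod 3 = (1 + 4 * coef v x + coef u x - coef v3 x) mod 3"
    using a_b_mod_3[OF n(1), of 1] by simp_all
  have E: "e x mod 5 = (2 - 8 * b x - a x - coef v5 x + 17 * coef v x + 4 * coef u x) mod 5"
    using d_e_mod_5(2)[OF n(2), of 2] by simp
  have c: "coprime 3 index" "coprime 5 index"
    using coprime_index_three coprime_index_five n by simp_all
  have ab: "a x \<in> set [0..9]" "b x \<in> set [0..9]"
    using True nonneg by auto
  have "-18 + 19 * a x + 27 * b x - 16 * coef u x - 28 * coef v x - 10 * coef u3 x - 20 * coef v3 x - 6 * coef v5 x - 5 * (a x * a x + b x * b x) \<le> 6 * (e x mod 5)"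
    using bound_2_2_check[THEN bspec, OF ab(1), THEN bspec, OF ab(2), THEN bspec, OF uv_units[of x],
        unfolded prod.case, THEN bspec, OF dilate_units[OF c(1)], unfolded prod.case,
        THEN bspec, OF dilate_units[OF c(2)], unfolded prod.case, THEN mp, OF a, THEN mp, OF b]
    by (simp only: E)
  also have "\<dots> \<le> 6 * e x"
    using zmod_le_nonneg_dividend[of "e x" 5] nonneg by simp
  finally show ?thesis .
next
  case False
  have c: "0 \<le> coef u x" "0 \<le> coef v x" "0 \<le> coef u3 x" "0 \<le> coef v3 x" "0 \<le> coef u5 x" "0 \<le> coef v5 x"
    by (intro coef_u_nonneg coef_v_nonneg coef_dilate_set_sum_nonneg)+
  have sa: "0 \<le> 100 * (a x * a x) - 380 * a x + 361"
    using zero_le_power2[of "10 * a x - 19"] by (simp add: power2_eq_square algebra_simps)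
  have sb: "0 \<le> 100 * (b x * b x) - 540 * b x + 729"
    using zero_le_power2[of "10 * b x - 27"] by (simp add: power2_eq_square algebra_simps)
  from False consider "a x \<ge> 10" | "b x \<ge> 10"
    by linarith
  then show ?thesis
  proof cases
    case 1
    then have "10 * a x \<le> a x * a x"
      by (intro mult_right_mono) simp_all
    then show ?thesis
      using 1 sb c nonneg[of x] unfolding distrib_left by linarith
  next
    case 2
    then have "10 * b x \<le> b x * b x"
      by (intro mult_right_mono) simp_all
    then show ?thesis
      using 2 sa c nonneg[of x] unfolding distrib_left by linarith
  qed
qed

lemma bound_2_4_check:
  "\<forall>a\<in>set [0..9]. \<forall>b\<in>set [0..9].
    \<forall>(u, v)\<in>set unit_pairs. \<forall>(u3, v3)\<in>set unit_pairs. \<forall>(u5, v5)\<in>set unit_pairs.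
    a mod 3 = (1 + 4 * u + v - u3) mod 3 \<longrightarrow> b mod 3 = (1 + 4 * v + u - v3) mod 3 \<longrightarrow>
    -39 + 36 * a + 36 * b - 18 * u - 9 * v - 40 * u3 - 40 * v3 - 9 * v5 - 5 * (a * a + b * b) - 5 * (a * b) \<le> 9 * ((4 - 16 * b - a - v5 + 69 * v + 8 * u) mod 5)"
  by code_simp

lemma (in lee_pair) bound_2_4:
  assumes n: "int n mod 3 = 2" "int n mod 5 = 4"
  shows "-39 + 36 * a x + 36 * b x - 18 * coef u x - 9 * coef v x - 40 * coef u3 x - 40 * coef v3 x - 9 * coef v5 x - 5 * (a x * a x + b x * b x) - 5 * (a x * b x) \<le> 9 * e x"
proof (cases "a x \<le> 9 \<and> b x \<le> 9")
  case True
  have a: "a x mod 3 = (1 + 4 * coef u x + coef v x - coef u3 x) mod 3"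
    and b: "b x mod 3 = (1 + 4 * coef v x + coef u x - coef v3 x) mod 3"
    using a_b_mod_3[OF n(1), of 1] by simp_all
  have E: "e x mod 5 = (4 - 16 * b x - a x - coef v5 x + 69 * coef v x + 8 * coef u x) mod 5"
    using d_e_mod_5(2)[OF n(2), of 4] by simp
  have c: "coprime 3 index" "coprime 5 index"
    using coprime_index_three coprime_index_five n by simp_all
  have ab: "a x \<in> set [0..9]" "b x \<in> set [0..9]"
    using True nonneg by auto
  have "-39 + 36 * a x + 36 * b x - 18 * coef u x - 9 * coef v x - 40 * coef u3 x - 40 * coef v3 x - 9 * coef v5 x - 5 * (a x * a x + b x * b x) - 5 * (a x * b x) \<le> 9 * (e x mod 5)"
    using bound_2_4_check[THEN bspec, OF ab(1), THEN bspec, OF ab(2), THEN bspec, OF uv_units[of x],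
        unfolded prod.case, THEN bspec, OF dilate_units[OF c(1)], unfolded prod.case,
        THEN bspec, OF dilate_units[OF c(2)], unfolded prod.case, THEN mp, OF a, THEN mp, OF b]
    by (simp only: E)
  also have "\<dots> \<le> 9 * e x"
    using zmod_le_nonneg_dividend[of "e x" 5] nonneg by simp
  finally show ?thesis .
next
  case False
  have c: "0 \<le> coef u x" "0 \<le> coef v x" "0 \<le> coef u3 x" "0 \<le> coef v3 x" "0 \<le> coef u5 x" "0 \<le> coef v5 x"
    by (intro coef_u_nonneg coef_v_nonneg coef_dilate_set_sum_nonneg)+
  have m: "0 \<le> a x * b x"
    using nonneg by simp
  have sa: "0 \<le> 25 * (a x * a x) - 180 * a x + 324"
    using zero_le_power2[of "5 * a x - 18"] by (simp add: power2_eq_square algebra_simps)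
  have sb: "0 \<le> 25 * (b x * b x) - 180 * b x + 324"
    using zero_le_power2[of "5 * b x - 18"] by (simp add: power2_eq_square algebra_simps)
  from False consider "a x \<ge> 10" | "b x \<ge> 10"
    by linarith
  then show ?thesis
  proof cases
    case 1
    then have "10 * a x \<le> a x * a x"
      by (intro mult_right_mono) simp_all
    then show ?thesis
      using 1 sb c nonneg[of x] m unfolding distrib_left by linarith
  next
    case 2
    then have "10 * b x \<le> b x * b x"
      by (intro mult_right_mono) simp_all
    then show ?thesis
      using 2 sa c nonneg[of x] m unfolding distrib_left by linarith
  qed
qed

lemma bound_2_3_check:
  "\<forall>a\<in>set [0..9]. \<forall>b\<in>set [0..9].
    \<forall>(u, v)\<in>set unit_pairs. \<forall>(u3, v3)\<in>set unit_pairs. \<forall>(u5, v5)\<in>set unit_pairs.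
    a mod 3 = (1 + 4 * u + v - u3) mod 3 \<longrightarrow> b mod 3 = (1 + 4 * v + u - v3) mod 3 \<longrightarrow>
    6 + 105 * a + 63 * b + 222 * u + 348 * v - 80 * u3 - 230 * v3 - 36 * u5 - 18 * v5 - 25 * (a * a + b * b) + 20 * (a * b) - 240 * (v * a) - 150 * (u * b) \<le> 36 * ((1 - 12 * a - b - u5 + 39 * u + 6 * v) mod 5) + 18 * ((- 12 * b - a - v5 + 39 * v + 6 * u) mod 5)"
  by code_simp

lemma (in lee_pair) bound_2_3:
  assumes n: "int n mod 3 = 2" "int n mod 5 = 3"
  shows "6 + 105 * a x + 63 * b x + 222 * coef u x + 348 * coef v x - 80 * coef u3 x - 230 * coef v3 x - 36 * coef u5 x - 18 * coef v5 x - 25 * (a x * a x + b x * b x) + 20 * (a x * b x) - 240 * (coef v x * a x) - 150 * (coef u x * b x) \<le> 36 * d x + 18 * e x"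
proof (cases "a x \<le> 9 \<and> b x \<le> 9")
  case True
  have a: "a x mod 3 = (1 + 4 * coef u x + coef v x - coef u3 x) mod 3"
    and b: "b x mod 3 = (1 + 4 * coef v x + coef u x - coef v3 x) mod 3"
    using a_b_mod_3[OF n(1), of 1] by simp_all
  have E: "e x mod 5 = (- 12 * b x - a x - coef v5 x + 39 * coef v x + 6 * coef u x) mod 5"
    using d_e_mod_5(2)[OF n(2), of 0] by simp
  have D: "d x mod 5 = (1 - 12 * a x - b x - coef u5 x + 39 * coef u x + 6 * coef v x) mod 5"
    using d_e_mod_5(1)[OF n(2), of 1] by simp
  have c: "coprime 3 index" "coprime 5 index"
    using coprime_index_three coprime_index_five n by simp_all
  have ab: "a x \<in> set [0..9]" "b x \<in> set [0..9]"
    using True nonneg by auto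
  have "6 + 105 * a x + 63 * b x + 222 * coef u x + 348 * coef v x - 80 * coef u3 x - 230 * coef v3 x - 36 * coef u5 x - 18 * coef v5 x - 25 * (a x * a x + b x * b x) + 20 * (a x * b x) - 240 * (coef v x * a x) - 150 * (coef u x * b x) \<le> 36 * (d x mod 5) + 18 * (e x mod 5)"
    using bound_2_3_check[THEN bspec, OF ab(1), THEN bspec, OF ab(2), THEN bspec, OF uv_units[of x],
        unfolded prod.case, THEN bspec, OF dilate_units[OF c(1)], unfolded prod.case,
        THEN bspec, OF dilate_units[OF c(2)], unfolded prod.case, THEN mp, OF a, THEN mp, OF b]
    by (simp only: E D)
  also have "\<dots> \<le> 36 * d x + 18 * e x"
    using zmod_le_nonneg_dividend[of "e x" 5] zmod_le_nonneg_dividend[of "d x" 5] nonneg by simp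
  finally show ?thesis .
next
  case False
  have c: "0 \<le> coef u x" "0 \<le> coef v x" "0 \<le> coef u3 x" "0 \<le> coef v3 x" "0 \<le> coef u5 x" "0 \<le> coef v5 x"
    by (intro coef_u_nonneg coef_v_nonneg coef_dilate_set_sum_nonneg)+
  have m: "0 \<le> coef v x * a x" "0 \<le> coef u x * b x"
    using nonneg c by simp_all
  \<comment> \<open>The term \<open>20 * (a x * b x)\<close> costs at most
    \<open>10 * (a x * a x + b x * b x)\<close>, leaving \<open>- 15\<close> at the squares. Then
    \<open>105 * a - 15 * a ^ 2\<close> and \<open>63 * b - 15 * b ^ 2\<close> peak at
    \<open>7 / 2\<close> and \<open>21 / 10\<close>, where the squares behind \<open>sa\<close> and
    \<open>sb\<close> vanish.\<close>
  have m': "2 * (a x * b x) \<le> a x * a x + b x * b x"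
    using zero_le_power2[of "a x - b x"] by (simp add: power2_eq_square algebra_simps)
  have m'': "coef u x + coef v x \<le> 1"
    using coef_B_le[of x] by (simp add: coef_add)
  have sa: "0 \<le> 4 * (a x * a x) - 28 * a x + 49"
    using zero_le_power2[of "2 * a x - 7"] by (simp add: power2_eq_square algebra_simps)
  have sb: "0 \<le> 100 * (b x * b x) - 420 * b x + 441"
    using zero_le_power2[of "10 * b x - 21"] by (simp add: power2_eq_square algebra_simps)
  from False consider "a x \<ge> 10" | "b x \<ge> 10"
    by linarith
  then show ?thesis
  proof cases
    case 1
    then have "10 * a x \<le> a x * a x"
      by (intro mult_right_mono) simp_all
    then show ?thesis
      using 1 sb c nonneg[of x] m m' m'' unfolding distrib_left by linarith
  next
    case 2
    then have "10 * b x \<le> b x * b x"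
      by (intro mult_right_mono) simp_all
    then show ?thesis
      using 2 sa c nonneg[of x] m m' m'' unfolding distrib_left by linarith
  qed
qed

lemma bound_0_0_check:
  "\<forall>a\<in>set [0..5].
    \<forall>(u, v)\<in>set unit_pairs. \<forall>(u3, v3)\<in>set unit_pairs. \<forall>(u5, v5)\<in>set unit_pairs.
    a mod 3 = (2 + v - u3) mod 3 \<longrightarrow>
    5 - a - 3 * v - v5 \<le> (- a - v5 - 3 * v) mod 5"
  by code_simp

text \<open>For \<open>n\<close> divisible by 5 the multiple of \<open>b x\<close> in the residue of
  \<open>e x\<close> vanishes, so only \<open>a x\<close> is enumerated.\<close>

lemma (in lee_pair) bound_0_0:
  assumes n: "int n mod 3 = 0" "int n mod 5 = 0"
  shows "5 - a x - 3 * coef v x - coef v5 x \<le> e x"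
proof (cases "a x \<le> 5")
  case True
  have a: "a x mod 3 = (2 + coef v x - coef u3 x) mod 3"
    using a_b_mod_3[OF n(1), of 2] by simp
  have E: "e x mod 5 = (- a x - coef v5 x - 3 * coef v x) mod 5"
    using d_e_mod_5(2)[OF n(2), of 0] by simp
  have c: "coprime 3 index" "coprime 5 index"
    using coprime_index_three coprime_index_five n by simp_all
  have m: "a x \<in> set [0..5]"
    using True nonneg by auto
  have "5 - a x - 3 * coef v x - coef v5 x \<le> e x mod 5"
    using bound_0_0_check[THEN bspec, OF m, THEN bspec, OF uv_units[of x],
        unfolded prod.case, THEN bspec, OF dilate_units[OF c(1)], unfolded prod.case,
        THEN bspec, OF dilate_units[OF c(2)], unfolded prod.case, THEN mp, OF a]
    by (simp only: E)
  also have "\<dots> \<le> e x"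
    using zmod_le_nonneg_dividend nonneg by simp
  finally show ?thesis .
next
  case False
  have "0 \<le> coef v x" "0 \<le> coef v5 x"
    by (intro coef_v_nonneg coef_dilate_set_sum_nonneg)+
  then show ?thesis
    using False nonneg[of x] by linarith
qed

lemma bound_2_1_check:
  "\<forall>t\<in>set [-5..5].
    \<forall>(u, v)\<in>set unit_pairs. \<forall>(u3, v3)\<in>set unit_pairs. \<forall>(u5, v5)\<in>set unit_pairs.
    t mod 3 = (v3 - u3) mod 3 \<longrightarrow>
    72 - 3 * t - 54 * u - 36 * v - 70 * u3 - 40 * v3 - 18 * v5 - 5 * (t * t)
      \<le> 18 * ((4 - t - v5 + 3 * v + 2 * u) mod 5)"
  by code_simp

text \<open>For \<open>n\<close> congruent to 1 modulo 5 the residue of \<open>e x\<close> contains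
  \<open>- 4 * b x - a x\<close>, which is \<open>b x - a x\<close> modulo 5. The quadratic form is
  a multiple of the square of this difference, so one variable \<open>t\<close> suffices.\<close>

lemma (in lee_pair) bound_2_1:
  assumes n: "int n mod 3 = 2" "int n mod 5 = 1"
  shows "72 - 3 * a x + 3 * b x - 54 * coef u x - 36 * coef v x - 70 * coef u3 x - 40 * coef v3 x
    - 18 * coef v5 x - 5 * (a x * a x + b x * b x) + 10 * (a x * b x) \<le> 18 * e x"
proof -
  define t where "t = a x - b x"
  have "72 - 3 * t - 54 * coef u x - 36 * coef v x - 70 * coef u3 x - 40 * coef v3 x
    - 18 * coef v5 x - 5 * (t * t) \<le> 18 * e x"
  proof (cases "- 5 \<le> t \<and> t \<le> 5")
    case True
    have ab: "a x mod 3 = (1 + 4 * coef u x + coef v x - coef u3 x) mod 3"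
      "b x mod 3 = (1 + 4 * coef v x + coef u x - coef v3 x) mod 3"
      using a_b_mod_3[OF n(1), of 1] by simp_all
    then have "t mod 3 = ((1 + 4 * coef u x + coef v x - coef u3 x)
        - (1 + 4 * coef v x + coef u x - coef v3 x)) mod 3"
      unfolding t_def by (metis mod_diff_cong)
    also have "\<dots> = (coef v3 x - coef u3 x + 3 * (coef u x - coef v x)) mod 3"
      by (simp add: algebra_simps)
    also have "\<dots> = (coef v3 x - coef u3 x) mod 3"
      by presburger
    finally have t: "t mod 3 = (coef v3 x - coef u3 x) mod 3" .
    have "e x mod 5 = (4 - 4 * b x - a x - coef v5 x + 3 * coef v x + 2 * coef u x) mod 5"
      using d_e_mod_5(2)[OF n(2), of 4] by simp
    also have "4 - 4 * b x - a x - coef v5 x + 3 * coef v x + 2 * coef u x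
      = (4 - t - coef v5 x + 3 * coef v x + 2 * coef u x) + 5 * (- b x)"
      by (simp add: t_def)
    also have "\<dots> mod 5 = (4 - t - coef v5 x + 3 * coef v x + 2 * coef u x) mod 5"
      by presburger
    finally have E: "e x mod 5 = (4 - t - coef v5 x + 3 * coef v x + 2 * coef u x) mod 5" .
    have c: "coprime 3 index" "coprime 5 index"
      using coprime_index_three coprime_index_five n by simp_all
    have m: "t \<in> set [-5..5]"
      using True by auto
    have "72 - 3 * t - 54 * coef u x - 36 * coef v x - 70 * coef u3 x - 40 * coef v3 x
      - 18 * coef v5 x - 5 * (t * t) \<le> 18 * (e x mod 5)"
      using bound_2_1_check[THEN bspec, OF m, THEN bspec, OF uv_units[of x],
          unfolded prod.case, THEN bspec, OF dilate_units[OF c(1)], unfolded prod.case,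
          THEN bspec, OF dilate_units[OF c(2)], unfolded prod.case, THEN mp, OF t]
      by (simp only: E)
    also have "\<dots> \<le> 18 * e x"
      using zmod_le_nonneg_dividend nonneg by simp
    finally show ?thesis .
  next
    case False
    have c: "0 \<le> coef u x" "0 \<le> coef v x" "0 \<le> coef u3 x" "0 \<le> coef v3 x" "0 \<le> coef v5 x"
      by (intro coef_u_nonneg coef_v_nonneg coef_dilate_set_sum_nonneg)+
    from False have t: "\<bar>t\<bar> \<ge> 6"
      by linarith
    then have "6 * \<bar>t\<bar> \<le> \<bar>t\<bar> * \<bar>t\<bar>"
      by (intro mult_right_mono) simp_all
    then have "6 * \<bar>t\<bar> \<le> t * t"
      by simp
    then show ?thesis
      using c nonneg[of x] t abs_ge_minus_self[of t] by linarith
  qed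
  then show ?thesis
    by (simp add: t_def algebra_simps)
qed

lemma dilate_one [simp]: "dilate 1 P = P" "dilate (Suc 0) P = P"
  by (induction P rule: frag_induct) (simp_all add: dilate_diff)

text \<open>The minimum of \<open>x * x - 7 * x\<close> over nonnegative integers \<open>x\<close>
  with residue \<open>r\<close> modulo 5; \<open>min5\<close> is its analogue for
  \<open>x * x - 5 * x\<close>.\<close>

definition min7 :: "int \<Rightarrow> int" where
  "min7 r = (if r = 0 \<or> r = 2 then - 10 else if r = 1 then - 6 else - 12)"

definition min5 :: "int \<Rightarrow> int" where
  "min5 r = (if r = 0 then 0 else if r = 1 \<or> r = 4 then - 4 else - 6)"

lemma min_check: "\<forall>x\<in>set [0..9]. min7 (x mod 5) \<le> x * x - 7 * x \<and> min5 (x mod 5) \<le> x * x - 5 * x"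
  by code_simp

lemma min7_min5:
  fixes x :: int
  assumes "x \<ge> 0"
  shows "min7 (x mod 5) \<le> x * x - 7 * x" and "min5 (x mod 5) \<le> x * x - 5 * x"
proof -
  have "min7 (x mod 5) \<le> x * x - 7 * x \<and> min5 (x mod 5) \<le> x * x - 5 * x"
  proof (cases "x \<le> 9")
    case True
    then show ?thesis
      using assms min_check by auto
  next
    case False
    then have "10 * x \<le> x * x"
      by (intro mult_right_mono) simp_all
    then have "0 \<le> x * x - 7 * x" "0 \<le> x * x - 5 * x"
      using False by linarith+
    then show ?thesis
      by (simp add: min7_def min5_def)
  qed
  then show "min7 (x mod 5) \<le> x * x - 7 * x" and "min5 (x mod 5) \<le> x * x - 5 * x"
    by simp_all
qed

lemma bound_0_4_check:
  "\<forall>a\<in>set [0..6]. \<forall>b\<in>set [0..6].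
    \<forall>(u, v)\<in>set unit_pairs. \<forall>(u3, v3)\<in>set unit_pairs. \<forall>(u5, v5)\<in>set unit_pairs.
    a mod 3 = (2 + v - u3) mod 3 \<longrightarrow> b mod 3 = (2 + u - v3) mod 3 \<longrightarrow>
    10 - 12 * u - 12 * v - 12 * u3 - 12 * v3 - 4 * u5 - 4 * v5 - 4 * a - 4 * b
      \<le> min7 ((- (16 * a) - b - u5 + 69 * u + 8 * v) mod 5)
       + min5 ((4 - 16 * b - a - v5 + 69 * v + 8 * u) mod 5)"
  by code_simp

text \<open>The residues of \<open>d x\<close> and \<open>e x\<close> bound
  \<open>d x * d x - 7 * d x\<close> and \<open>e x * e x - 5 * e x\<close> from below, to be set
  against the upper bound \<open>sum_d2_e2\<close>.\<close>

lemma (in lee_pair) bound_0_4: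
  assumes n: "int n mod 3 = 0" "int n mod 5 = 4"
  shows "10 - 12 * coef u x - 12 * coef v x - 12 * coef u3 x - 12 * coef v3 x - 4 * coef u5 x - 4 * coef v5 x
      - 4 * a x - 4 * b x + 7 * d x + 5 * e x
    \<le> d x * d x + e x * e x"
proof (cases "a x \<le> 6 \<and> b x \<le> 6")
  case True
  have a: "a x mod 3 = (2 + coef v x - coef u3 x) mod 3"
    and b: "b x mod 3 = (2 + coef u x - coef v3 x) mod 3"
    using a_b_mod_3[OF n(1), of 2] by simp_all
  have E: "e x mod 5 = (4 - 16 * b x - a x - coef v5 x + 69 * coef v x + 8 * coef u x) mod 5"
    using d_e_mod_5(2)[OF n(2), of 4] by simp
  have D: "d x mod 5 = (- (16 * a x) - b x - coef u5 x + 69 * coef u x + 8 * coef v x) mod 5"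
    using d_e_mod_5(1)[OF n(2), of 0] by simp
  have c: "coprime 3 index" "coprime 5 index"
    using coprime_index_three coprime_index_five n by simp_all
  have ab: "a x \<in> set [0..6]" "b x \<in> set [0..6]"
    using True nonneg by auto
  have "10 - 12 * coef u x - 12 * coef v x - 12 * coef u3 x - 12 * coef v3 x - 4 * coef u5 x - 4 * coef v5 x
      - 4 * a x - 4 * b x
    \<le> min7 (d x mod 5) + min5 (e x mod 5)"
    using bound_0_4_check[THEN bspec, OF ab(1), THEN bspec, OF ab(2), THEN bspec, OF uv_units[of x],
        unfolded prod.case, THEN bspec, OF dilate_units[OF c(1)], unfolded prod.case,
        THEN bspec, OF dilate_units[OF c(2)], unfolded prod.case, THEN mp, OF a, THEN mp, OF b]
    by (simp only: D E)
  then show ?thesis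
    using min7_min5(1)[OF nonneg(3)[of x]] min7_min5(2)[OF nonneg(4)[of x]] by linarith
next
  case False
  have c: "0 \<le> coef u x" "0 \<le> coef v x" "0 \<le> coef u3 x" "0 \<le> coef v3 x" "0 \<le> coef u5 x" "0 \<le> coef v5 x"
    by (intro coef_u_nonneg coef_v_nonneg coef_dilate_set_sum_nonneg)+
  \<comment> \<open>The least values of \<open>min7\<close> and \<open>min5\<close>. With
    \<open>a x + b x \<ge> 7\<close> the remaining terms on the left are at most
    \<open>10 - 4 * 7\<close>, exactly their sum.\<close>
  have "- 12 \<le> d x * d x - 7 * d x" "- 6 \<le> e x * e x - 5 * e x"
    using min7_min5(1)[OF nonneg(3)[of x]] min7_min5(2)[OF nonneg(4)[of x]]
    by (auto simp: min7_def min5_def split: if_splits)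
  moreover have "a x + b x \<ge> 7"
    using False nonneg[of x] by linarith
  ultimately show ?thesis
    using c by linarith
qed

text \<open>This is \<open>bound_2_3\<close> at \<open>0\<close>, where \<open>u\<close>,
  \<open>u3\<close>, \<open>u5\<close> have coefficient 1 and \<open>v\<close>, \<open>v3\<close>,
  \<open>v5\<close> coefficient 0, improved by \<open>25 * (a + b) - 104\<close>.\<close>

lemma bound_zero_check:
  "\<forall>a\<in>set [0..9]. \<forall>b\<in>set [0..9]. a mod 3 = 1 \<longrightarrow> b mod 3 = 2 \<longrightarrow>
    8 + 130 * a - 62 * b - 25 * (a * a + b * b) + 20 * (a * b)
      \<le> 36 * ((- (12 * a) - b + 39) mod 5) + 18 * ((- (12 * b) - a + 6) mod (5::int))"
  by code_simp

section \<open>Summation of the bounds over the quotient\<close>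

context lee_pair
begin

text \<open>The summed bounds are linear in \<open>n\<close> and \<open>n * n\<close>; this
  comparison of the two lets linear arithmetic finish.\<close>

lemma square_ge: "c \<le> int n \<Longrightarrow> c * int n \<le> int n * int n"
  by (intro mult_right_mono) simp_all

lemma numeral_square: "int n * (numeral k * int n) = numeral k * (int n * int n)"
  by simp

lemmas sums_a2_b2 = sum_a2_b2[unfolded power2_eq_square sum.distrib]
lemmas sums_d2_e2 = sum_d2_e2[unfolded power2_eq_square sum.distrib]

text \<open>Summed over all cosets, the bound becomes \<open>n ^ 2 \<le> 3 * n\<close>. Here and in
  the next lemmas the threshold is the least member of the class that is none of \<open>0\<close>,
  \<open>2\<close>, \<open>3\<close>, \<open>5\<close>, \<open>8\<close>, \<open>11\<close>,
  \<open>23\<close>.\<close>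

lemma not_0_0:
  assumes n: "int n mod 3 = 0" "int n mod 5 = 0" and ge: "int n \<ge> 15"
  shows False
proof -
  have "(\<Sum>x\<in>reps. 5 - a x - 3 * coef v x - coef v5 x) \<le> (\<Sum>x\<in>reps. e x)"
    by (intro sum_mono bound_0_0 n)
  then show False
    using ge square_ge[OF ge]
    unfolding sum_rules power2_eq_square ring_distribs numeral_square by linarith
qed

lemma not_0_1:
  assumes n: "int n mod 3 = 0" "int n mod 5 = 1" and ge: "int n \<ge> 6"
  shows False
proof -
  have "(\<Sum>x\<in>reps. 22 - 3 * a x - 2 * b x - 4 * coef u x - 6 * coef v x - 15 * coef u3 x - 5 * coef v3 x - 3 * coef v5 x) \<le> (\<Sum>x\<in>reps. 3 * e x)"
    by (intro sum_mono bound_0_1 n)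
  then show False
    using ge square_ge[OF ge]
    unfolding sum_rules power2_eq_square ring_distribs numeral_square by linarith
qed

lemma not_0_2:
  assumes n: "int n mod 3 = 0" "int n mod 5 = 2" and ge: "int n \<ge> 12"
  shows False
proof -
  have "(\<Sum>x\<in>reps. 26 - 3 * a x - 4 * b x - 8 * coef u x - 9 * coef v x - 15 * coef u3 x - 10 * coef v3 x - 3 * coef v5 x) \<le> (\<Sum>x\<in>reps. 3 * e x)"
    by (intro sum_mono bound_0_2 n)
  then show False
    using ge square_ge[OF ge]
    unfolding sum_rules power2_eq_square ring_distribs numeral_square by linarith
qed

lemma not_0_3:
  assumes n: "int n mod 3 = 0" "int n mod 5 = 3" and ge: "int n \<ge> 18"
  shows False
proof -
  have "(\<Sum>x\<in>reps. 20 - 3 * a x - b x - 2 * coef u x - 18 * coef v x - 15 * coef u3 x - 10 * coef v3 x - 3 * coef v5 x) \<le> (\<Sum>x\<in>reps. 3 * e x)"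
    by (intro sum_mono bound_0_3 n)
  then show False
    using ge square_ge[OF ge]
    unfolding sum_rules power2_eq_square ring_distribs numeral_square by linarith
qed

lemma not_0_4:
  assumes n: "int n mod 3 = 0" "int n mod 5 = 4" and ge: "int n \<ge> 9"
  shows False
proof -
  have "(\<Sum>x\<in>reps. 10 - 12 * coef u x - 12 * coef v x - 12 * coef u3 x - 12 * coef v3 x - 4 * coef u5 x - 4 * coef v5 x - 4 * a x - 4 * b x + 7 * d x + 5 * e x) \<le> (\<Sum>x\<in>reps. d x * d x + e x * e x)"
    by (intro sum_mono bound_0_4 n)
  then show False
    using ge square_ge[OF ge] sums_d2_e2
    unfolding sum_rules power2_eq_square ring_distribs numeral_square by linarith
qed

lemma not_2_0:
  assumes n: "int n mod 3 = 2" "int n mod 5 = 0" and ge: "int n \<ge> 20"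
  shows False
proof -
  have "(\<Sum>x\<in>reps. -10 + 19 * a x + 25 * b x - 20 * coef u x - 38 * coef v x - 10 * coef u3 x - 10 * coef v3 x - 6 * coef v5 x - 5 * (a x * a x + b x * b x)) \<le> (\<Sum>x\<in>reps. 6 * e x)"
    by (intro sum_mono bound_2_0 n)
  then show False
    using ge square_ge[OF ge] sums_a2_b2 a0_b0_le
    unfolding sum_rules power2_eq_square ring_distribs numeral_square by linarith
qed

lemma not_2_1:
  assumes n: "int n mod 3 = 2" "int n mod 5 = 1" and ge: "int n \<ge> 26"
  shows False
proof -
  have "(\<Sum>x\<in>reps. 72 - 3 * a x + 3 * b x - 54 * coef u x - 36 * coef v x - 70 * coef u3 x - 40 * coef v3 x - 18 * coef v5 x - 5 * (a x * a x + b x * b x) + 10 * (a x * b x)) \<le> (\<Sum>x\<in>reps. 18 * e x)"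
    by (intro sum_mono bound_2_1 n)
  then show False
    using ge square_ge[OF ge] sums_a2_b2 a0_b0_le
    unfolding sum_rules power2_eq_square ring_distribs numeral_square by (simp | (simp add: algebra_simps; fail) | smt (verit))
qed

lemma not_2_2:
  assumes n: "int n mod 3 = 2" "int n mod 5 = 2" and ge: "int n \<ge> 17"
  shows False
proof -
  have "(\<Sum>x\<in>reps. -18 + 19 * a x + 27 * b x - 16 * coef u x - 28 * coef v x - 10 * coef u3 x - 20 * coef v3 x - 6 * coef v5 x - 5 * (a x * a x + b x * b x)) \<le> (\<Sum>x\<in>reps. 6 * e x)"
    by (intro sum_mono bound_2_2 n)
  then show False
    using ge square_ge[OF ge] sums_a2_b2 a0_b0_le
    unfolding sum_rules power2_eq_square ring_distribs numeral_square by linarith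
qed

lemma not_2_3:
  assumes n: "int n mod 3 = 2" "int n mod 5 = 3" and ge: "int n \<ge> 38"
  shows False
proof -
  have "(\<Sum>x\<in>reps. 6 + 105 * a x + 63 * b x + 222 * coef u x + 348 * coef v x - 80 * coef u3 x - 230 * coef v3 x - 36 * coef u5 x - 18 * coef v5 x - 25 * (a x * a x + b x * b x) + 20 * (a x * b x) - 240 * (coef v x * a x) - 150 * (coef u x * b x)) \<le> (\<Sum>x\<in>reps. 36 * d x + 18 * e x)"
    by (intro sum_mono bound_2_3 n)
  then show False
    using ge square_ge[OF ge] sums_a2_b2 a0_b0_le
    unfolding sum_rules power2_eq_square ring_distribs numeral_square by linarith
qed

lemma not_2_4:
  assumes n: "int n mod 3 = 2" "int n mod 5 = 4" and ge: "int n \<ge> 14"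
  shows False
proof -
  have "(\<Sum>x\<in>reps. -39 + 36 * a x + 36 * b x - 18 * coef u x - 9 * coef v x - 40 * coef u3 x - 40 * coef v3 x - 9 * coef v5 x - 5 * (a x * a x + b x * b x) - 5 * (a x * b x)) \<le> (\<Sum>x\<in>reps. 9 * e x)"
    by (intro sum_mono bound_2_4 n)
  then show False
    using ge square_ge[OF ge] sums_a2_b2 a0_b0_le
    unfolding sum_rules power2_eq_square ring_distribs numeral_square by linarith
qed

lemma coef_zero_U:
  assumes "0 \<in> U" and "coprime k index"
  shows "coef (dilate k u) 0 = 1 \<and> coef (dilate k v) 0 = 0"
proof -
  have "card {x \<in> U. 0 - x \<in> K} > 0"
    using assms zero_mem finite_U by (auto simp: card_gt_0_iff)
  then have "coef u 0 \<ge> 1"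
    by (simp add: coef_set_sum finite_U)
  then have "coef u 0 = 1 \<and> coef v 0 = 0"
    using coef_B_le[of 0] coef_v_nonneg[of 0] by (simp add: coef_add)
  then show ?thesis
    using assms(2) by (simp add: coef_dilate_0)
qed

text \<open>
  For \<open>n = 23\<close> the trivial bound on \<open>a 0 + b 0\<close> is too weak, so the terms at \<open>0\<close> are kept.
\<close>

lemma not_23:
  assumes "n = 23"
  shows False
proof -
  have n: "int n mod 3 = 2" "int n mod 5 = 3"
    using assms by simp_all
  have c: "coprime 1 index" "coprime 3 index" "coprime 5 index"
    using coprime_index_three coprime_index_five n by simp_all
  have z: "coef u 0 = 1" "coef v 0 = 0" "coef u3 0 = 1" "coef v3 0 = 0" "coef u5 0 = 1" "coef v5 0 = 0"
    using coef_zero_U[OF _ c(1)] coef_zero_U[OF _ c(2)] coef_zero_U[OF _ c(3)] zero_in_odd assms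
      dilate_one by auto
  have m: "a 0 mod 3 = 1" "b 0 mod 3 = 2"
    using a_b_mod_3[OF n(1), of 1 0] z by simp_all
  have D: "d 0 mod 5 = (- (12 * a 0) - b 0 + 39) mod 5"
    using d_e_mod_5(1)[OF n(2), of 1 0] z by simp
  have E: "e 0 mod 5 = (- (12 * b 0) - a 0 + 6) mod 5"
    using d_e_mod_5(2)[OF n(2), of 0 0] z by simp
  have zero: "8 + 130 * a 0 - 62 * b 0 - 25 * (a 0 * a 0 + b 0 * b 0) + 20 * (a 0 * b 0)
     \<le> 36 * d 0 + 18 * e 0"
  proof (cases "a 0 \<le> 9 \<and> b 0 \<le> 9")
    case True
    then have "a 0 \<in> set [0..9]" "b 0 \<in> set [0..9]"
      using nonneg by auto
    from bound_zero_check[THEN bspec, OF this(1), THEN bspec, OF this(2), THEN mp, OF m(1), THEN mp, OF m(2)]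
    have "8 + 130 * a 0 - 62 * b 0 - 25 * (a 0 * a 0 + b 0 * b 0) + 20 * (a 0 * b 0)
       \<le> 36 * (d 0 mod 5) + 18 * (e 0 mod 5)"
      by (simp only: D E)
    also have "\<dots> \<le> 36 * d 0 + 18 * e 0"
      using zmod_le_nonneg_dividend[of "e 0" 5] zmod_le_nonneg_dividend[of "d 0" 5] nonneg by simp
    finally show ?thesis .
  next
    case False
    have m': "2 * (a 0 * b 0) \<le> a 0 * a 0 + b 0 * b 0"
      using zero_le_power2[of "a 0 - b 0"] by (simp add: power2_eq_square algebra_simps)
    have sa: "0 \<le> 9 * (a 0 * a 0) - 78 * a 0 + 169"
      using zero_le_power2[of "3 * a 0 - 13"] by (simp add: power2_eq_square algebra_simps)
    from False consider "a 0 \<ge> 10" | "b 0 \<ge> 10"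
      by linarith
    then show ?thesis
    proof cases
      case 1
      then have "10 * a 0 \<le> a 0 * a 0"
        by (intro mult_right_mono) simp_all
      then show ?thesis
        using 1 nonneg[of 0] m' unfolding distrib_left by (smt (verit) zero_le_square)
    next
      case 2
      then have "10 * b 0 \<le> b 0 * b 0"
        by (intro mult_right_mono) simp_all
      then show ?thesis
        using 2 sa nonneg[of 0] m' unfolding distrib_left by linarith
    qed
  qed
  \<comment> \<open>The extra summand at the coset of \<open>0\<close> cancels the unknown
    \<open>a 0 + b 0\<close> in the second moments.\<close>
  have "6 + 105 * a x + 63 * b x + 222 * coef u x + 348 * coef v x - 80 * coef u3 x - 230 * coef v3 x - 36 * coef u5 x - 18 * coef v5 x - 25 * (a x * a x + b x * b x) + 20 * (a x * b x) - 240 * (coef v x * a x) - 150 * (coef u x * b x) + (if x = rep 0 then 25 * (a 0 + b 0) - 104 else 0) \<le> 36 * d x + 18 * e x" for x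
  proof (cases "x = rep 0")
    case True
    have "coef P x = coef P 0" for P
      unfolding True by (rule coef_cong) (rule rep_diff)
    then have "a x = a 0" "b x = b 0" "d x = d 0" "e x = e 0" "coef u x = 1" "coef v x = 0"
        "coef u3 x = 1" "coef v3 x = 0" "coef u5 x = 1" "coef v5 x = 0"
      by (simp_all add: a_def b_def d_def e_def z)
    then show ?thesis
      using zero True by simp
  next
    case False
    then show ?thesis
      using bound_2_3[OF n] by simp
  qed
  then have "(\<Sum>x\<in>reps. 6 + 105 * a x + 63 * b x + 222 * coef u x + 348 * coef v x - 80 * coef u3 x - 230 * coef v3 x - 36 * coef u5 x - 18 * coef v5 x - 25 * (a x * a x + b x * b x) + 20 * (a x * b x) - 240 * (coef v x * a x) - 150 * (coef u x * b x) + (if x = rep 0 then 25 * (a 0 + b 0) - 104 else 0))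
     \<le> (\<Sum>x\<in>reps. 36 * d x + 18 * e x)"
    by (intro sum_mono) simp
  moreover have "(\<Sum>x\<in>reps. if x = rep 0 then 25 * (a 0 + b 0) - 104 else 0) = 25 * (a 0 + b 0) - 104"
    by simp
  ultimately show False
    using sums_a2_b2 assms unfolding sum_rules power2_eq_square ring_distribs numeral_square by simp
qed

end

section \<open>Prime index\<close>

context finite_index_subgroup
begin

lemma coef_dilate_id:
  assumes "\<And>y. of_nat k * y - y \<in> K"
  shows "coef (dilate k P) x = coef P x"
proof (induction P rule: frag_induct)
  case (one y)
  have "x - of_nat k * y \<in> K \<longleftrightarrow> x - y \<in> K"
    using assms[of y] diff_trans diff_swap by blast
  then show ?case
    by (simp add: coef_frag_of)
qed (simp_all add: dilate_diff coef_diff)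

lemma coef_dilate_mem:
  assumes "\<And>y. of_nat k * y \<in> K"
  shows "coef (dilate k P) x = aug P * of_bool (x \<in> K)"
proof (induction P rule: frag_induct)
  case (one y)
  have "x - of_nat k * y \<in> K \<longleftrightarrow> x \<in> K"
    using add_mem_cancel[OF minus_mem[OF assms[of y]], of x] by simp
  then show ?case
    by (simp add: coef_frag_of)
qed (simp_all add: dilate_diff coef_diff aug_diff algebra_simps)

lemma const_mod_cong_mult:
  assumes "const_mod m (P - P')" "const_mod m (Q - Q')"
  shows "const_mod m (P * Q - P' * Q')"
proof -
  have "const_mod m ((P - P') * Q + (Q - Q') * P')"
    by (intro const_mod_add const_mod_mult assms)
  then show ?thesis
    by (simp add: algebra_simps)
qed

lemma const_mod_of_int: "m dvd k \<Longrightarrow> const_mod m (of_int k)"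
  using const_mod_multiple[of m] by (metis dvdE of_int_mult)

lemma const_mod_trans: "const_mod m (P - Q) \<Longrightarrow> const_mod m (Q - R) \<Longrightarrow> const_mod m (P - R)"
  using const_mod_add[of m "P - Q" "Q - R"] by simp

text \<open>Iterating \<open>D = D * (D * Q)\<close> modulo the ideal makes \<open>D\<close> a
  multiple of every power of itself, in particular of \<open>D ^ p\<close>.\<close>

lemma const_mod_nilpotent:
  assumes "const_mod m (D ^ p)" and "const_mod m (D - D * (D * Q))"
  shows "const_mod m D"
proof -
  have "const_mod m (D - D * (D * Q) ^ j)" for j
  proof (induction j)
    case 0
    show ?case
      by (auto intro: const_modI[of _ 0])
  next
    case (Suc j)
    have "const_mod m ((D - D * (D * Q)) * (D * Q) ^ j)"
      by (intro const_mod_mult assms)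
    then have "const_mod m (D * (D * Q) ^ j - D * (D * Q) ^ Suc j)"
      by (simp add: algebra_simps)
    with Suc show ?case
      by (rule const_mod_trans)
  qed
  from this[of p] have "const_mod m (D - D ^ p * (Q ^ p * D))"
    by (simp add: power_mult_distrib algebra_simps)
  from const_mod_add[OF this const_mod_mult[OF assms(1), of "Q ^ p * D"]] show ?thesis
    by simp
qed

end

context lee_pair
begin

text \<open>Multiplication by the index \<open>p\<close> sends everything to the zero coset, so
  \<open>B ^ p\<close> is congruent to the augmentation \<open>2 n + 1\<close> of \<open>B\<close>.
  The Frobenius congruence and Fermat's theorem carry this over to the shifted element.\<close>

lemma prime_index_power:
  assumes p: "prime index"
  shows "const_mod (int index) ((B - of_int (2 * int n + 1)) ^ index)"
proof -
  define \<beta> where "\<beta> = 2 * int n + 1"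
  obtain w1 where "B ^ index = dilate index B + of_nat index * w1"
    using set_sum_power_prime[OF p, of "U \<union> V"] finite_U finite_V unfolding B_eq_set_sum by blast
  then have w1: "B ^ index = dilate index B + of_int (int index) * w1"
    by simp
  obtain w2 where "((B - of_int \<beta>) + of_int \<beta>) ^ index
      = (B - of_int \<beta>) ^ index + of_int \<beta> ^ index + of_nat index * w2"
    using power_add_prime[OF p] by blast
  then have w2: "B ^ index = (B - of_int \<beta>) ^ index + of_int \<beta> ^ index + of_int (int index) * w2"
    by simp
  \<comment> \<open>Fermat's theorem for \<open>\<beta>\<close>, as the Frobenius congruence for a
    sum of \<open>\<beta>\<close> ones.\<close>
  obtain w3 where "(\<Sum>i<nat \<beta>. 1 :: int) ^ index = (\<Sum>i<nat \<beta>. 1 ^ index) + of_nat index * w3"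
    using power_sum_prime[OF p, of "{..<nat \<beta>}" "\<lambda>_. 1 :: int"] by blast
  then have "\<beta> ^ index = \<beta> + int index * w3"
    by (simp add: \<beta>_def)
  then have w3: "(of_int \<beta> ^ index :: 'a \<Rightarrow>\<^sub>0 int) = of_int \<beta> + of_int (int index) * of_int w3"
    by (metis of_int_add of_int_mult of_int_power)
  have "null (dilate index B - of_int \<beta>)"
    unfolding null_def
    by (simp only: coef_diff coef_dilate_mem[OF index_mult_mem] coef_of_int) (simp add: aug_add \<beta>_def)
  then have "const_mod (int index) ((dilate index B - of_int \<beta>) + of_int (int index) * (w1 - w2 - of_int w3))"
    by (intro const_mod_add const_mod_multiple null_const_mod)
  also have "(dilate index B - of_int \<beta>) + of_int (int index) * (w1 - w2 - of_int w3) = (B - of_int \<beta>) ^ index"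
    using w1 w2 w3 by (simp add: algebra_simps)
  finally show ?thesis
    by (simp add: \<beta>_def)
qed

text \<open>Otherwise the coefficients of \<open>B\<close> off the zero coset would be all 0 or all
  1, but their sum \<open>2 n\<close> lies strictly between 0 and the number
  \<open>n ^ 2 + n\<close> of these cosets.\<close>

lemma not_const_shift:
  assumes "n \<ge> 2" and "m > 1"
  shows "\<not> const_mod m (B - of_int k)"
proof
  assume "const_mod m (B - of_int k)"
  then obtain l where l: "\<And>x. [coef (B - of_int k) x = l] (mod m)"
    by (auto simp: const_mod_def)
  have l: "[coef B x = l] (mod m)" if "x \<notin> K" for x
    using l[of x] that by (simp add: coef_diff coef_of_int)
  have c01: "coef B x = 0 \<or> coef B x = 1" for x
    using coef_B_nonneg[of x] coef_B_le[of x] by linarith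
  have "\<exists>x\<in>reps - {rep 0}. coef B x = i" if i: "i = 0 \<or> i = 1" for i
  proof (rule ccontr)
    assume neg: "\<not> ?thesis"
    then have "coef B x = 1 - i" if "x \<in> reps - {rep 0}" for x
      using that c01[of x] i by auto
    then have "(\<Sum>x\<in>reps - {rep 0}. coef B x) = (\<Sum>x\<in>reps - {rep 0}. 1 - i)"
      by (intro sum.cong) auto
    also have "\<dots> = (int index - 1) * (1 - i)"
      using index_pos by (simp add: card_Diff_singleton index_def of_nat_diff Suc_leI)
    finally have "(\<Sum>x\<in>reps. coef B x) = coef B (rep 0) + (int index - 1) * (1 - i)"
      by (subst sum.remove[of _ "rep 0"]) simp_all
    moreover have "coef B (rep 0) = 1"
      using coef_cong[OF rep_diff] coef_B_0 by metis
    moreover have "(\<Sum>x\<in>reps. coef B x) = 2 * int n + 1"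
      unfolding aug_def[symmetric] by (simp add: aug_add)
    ultimately have "2 * int n = (int n ^ 2 + int n) * (1 - i)"
      by (simp add: int_index)
    moreover have "int n * int n \<ge> 2 * int n"
      using assms by (intro mult_right_mono) simp_all
    ultimately show False
      using i assms by (auto simp: power2_eq_square)
  qed
  then obtain x y where "x \<in> reps - {rep 0}" "coef B x = 0" "y \<in> reps - {rep 0}" "coef B y = 1"
    by metis
  moreover have "x \<notin> K" if "x \<in> reps - {rep 0}" for x
    using that rep_eq_iff[of x 0] rep_of_reps[of x] by auto
  ultimately have "[0 = l] (mod m)" "[1 = l] (mod m)"
    using l by metis+
  then have "[0 = 1] (mod m)"
    using cong_sym cong_trans by blast
  then show False
    using assms(2) by (simp add: cong_def)
qed

text \<open>
  If the index is a prime \<open>p\<close>, then modulo \<open>p\<close> the element \<open>B\<close> differs from the fixed point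
  \<open>2 n + 1\<close> of \<open>y \<mapsto> 2 n - 2 - y\<^sup>2\<close> by a nilpotent, and doubling acts on \<open>B\<close> as this map. Its
  multiplier at the fixed point is \<open>- 2 (2 n + 1)\<close>; on the other hand a power of \<open>2\<close> congruent
  to \<open>1\<close> acts trivially.
\<close>

lemma prime_index_multiplier:
  assumes p: "prime index" and n: "n \<ge> 2"
    and k: "[2 ^ k = 1] (mod index)"
    and \<mu>: "\<not> [(- 2 * (2 * int n + 1)) ^ k = 1] (mod int index)"
  shows False
proof -
  define m where "m = int index"
  define \<beta> where "\<beta> = 2 * int n + 1"
  define \<mu> where "\<mu> = - 2 * \<beta>"
  define D where "D = B - of_int \<beta>"
  \<comment> \<open>To first order in \<open>D\<close> each doubling multiplies by
    \<open>\<mu>\<close>; \<open>Q\<close> collects the higher terms.\<close>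
  have "\<exists>Q. const_mod m (dilate (2 ^ j) B - (of_int \<beta> + of_int (\<mu> ^ j) * D + D ^ 2 * Q))" for j
  proof (induction j)
    case 0
    show ?case
      by (auto simp: D_def intro!: exI[of _ 0] const_modI[of _ 0])
  next
    case (Suc j)
    define X where "X = dilate (2 ^ j) B"
    from Suc obtain Q where Q: "const_mod m (X - (of_int \<beta> + of_int (\<mu> ^ j) * D + D ^ 2 * Q))"
      unfolding X_def by blast
    define Y where "Y = of_int \<beta> + of_int (\<mu> ^ j) * D + D ^ 2 * Q"
    \<comment> \<open>The cofactor of \<open>D ^ 2\<close> in \<open>- Y ^ 2\<close>.\<close>
    define Q' where "Q' = - 2 * of_int \<beta> * Q - (of_int (\<mu> ^ j) + D * Q) ^ 2"
    have cop: "coprime (2 ^ j) index"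
      using coprime_index_two coprime_power_left_iff by blast
    have 1: "const_mod m (X ^ 2 - s + 2 + dilate (2 ^ Suc j) B)"
      using const_dilate_B_square[OF cop] by (simp add: X_def)
    have 2: "const_mod m (X * X - Y * Y)"
      using Q by (intro const_mod_cong_mult) (simp_all add: Y_def)
    have "s - 2 - of_int \<beta> ^ 2 - of_int \<beta> = (of_int (2 * int n - 2 - \<beta> ^ 2 - \<beta>) :: 'a \<Rightarrow>\<^sub>0 int)"
      by simp
    \<comment> \<open>The fixed point equation for \<open>\<beta>\<close> holds modulo the index:
      the defect is \<open>- 4 * (n ^ 2 + n + 1)\<close>.\<close>
    also have "2 * int n - 2 - \<beta> ^ 2 - \<beta> = m * (- 4)"
      by (simp add: \<beta>_def m_def int_index power2_eq_square algebra_simps)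
    finally have 3: "s - 2 - of_int \<beta> ^ 2 - of_int \<beta> = (of_int (m * - 4) :: 'a \<Rightarrow>\<^sub>0 int)" .
    have "const_mod m (s - 2 - of_int \<beta> ^ 2 - of_int \<beta> :: 'a \<Rightarrow>\<^sub>0 int)"
      unfolding 3 by (rule const_mod_of_int) simp
    from const_mod_add[OF const_mod_diff[OF 1 2] this]
    have "const_mod m ((X ^ 2 - s + 2 + dilate (2 ^ Suc j) B) - (X * X - Y * Y)
      + (s - 2 - of_int \<beta> ^ 2 - of_int \<beta>))" .
    also have "(X ^ 2 - s + 2 + dilate (2 ^ Suc j) B) - (X * X - Y * Y)
      + (s - 2 - of_int \<beta> ^ 2 - of_int \<beta>)
      = dilate (2 ^ Suc j) B - (of_int \<beta> + of_int (\<mu> ^ Suc j) * D + D ^ 2 * Q')"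
      by (simp add: Y_def Q'_def \<mu>_def power2_eq_square algebra_simps)
    finally show ?case
      by blast
  qed
  then obtain Q where Q: "const_mod m (dilate (2 ^ k) B - (of_int \<beta> + of_int (\<mu> ^ k) * D + D ^ 2 * Q))"
    by blast
  have id: "of_nat (2 ^ k) * y - y \<in> K" for y :: 'a
  proof -
    obtain i where "2 ^ k = 1 + index * i"
      using k by (metis cong_iff_lin_nat cong_sym cong_to_1'_nat mult.commute one_le_numeral one_le_power le_add_diff_inverse cong_altdef_nat dvdE)
    then have "of_nat (2 ^ k) * y - y = of_nat i * (of_nat index * y)"
      by (simp only: of_nat_add of_nat_mult) (simp add: algebra_simps)
    then show ?thesis
      using of_nat_mult_mem[OF index_mult_mem] by simp
  qed
  have "null (dilate (2 ^ k) B - B)"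
    by (simp only: null_def coef_diff coef_dilate_id[OF id]) simp
  \<comment> \<open>Comparison with \<open>B = \<beta> + D\<close> makes
    \<open>(1 - \<mu> ^ k) * D\<close> a multiple of \<open>D ^ 2\<close>. Once the integer factor
    is inverted modulo the prime \<open>m\<close>, nilpotency of \<open>D\<close> applies.\<close>
  then have "const_mod m ((dilate (2 ^ k) B - (of_int \<beta> + of_int (\<mu> ^ k) * D + D ^ 2 * Q))
      - (dilate (2 ^ k) B - B))"
    by (intro const_mod_diff Q null_const_mod)
  then have 1: "const_mod m (of_int (1 - \<mu> ^ k) * D - D ^ 2 * Q)"
    by (simp add: D_def algebra_simps)
  have "\<not> m dvd 1 - \<mu> ^ k"
    using \<mu> by (simp add: \<mu>_def \<beta>_def m_def cong_iff_dvd_diff dvd_diff_commute)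
  moreover have "prime m"
    using p by (simp add: m_def)
  ultimately have "coprime (1 - \<mu> ^ k) m"
    using prime_imp_coprime coprime_commute by blast
  then obtain i where "[(1 - \<mu> ^ k) * i = 1] (mod m)"
    using coprime_iff_invertible_int by blast
  then obtain z where z: "(1 - \<mu> ^ k) * i = 1 + m * z"
    by (metis cong_iff_lin cong_sym)
  have "const_mod m ((of_int (1 - \<mu> ^ k) * D - D ^ 2 * Q) * of_int i - of_int m * (of_int z * D))"
    by (intro const_mod_diff const_mod_mult[OF 1] const_mod_multiple)
  also have "(of_int (1 - \<mu> ^ k) * D - D ^ 2 * Q) * of_int i - of_int m * (of_int z * D)
      = (of_int ((1 - \<mu> ^ k) * i) - of_int (m * z)) * D - D * (D * (Q * of_int i))"
    by (simp only: of_int_mult) (simp add: power2_eq_square algebra_simps)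
  also have "\<dots> = D - D * (D * (Q * of_int i))"
    by (simp add: z)
  finally have "const_mod m D"
    using prime_index_power[OF p] by (intro const_mod_nilpotent[of m D index]) (simp_all add: D_def \<beta>_def m_def)
  moreover have "m > 1"
    using p prime_gt_1_nat by (simp add: m_def)
  ultimately show False
    using not_const_shift[OF n] by (simp add: D_def)
qed

text \<open>Modulo 31, \<open>2 ^ 5\<close> is 1, but the multiplier \<open>- 22\<close> has fifth
  power 25.\<close>

lemma not_5: "n \<noteq> 5"
proof
  assume n: "n = 5"
  then have i: "index = 31"
    by (simp add: index_eq)
  have "prime (31 :: nat)"
    by simp
  then show False
    using prime_index_multiplier[of 5] by (simp add: n i cong_def)
qed

text \<open>Modulo 73, \<open>2 ^ 9\<close> is 1, but the multiplier \<open>- 34\<close> has ninth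
  power 10.\<close>

lemma not_8: "n \<noteq> 8"
proof
  assume n: "n = 8"
  then have i: "index = 73"
    by (simp add: index_eq)
  have "prime (73 :: nat)"
    by simp
  then show False
    using prime_index_multiplier[of 9] by (simp add: n i cong_def)
qed

end

section \<open>Index divisible by three\<close>

context finite_index_subgroup
begin

lemma finite_index_superset:
  assumes "K \<subseteq> N" "\<And>x y. x \<in> N \<Longrightarrow> y \<in> N \<Longrightarrow> x - y \<in> N"
  shows "finite_index_subgroup N"
proof
  show "0 \<in> N"
    using assms(1) zero_mem by blast
  show "\<exists>F. finite F \<and> (\<forall>x. \<exists>r\<in>F. x - r \<in> N)"
    using finite_cover assms(1) by (meson subsetD)
qed (use assms(2) in auto)

lemma index_superset:
  assumes "finite_index_subgroup N" "K \<subseteq> N" and "\<And>x. card {r \<in> reps. r - x \<in> N} = k"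
  shows "index = k * finite_index_subgroup.index N"
proof -
  interpret N: finite_index_subgroup N
    by fact
  have "index = card (\<Union>x\<in>N.reps. {r \<in> reps. r - x \<in> N})"
  proof -
    have "reps = (\<Union>x\<in>N.reps. {r \<in> reps. r - x \<in> N})"
      using N.rep_diff N.diff_swap N.rep_in_reps by blast
    then show ?thesis
      by (simp add: index_def)
  qed
  also have "\<dots> = (\<Sum>x\<in>N.reps. card {r \<in> reps. r - x \<in> N})"
  proof (rule card_UN_disjoint)
    show "\<forall>x\<in>N.reps. \<forall>y\<in>N.reps. x \<noteq> y \<longrightarrow> {r \<in> reps. r - x \<in> N} \<inter> {r \<in> reps. r - y \<in> N} = {}"
      using N.rep_eq_iff N.rep_of_reps by (metis (mono_tags, lifting) Int_emptyI mem_Collect_eq)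
  qed simp_all
  also have "\<dots> = k * N.index"
    by (simp add: assms(3) N.index_def)
  finally show ?thesis .
qed

lemma coef_superset:
  assumes "finite_index_subgroup N" "K \<subseteq> N"
  shows "finite_index_subgroup.coef N P x = (\<Sum>r\<in>reps. if r - x \<in> N then coef P r else 0)"
proof -
  interpret N: finite_index_subgroup N
    by fact
  show ?thesis
  proof (induction P rule: frag_induct)
    case (one y)
    have mem: "r - x \<in> N \<longleftrightarrow> r' - x \<in> N" if "r - r' \<in> K" for r r'
      using N.add_mem_cancel[of "r - r'" "r' - x"] that assms(2) by auto
    have "(\<Sum>r\<in>reps. if r - x \<in> N then coef (frag_of y) r else 0)
        = (\<Sum>r\<in>reps. if r - y \<in> K then of_bool (r - x \<in> N) else 0)"
      by (intro sum.cong) (auto simp: coef_frag_of)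
    also have "\<dots> = of_bool (y - x \<in> N)"
      using mem by (intro sum_reps_delta) simp
    finally show ?case
      by (simp add: N.coef_frag_of N.diff_swap[of x])
  next
    case (diff P Q)
    have "(\<Sum>r\<in>reps. if r - x \<in> N then coef (P - Q) r else 0)
        = (\<Sum>r\<in>reps. (if r - x \<in> N then coef P r else 0) - (if r - x \<in> N then coef Q r else 0))"
      by (intro sum.cong) (simp_all add: coef_diff)
    then show ?case
      using diff by (simp add: N.coef_diff sum_subtractf)
  qed (simp cong: if_cong)
qed

lemma const_superset:
  assumes "finite_index_subgroup N" "K \<subseteq> N" "const_mod 0 P"
  shows "finite_index_subgroup.const_mod N 0 P"
proof -
  interpret N: finite_index_subgroup N
    by fact
  obtain k where k: "\<And>x. coef P x = k"
    using assms(3) by (auto simp: const_mod_def cong_def)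
  have "N.coef P x = (\<Sum>r\<in>reps. if r \<in> N then k else 0)" for x
  proof -
    have "N.coef P x = (\<Sum>r\<in>reps. if (r - x) \<in> N then k else 0)"
      by (simp add: coef_superset[OF assms(1,2)] k cong: if_cong)
    also have "\<dots> = (\<Sum>r\<in>reps. if (r + (- x)) \<in> N then k else 0)"
      by simp
    also have "\<dots> = (\<Sum>r\<in>reps. if r \<in> N then k else 0)"
      using assms(2) N.add_mem_cancel N.minus_mem
      by (intro sum_reps_translate) (metis (no_types, lifting) diff_add_cancel add.commute subsetD)
    finally show ?thesis .
  qed
  then show ?thesis
    by (rule N.const_modI)
qed

text \<open>Cauchy's theorem for 3: the cube of the full sum has coefficient
  \<open>index ^ 2\<close> at \<open>0\<close>, and modulo 3 this counts the cosets killed by 3.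
  Their number is thus a multiple of 3, so the zero coset is not the only one.\<close>

lemma exists_order_3:
  assumes "3 dvd index"
  obtains g where "3 * g \<in> K" "g \<notin> K"
proof -
  obtain w where w: "set_sum reps ^ 3 = dilate 3 (set_sum reps) + of_nat 3 * w"
    using set_sum_power_prime[of 3 reps] by auto
  have "set_sum reps ^ 3 = coset_sum * coset_sum ^ 2"
    by (simp add: coset_sum_def set_sum_def power2_eq_square power3_eq_cube)
  then have "coef (set_sum reps ^ 3) 0 = aug coset_sum ^ 2"
    by (simp add: coef_coset_sum_mult aug_power)
  also have "aug coset_sum = int index"
    by (simp add: coset_sum_def aug_sum index_def)
  finally have "int index ^ 2 = coef (dilate 3 (set_sum reps)) 0 + 3 * coef w 0"
    by (simp add: w coef_add coef_numeral_mult)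
  moreover have "3 dvd int index ^ 2"
    using assms int_dvd_int_iff[of 3 index] by (simp add: power2_eq_square)
  ultimately have d: "3 dvd coef (dilate 3 (set_sum reps)) 0"
    by (metis dvd_add_times_triv_right_iff mult.commute)
  have "coef (dilate 3 (set_sum reps)) 0 = (\<Sum>r\<in>reps. of_bool (3 * r \<in> K))"
    by (simp add: set_sum_def dilate_sum coef_sum coef_frag_of minus_mem_iff)
  also have "\<dots> = int (card {r \<in> reps. 3 * r \<in> K})"
    by (simp add: of_bool_def sum.If_cases Int_def)
  finally have d: "3 dvd card {r \<in> reps. 3 * r \<in> K}"
    using d int_dvd_int_iff[of 3] by simp
  have "{r \<in> reps. 3 * r \<in> K} \<noteq> {rep 0}"
    using d by auto
  moreover have "3 * rep 0 \<in> K"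
    using of_nat_mult_mem[of "rep 0" 3] rep_diff[of 0] by simp
  ultimately obtain g where g: "g \<in> reps" "3 * g \<in> K" "g \<noteq> rep 0"
    by auto
  then have "g \<notin> K"
    using rep_eq_iff[of g 0] rep_of_reps[of g] by auto
  then show ?thesis
    using g that by blast
qed

text \<open>The subgroup \<open>K1\<close> generated by \<open>K\<close> and \<open>g\<close> has
  index \<open>M\<close>, so multiplication by \<open>M\<close> maps everything into
  \<open>K1\<close>. It fixes \<open>g\<close> modulo \<open>K\<close>, as \<open>M\<close> is 1
  modulo 3. Hence its kernel \<open>N\<close> misses \<open>g\<close>, and \<open>0\<close>,
  \<open>g\<close>, \<open>- g\<close> represent the cosets of \<open>N\<close>.\<close>

lemma index_3_subgroup:
  assumes M: "index = 3 * M" "M mod 3 = 1"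
  obtains N g where "finite_index_subgroup N" "K \<subseteq> N" "g \<notin> N" "\<And>x. 3 * x \<in> N"
    "\<And>x. x \<in> N \<or> x - g \<in> N \<or> x + g \<in> N"
proof -
  obtain g where g: "3 * g \<in> K" "g \<notin> K"
    using exists_order_3 M by auto
  have g2: "2 * g \<notin> K"
    using diff_mem[OF g(1), of "2 * g"] g(2) by (auto simp: left_diff_distrib[symmetric])
  define K1 where "K1 = {x. x \<in> K \<or> x - g \<in> K \<or> x + g \<in> K}"
  have K1_iff: "x \<in> K1 \<longleftrightarrow> rep x = rep 0 \<or> rep x = rep g \<or> rep x = rep (- g)" for x
    by (simp add: K1_def rep_eq_iff)
  have "x - y \<in> K1" if "x \<in> K1" "y \<in> K1" for x y
  proof -
    from that obtain e f where e: "e \<in> {0, g, - g}" "x - e \<in> K" and f: "f \<in> {0, g, - g}" "y - f \<in> K"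
      by (fastforce simp: K1_def)
    have xy: "(x - y) - (e - f) \<in> K"
      using diff_mem[OF e(2) f(2)] by (simp add: algebra_simps)
    have "2 * g - - g \<in> K" "- (2 * g) - g \<in> K"
      using g(1) minus_mem[OF g(1)] by (simp_all add: algebra_simps)
    then have "\<exists>h\<in>{0, g, - g}. (e - f) - h \<in> K"
      using e(1) f(1) zero_mem by (auto simp: algebra_simps)
    then obtain h where h: "h \<in> {0, g, - g}" "(x - y) - h \<in> K"
      using diff_trans[OF xy] by blast
    then show ?thesis
      by (auto simp: K1_def)
  qed
  then have K1: "finite_index_subgroup K1" and sub: "K \<subseteq> K1"
    by (intro finite_index_superset) (auto simp: K1_def)
  interpret K1: finite_index_subgroup K1
    by (rule K1)
  have "card {r \<in> reps. r - x \<in> K1} = 3" for x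
  proof -
    have "{r \<in> reps. r - x \<in> K1} = {rep x, rep (x + g), rep (x - g)}"
    proof (intro Set.set_eqI iffI)
      fix r assume "r \<in> {r \<in> reps. r - x \<in> K1}"
      then have r: "rep r = r" and "r - x \<in> K \<or> r - (x + g) \<in> K \<or> r - (x - g) \<in> K"
        by (auto simp: K1_def rep_of_reps algebra_simps)
      then show "r \<in> {rep x, rep (x + g), rep (x - g)}"
        by (auto simp: rep_eq_iff[symmetric])
    next
      fix r assume "r \<in> {rep x, rep (x + g), rep (x - g)}"
      then show "r \<in> {r \<in> reps. r - x \<in> K1}"
        using rep_diff[of x] rep_diff[of "x + g"] rep_diff[of "x - g"]
        by (auto simp: K1_def algebra_simps)
    qed
    moreover have diff: "(x + g) - (x - g) = 2 * g"
      unfolding mult_2 by simp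
    have "rep x \<noteq> rep (x + g)" "rep x \<noteq> rep (x - g)" "rep (x + g) \<noteq> rep (x - g)"
      using g(2) g2 diff by (auto simp: rep_eq_iff minus_mem_iff)
    ultimately show ?thesis
      by simp
  qed
  from index_superset[OF K1 sub this] M have "K1.index = M"
    by simp
  then have Mx: "of_nat M * x \<in> K1" for x
    using K1.index_mult_mem by simp
  define N where "N = {x. of_nat M * x \<in> K}"
  have N: "finite_index_subgroup N" and KN: "K \<subseteq> N"
    by (intro finite_index_superset) (auto simp: N_def right_diff_distrib intro: diff_mem of_nat_mult_mem)
  have "M = 3 * (M div 3) + 1"
    using M(2) by presburger
  then have "of_nat M = (3 * of_nat (M div 3) + 1 :: 'a)"
    by (metis of_nat_1 of_nat_add of_nat_mult of_nat_numeral)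
  then have "of_nat M * g - g = of_nat (M div 3) * (3 * g)"
    by (simp add: algebra_simps)
  then have Mg: "of_nat M * g - g \<in> K"
    using of_nat_mult_mem[OF g(1)] by simp
  show ?thesis
  proof (rule that[OF N KN])
    show "g \<notin> N"
      using Mg g(2) diff_mem[of "of_nat M * g" "of_nat M * g - g"] by (auto simp: N_def)
    show "3 * x \<in> N" for x
      using index_mult_mem[of x] by (simp add: N_def M algebra_simps)
    show "x \<in> N \<or> x - g \<in> N \<or> x + g \<in> N" for x
    proof -
      have "of_nat M * (x - g) = (of_nat M * x - g) - (of_nat M * g - g)"
        "of_nat M * (x + g) = (of_nat M * x + g) + (of_nat M * g - g)"
        by (simp_all add: algebra_simps)
      then show ?thesis
        using Mx[of x] Mg diff_mem add_mem unfolding K1_def N_def by (metis mem_Collect_eq)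
    qed
  qed
qed

end

context lee_pair
begin

text \<open>Modulo a subgroup of index \<open>3\<close> symmetric elements are constants up to multiples of
  \<open>coset_sum\<close>, so that the two relations become equations between integers.\<close>

lemma mod_3_eq_1:
  assumes "n mod 3 = 1"
  shows "n = 1"
proof -
  define k where "k = n div 3"
  have nk: "n = 3 * k + 1"
    using assms unfolding k_def by presburger
  define z where "z = k * k + k"
  define M where "M = 3 * z + 1"
  have "index = 3 * M"
    by (simp add: index_eq nk M_def z_def power2_eq_square algebra_simps)
  moreover have "M mod 3 = 1"
    unfolding M_def by presburger
  ultimately obtain N g where N: "finite_index_subgroup N" "K \<subseteq> N" and g: "g \<notin> N" and three: "\<And>x. 3 * x \<in> N"
    and cover: "\<And>x. x \<in> N \<or> x - g \<in> N \<or> x + g \<in> N"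
    by (rule index_3_subgroup) blast
  interpret N: finite_index_subgroup N
    by (rule N(1))
  \<comment> \<open>In the quotient of order 3 a symmetric \<open>P\<close> has equal coefficients
    at \<open>g\<close> and \<open>- g\<close>, so it is the integer \<open>val P\<close> plus a
    multiple of the sum of all elements.\<close>
  define val where "val P = N.coef P 0 - N.coef P g" for P
  have val: "N.const_mod 0 (P - of_int (val P))" if "reflect P = P" for P
  proof (rule N.const_modI)
    fix x
    have "N.coef P (- g) = N.coef P g"
      using N.coef_reflect[of P g] that by simp
    moreover have "N.coef P x = N.coef P 0" if "x \<in> N"
      using that by (intro N.coef_cong) simp
    moreover have "N.coef P x = N.coef P g" if "x - g \<in> N"
      using that by (intro N.coef_cong) simp
    moreover have "N.coef P x = N.coef P (- g)" if "x + g \<in> N"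
      using that by (intro N.coef_cong) simp
    moreover have "x \<notin> N" if "x - g \<in> N \<or> x + g \<in> N"
      using that g N.diff_mem[of x "x - g"] N.diff_mem[of "x + g" x] by auto
    ultimately show "N.coef (P - of_int (val P)) x = N.coef P g"
      using cover[of x] by (auto simp: N.coef_diff N.coef_of_int val_def)
  qed
  \<comment> \<open>Doubling is negation in a group of order 3.\<close>
  have val_dilate: "val (dilate 2 P) = val P" if "reflect P = P" for P
  proof -
    have "N.coef (dilate 2 P) x = N.coef P (2 * x)" for x
    proof (induction P rule: frag_induct)
      case (one y)
      have "2 * x - y = 2 * (x - 2 * y) + 3 * y" "x - 2 * y = 2 * (2 * x - y) - 3 * x"
        by (simp_all add: algebra_simps)
      then have "x - 2 * y \<in> N \<longleftrightarrow> 2 * x - y \<in> N"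
        using three N.of_nat_mult_mem[of _ 2] N.add_mem N.diff_mem by (metis of_nat_numeral)
      then show ?case
        by (simp add: N.coef_frag_of)
    qed (simp_all add: dilate_diff N.coef_diff)
    moreover have "N.coef P (2 * g) = N.coef P (- g)"
      using three[of g] by (intro N.coef_cong) (simp add: algebra_simps)
    ultimately show ?thesis
      using N.coef_reflect[of P g] that by (simp add: val_def)
  qed
  have const_int: "k = 0" if const: "N.const_mod 0 (of_int k)" for k
  proof -
    obtain l where l: "\<And>x. [N.coef (of_int k) x = l] (mod 0)"
      using const unfolding N.const_mod_def by blast
    have "k = l" "0 = l"
      using l[of 0] l[of g] g N.zero_mem by (simp_all add: N.coef_of_int cong_def)
    then show ?thesis
      by simp
  qed
  define \<alpha> where "\<alpha> = val u"
  define \<beta> where "\<beta> = val v"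
  have u: "N.const_mod 0 (u - of_int \<alpha>)" and v: "N.const_mod 0 (v - of_int \<beta>)"
    using val reflect_u reflect_v by (simp_all add: \<alpha>_def \<beta>_def)
  have "val B = \<alpha> + \<beta>"
    by (simp add: val_def \<alpha>_def \<beta>_def N.coef_add)
  then have B: "N.const_mod 0 (B2 - of_int (\<alpha> + \<beta>))"
    using val[OF reflect_dilate_B[of 2]] val_dilate[OF reflect_B] by simp
  have "N.const_mod 0 ((u * v + 1) - (u * v - of_int \<alpha> * of_int \<beta>))"
    using const_superset[OF N const_prod] u v by (intro N.const_mod_diff[OF _ N.const_mod_cong_mult])
  then have "N.const_mod 0 (of_int (\<alpha> * \<beta> + 1))"
    by (simp add: add.commute)
  then have prod: "\<alpha> * \<beta> = - 1"
    using const_int by fastforce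
  have "N.const_mod 0 ((u ^ 2 + v ^ 2 + B2 - s) - (u * u - of_int \<alpha> * of_int \<alpha>)
     - (v * v - of_int \<beta> * of_int \<beta>) - (B2 - of_int (\<alpha> + \<beta>)))"
    using const_superset[OF N const_squares] u v B
    by (intro N.const_mod_diff[OF N.const_mod_diff[OF N.const_mod_diff[OF _ N.const_mod_cong_mult] N.const_mod_cong_mult]])
  then have "N.const_mod 0 (of_int (\<alpha> * \<alpha> + \<beta> * \<beta> + \<alpha> + \<beta> - 2 * int n))"
    by (simp add: power2_eq_square algebra_simps)
  then have "\<alpha> * \<alpha> + \<beta> * \<beta> + \<alpha> + \<beta> = 2 * int n"
    using const_int by fastforce
  \<comment> \<open>For these values the left side of the preceding equation is 2.\<close>
  moreover have "(\<alpha> = 1 \<and> \<beta> = - 1) \<or> (\<alpha> = - 1 \<and> \<beta> = 1)"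
  proof -
    have "\<alpha> dvd 1"
      using prod by (metis dvd_minus_iff dvd_triv_left)
    then have "\<alpha> = 1 \<or> \<alpha> = - 1"
      by (auto simp: zdvd1_eq abs_if split: if_splits)
    then show ?thesis
      using prod by auto
  qed
  ultimately show ?thesis
    by auto
qed

text \<open>As \<open>U\<close> is \<open>{0, x, - x}\<close>, the product relation makes three
  consecutive coefficients of \<open>v\<close> along the multiples of \<open>x\<close> sum to 1,
  away from the zero coset. So \<open>v\<close> contains \<open>2 x\<close> and \<open>5 x\<close>,
  and \<open>3 x = 5 x - 2 x = - 2 x + 5 x = - 5 x - 5 x\<close> modulo \<open>K\<close> has three
  representations in \<open>v ^ 2\<close>; the square relation allows two.\<close>

lemma not_3: "n \<noteq> 3"
proof
  assume n: "n = 3"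
  have i: "index = 13"
    by (simp add: index_eq n)
  have "0 \<in> U"
    using zero_in_odd n by simp
  have "\<not> U \<subseteq> {0}"
    using card_mono[of "{0}" U] card_U n by auto
  then obtain x where x: "x \<in> U" "x \<noteq> 0"
    by blast
  have xK: "x \<notin> K"
    using distinct[of x 0] x \<open>0 \<in> U\<close> by auto
  have nK: "of_nat k * x \<notin> K" if "coprime k 13" for k
    using coprime_index_mem[of k x] that xK i by auto
  have "x \<noteq> - x"
  proof
    assume "x = - x"
    then have "x + x = 0"
      by (simp only: eq_neg_iff_add_eq_0)
    then have "of_nat 2 * x \<in> K"
      using zero_mem by (simp only: of_nat_numeral mult_2)
    moreover have "coprime 2 (13 :: nat)"
      by simp
    ultimately show False
      using nK by blast
  qed
  then have "card {0, x, - x} = 3"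
    using x by auto
  then have U: "U = {0, x, - x}"
    using card_subset_eq[OF finite_U, of "{0, x, - x}"] x minus_U \<open>0 \<in> U\<close> card_U n by auto
  have uv: "coef (u * v) y = coef v y + coef v (y - x) + coef v (y + x)" for y
  proof -
    have "u = frag_of 0 + frag_of x + frag_of (- x)"
      using x \<open>x \<noteq> - x\<close> by (simp add: U set_sum_def)
    then have "u * v = frag_of 0 * v + frag_of x * v + frag_of (- x) * v"
      by (simp only: distrib_right)
    then show ?thesis
      by (simp only: coef_add coef_frag_mult) simp
  qed
  define c where "c k = coef v (of_nat k * x)" for k
  have c0: "c 0 = 0"
    using coef_zero_U[OF \<open>0 \<in> U\<close>, of 1] by (simp add: c_def)
  have c1: "c 1 = 0"
  proof -
    have "coef u x \<ge> 1"
      using x zero_mem finite_U by (auto simp: coef_set_sum Suc_le_eq card_gt_0_iff)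
    then show ?thesis
      using coef_B_le[of x] coef_v_nonneg[of x] by (simp add: c_def coef_add)
  qed
  have rec: "c (k + 1) + c k + c (k + 2) = 1" if "coprime (k + 1) 13" for k
    using uv[of "of_nat (k + 1) * x"] prod_UV[of "of_nat (k + 1) * x"] nK[OF that]
    by (simp add: c_def algebra_simps)
  have cop: "coprime 2 (13 :: nat)" "coprime 3 (13 :: nat)" "coprime 4 (13 :: nat)"
    by (simp_all add: coprime_iff_gcd_eq_1 gcd_non_0_nat)
  have "c 1 + c 0 + c 2 = 1" "c 2 + c 1 + c 3 = 1" "c 3 + c 2 + c 4 = 1" "c 4 + c 3 + c 5 = 1"
    using rec[of 0] rec[of 1] rec[of 2] rec[of 3] cop by (simp_all add: numeral_2_eq_2[symmetric])
  then have "c 2 = 1" "c 5 = 1"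
    using c0 c1 by linarith+
  then have c25: "coef v (2 * x) = 1" "coef v (5 * x) = 1"
    by (simp_all add: c_def)
  have refl: "coef v (- y) = coef v y" for y
    using coef_reflect[of v y] reflect_v by simp
  have K: "rep (of_nat i * x) \<noteq> rep (- (of_nat j * x))" if "coprime (i + j) 13" for i j
    using nK[OF that] by (simp add: rep_eq_iff distrib_right)
  have ne: "rep (5 * x) \<noteq> rep (- (2 * x))" "rep (5 * x) \<noteq> rep (- (5 * x))" "rep (- (2 * x)) \<noteq> rep (- (5 * x))"
  proof -
    have cop: "coprime 7 (13 :: nat)" "coprime 10 (13 :: nat)" "coprime 3 (13 :: nat)"
      by (simp_all add: coprime_iff_gcd_eq_1 gcd_non_0_nat)
    show "rep (5 * x) \<noteq> rep (- (2 * x))" "rep (5 * x) \<noteq> rep (- (5 * x))"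
      using K[of 5 2] K[of 5 5] cop by simp_all
    have "3 * x \<notin> K"
      using nK[OF cop(3)] by simp
    then show "rep (- (2 * x)) \<noteq> rep (- (5 * x))"
      by (simp add: rep_eq_iff algebra_simps)
  qed
  define f where "f r = coef v r * coef v (3 * x - r)" for r
  have f_rep: "f (rep y) = f y" for y
  proof -
    have "coef v (rep y) = coef v y" "coef v (3 * x - rep y) = coef v (3 * x - y)"
      using rep_diff[of y] diff_swap by (auto intro!: coef_cong)
    then show ?thesis
      by (simp add: f_def)
  qed
  have "coef v (8 * x) = coef v (- (5 * x))"
    using index_mult_mem[of x] i by (intro coef_cong) (simp add: algebra_simps)
  then have f1: "f (5 * x) = 1" "f (- (2 * x)) = 1" "f (- (5 * x)) = 1"
    using c25 refl[of "2 * x"] refl[of "5 * x"] by (simp_all add: f_def algebra_simps)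
  have "3 = (\<Sum>r\<in>{rep (5 * x), rep (- (2 * x)), rep (- (5 * x))}. f r)"
    using ne by (simp add: f_rep f1)
  also have "\<dots> \<le> (\<Sum>r\<in>reps. f r)"
    by (intro sum_mono2) (auto simp: f_def coef_v_nonneg)
  also have "\<dots> = coef (v ^ 2) (3 * x)"
    by (simp add: f_def coef_mult power2_eq_square)
  finally have "coef (v ^ 2) (3 * x) \<ge> 3" .
  moreover have "coef (u ^ 2) (3 * x) \<ge> 0"
    unfolding power2_eq_square by (intro coef_mult_nonneg coef_u_nonneg)
  moreover have "coef (u ^ 2) (3 * x) + coef (v ^ 2) (3 * x) + coef B2 (3 * x) = 2"
    using squares_UV[of "3 * x"] nK[of 3] cop by (simp add: coef_add)
  ultimately show False
    using coef_dilate_B_nonneg[of 2 "3 * x"] by linarith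
qed

lemma n_exceptional: "n \<in> {0, 1, 2, 11}"
proof -
  define N where "N = int n"
  have N: "N \<ge> 0" "N \<noteq> 3" "N \<noteq> 5" "N \<noteq> 8" "N \<noteq> 23"
    using not_3 not_5 not_8 not_23 by (auto simp: N_def)
  have r5: "N mod 5 = 0 \<or> N mod 5 = 1 \<or> N mod 5 = 2 \<or> N mod 5 = 3 \<or> N mod 5 = 4"
    by presburger
  consider "N mod 3 = 0" | "N mod 3 = 1" | "N mod 3 = 2"
    by linarith
  then show ?thesis
  proof cases
    case 1
    from r5 have "N = 0"
    proof (elim disjE)
      assume r: "N mod 5 = 0"
      show ?thesis
      proof (rule ccontr)
        assume "N \<noteq> 0"
        then have "N \<ge> 15" using N(1) 1 r by presburger
        then show False using not_0_0 1 r by (simp add: N_def)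
      qed
    next
      assume r: "N mod 5 = 1"
      then have "N \<ge> 6" using N(1) 1 by presburger
      then show ?thesis using not_0_1 1 r by (simp add: N_def)
    next
      assume r: "N mod 5 = 2"
      then have "N \<ge> 12" using N(1) 1 by presburger
      then show ?thesis using not_0_2 1 r by (simp add: N_def)
    next
      assume r: "N mod 5 = 3"
      then have "N \<ge> 18" using N(1,2) 1 by presburger
      then show ?thesis using not_0_3 1 r by (simp add: N_def)
    next
      assume r: "N mod 5 = 4"
      then have "N \<ge> 9" using N(1) 1 by presburger
      then show ?thesis using not_0_4 1 r by (simp add: N_def)
    qed
    then show ?thesis by (simp add: N_def)
  next
    case 2
    then have "n mod 3 = 1" unfolding N_def by presburger
    then show ?thesis using mod_3_eq_1 by simp
  next
    case 3
    from r5 have "N = 2 \<or> N = 11"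
    proof (elim disjE)
      assume r: "N mod 5 = 0"
      then have "N \<ge> 20" using N(1,3) 3 by presburger
      then show ?thesis using not_2_0 3 r by (simp add: N_def)
    next
      assume r: "N mod 5 = 1"
      show ?thesis
      proof (rule ccontr)
        assume "\<not> ?thesis"
        then have "N \<ge> 26" using N(1) 3 r by presburger
        then show False using not_2_1 3 r by (simp add: N_def)
      qed
    next
      assume r: "N mod 5 = 2"
      show ?thesis
      proof (rule ccontr)
        assume "\<not> ?thesis"
        then have "N \<ge> 17" using N(1) 3 r by presburger
        then show False using not_2_2 3 r by (simp add: N_def)
      qed
    next
      assume r: "N mod 5 = 3"
      then have "N \<ge> 38" using N(1,4,5) 3 by presburger
      then show ?thesis using not_2_3 3 r by (simp add: N_def)
    next
      assume r: "N mod 5 = 4"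
      then have "N \<ge> 14" using N(1) 3 by presburger
      then show ?thesis using not_2_4 3 r by (simp add: N_def)
    qed
    then show ?thesis by (auto simp: N_def)
  qed
qed

end

section \<open>From an almost perfect tiling to a pair\<close>

context finite_index_subgroup
begin

lemma coef_set_sum_mult:
  assumes "finite A" "finite B"
  shows "coef (set_sum A * set_sum B) x = int (card {(a, b) \<in> A \<times> B. x - (a + b) \<in> K})"
proof -
  have "set_sum A * set_sum B = (\<Sum>(a, b)\<in>A \<times> B. frag_of (a + b))"
    by (simp add: set_sum_def sum_product sum.cartesian_product mult_single)
  then have "coef (set_sum A * set_sum B) x = (\<Sum>p\<in>A \<times> B. of_bool (case p of (a, b) \<Rightarrow> x - (a + b) \<in> K))"
    by (simp add: coef_sum coef_frag_of case_prod_unfold)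
  also have "\<dots> = int (card {p \<in> A \<times> B. case p of (a, b) \<Rightarrow> x - (a + b) \<in> K})"
    using assms by (simp add: of_bool_def sum.If_cases Int_def)
  finally show ?thesis
    by (simp add: case_prod_unfold mem_Times_iff conj_assoc)
qed

lemma coef_dilate_set_sum:
  "finite A \<Longrightarrow> coef (dilate k (set_sum A)) x = int (card {a \<in> A. x - of_nat k * a \<in> K})"
  by (simp add: set_sum_def dilate_sum coef_sum coef_frag_of of_bool_def sum.If_cases Int_def)

end

text \<open>
  \<open>T\<close> plays the role of the Lee sphere of radius \<open>1\<close>, so that the sphere of radius \<open>2\<close> is the
  set of all sums of two elements of \<open>T\<close>.
\<close>

locale almost_tiling = finite_index_subgroup K for K :: "'a::comm_ring_1 set" +
  fixes n :: nat and T :: "'a set"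
  assumes finite_T: "finite T" and card_T: "card T = 2 * n + 1"
    and zero_T: "0 \<in> T" and minus_T: "x \<in> T \<Longrightarrow> - x \<in> T"
    and no_involution: "x \<in> T \<Longrightarrow> x + x = 0 \<Longrightarrow> x = 0"
    and sums_distinct: "x \<in> T \<Longrightarrow> y \<in> T \<Longrightarrow> x' \<in> T \<Longrightarrow> y' \<in> T \<Longrightarrow> (x + y) - (x' + y') \<in> K \<Longrightarrow>
      (x = x' \<and> y = y') \<or> (x = y' \<and> y = x') \<or> (x + y = 0 \<and> x' + y' = 0)"
    and index_sums: "index = Suc (card {x + y | x y. x \<in> T \<and> y \<in> T})"
begin

text \<open>In terms of the packing, \<open>x\<close> lies in a translate of the sphere of radius 2
  by an element of \<open>K\<close>.\<close>

definition covered :: "'a \<Rightarrow> bool" where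
  "covered x \<longleftrightarrow> (\<exists>s\<in>T. \<exists>t\<in>T. x - (s + t) \<in> K)"

lemma covered_cong: "x - y \<in> K \<Longrightarrow> covered x \<longleftrightarrow> covered y"
  unfolding covered_def using diff_trans diff_swap by meson

lemma covered_minus: "covered x \<Longrightarrow> covered (- x)"
proof -
  assume "covered x"
  then obtain s t where "s \<in> T" "t \<in> T" "x - (s + t) \<in> K"
    by (auto simp: covered_def)
  moreover from this have "- x - (- s + - t) \<in> K"
    using minus_mem[of "x - (s + t)"] by (simp add: algebra_simps)
  ultimately show ?thesis
    unfolding covered_def using minus_T by blast
qed

text \<open>A nonzero covered coset has one unordered representation \<open>s + t\<close>: two
  ordered ones, or one with \<open>s = t\<close> to which the dilation adds another. The zero coset
  has \<open>2 n + 1\<close> representations \<open>s - s\<close> and one more from the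
  dilation.\<close>

lemma coef_T_square:
  "coef (set_sum T ^ 2 + dilate 2 (set_sum T)) x = 2 * of_bool (covered x) + 2 * int n * of_bool (x \<in> K)"
proof -
  define P where "P = {(s, t) \<in> T \<times> T. x - (s + t) \<in> K}"
  define Q where "Q = {s \<in> T. x - of_nat 2 * s \<in> K}"
  have Q: "s \<in> Q \<longleftrightarrow> (s, s) \<in> P" for s
    unfolding P_def Q_def of_nat_numeral mult_2 by blast
  have coef: "coef (set_sum T ^ 2 + dilate 2 (set_sum T)) x = int (card P) + int (card Q)"
    unfolding power2_eq_square coef_add P_def Q_def
    by (simp only: coef_set_sum_mult coef_dilate_set_sum finite_T)
  consider "x \<in> K" | "x \<notin> K" "covered x" | "x \<notin> K" "\<not> covered x"
    by blast
  then show ?thesis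
  proof cases
    case 1
    have "x - (s + t) \<in> K \<longleftrightarrow> s + t = 0" if "s \<in> T" "t \<in> T" for s t
    proof
      assume "x - (s + t) \<in> K"
      then have "(s + t) - (0 + 0) \<in> K"
        using 1 diff_mem[of x "x - (s + t)"] by simp
      then show "s + t = 0"
        using sums_distinct[OF that zero_T zero_T] by auto
    qed (use 1 in simp)
    then have P: "P = (\<lambda>s. (s, - s)) ` T"
      using minus_T 1 by (auto simp: P_def image_iff eq_neg_iff_add_eq_0 add.commute)
    have "card P = 2 * n + 1"
      unfolding P by (simp add: card_image inj_on_def card_T)
    moreover have "Q = {0}"
      using Q no_involution zero_T P by (auto simp: image_iff eq_neg_iff_add_eq_0)
    moreover have "covered x"
      unfolding covered_def using 1 zero_T by (intro bexI[of _ 0]) simp_all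
    ultimately show ?thesis
      using 1 coef by simp
  next
    case 2
    then obtain s t where st: "s \<in> T" "t \<in> T" "x - (s + t) \<in> K"
      by (auto simp: covered_def)
    have "s + t \<noteq> 0"
      using st 2 by auto
    have "P = {(s, t), (t, s)}"
    proof (intro equalityI subsetI)
      fix p assume "p \<in> P"
      then obtain s' t' where p: "p = (s', t')" "s' \<in> T" "t' \<in> T" "x - (s' + t') \<in> K"
        by (auto simp: P_def)
      have "(s + t) - (s' + t') \<in> K"
        using diff_mem[OF p(4) st(3)] by (simp add: algebra_simps)
      then show "p \<in> {(s, t), (t, s)}"
        using sums_distinct[OF st(1,2) p(2,3)] \<open>s + t \<noteq> 0\<close> p(1) by auto
    qed (use st in \<open>auto simp: P_def add.commute\<close>)
    moreover from this have "r \<in> Q \<longleftrightarrow> r = s \<and> r = t" for r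
      unfolding Q by blast
    then have "Q = (if s = t then {s} else {})"
      by (intro Set.set_eqI) simp
    ultimately show ?thesis
      using 2 coef by auto
  next
    case 3
    then have "P = {}"
      by (auto simp: P_def covered_def)
    moreover from this have "Q = {}"
      using Q by auto
    ultimately show ?thesis
      using 3 coef by simp
  qed
qed

text \<open>Distinct sums lie in distinct cosets, so \<open>index - 1\<close> cosets are
  covered.\<close>

lemma exists_uncovered:
  obtains f where "\<And>x. covered x \<longleftrightarrow> x - f \<notin> K"
proof -
  have "bij_betw rep {x + y | x y. x \<in> T \<and> y \<in> T} {r \<in> reps. covered r}"
  proof (rule bij_betw_imageI)
    show "inj_on rep {x + y | x y. x \<in> T \<and> y \<in> T}"
      unfolding inj_on_def rep_eq_iff using sums_distinct by (fastforce simp: add.commute)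
    show "rep ` {x + y | x y. x \<in> T \<and> y \<in> T} = {r \<in> reps. covered r}"
    proof (intro equalityI subsetI)
      fix r assume "r \<in> rep ` {x + y | x y. x \<in> T \<and> y \<in> T}"
      then show "r \<in> {r \<in> reps. covered r}"
        using rep_diff by (auto simp: covered_def)
    next
      fix r assume "r \<in> {r \<in> reps. covered r}"
      then obtain s t where "rep r = r" "s \<in> T" "t \<in> T" "r - (s + t) \<in> K"
        by (auto simp: covered_def rep_of_reps)
      then have "r = rep (s + t)"
        by (metis rep_eq_iff)
      then show "r \<in> rep ` {x + y | x y. x \<in> T \<and> y \<in> T}"
        using \<open>s \<in> T\<close> \<open>t \<in> T\<close> by blast
    qed
  qed
  then have "card {r \<in> reps. covered r} + 1 = card reps"
    using index_sums bij_betw_same_card unfolding index_def by fastforce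
  moreover have "card reps = card {r \<in> reps. covered r} + card {r \<in> reps. \<not> covered r}"
    by (subst card_Un_disjoint[symmetric]) (auto intro: arg_cong[where f = card])
  ultimately have "card {r \<in> reps. \<not> covered r} = 1"
    by simp
  then obtain f where f: "{r \<in> reps. \<not> covered r} = {f}"
    by (auto simp: card_1_singleton_iff)
  have "covered x \<longleftrightarrow> x - f \<notin> K" for x
  proof -
    have "covered x \<longleftrightarrow> covered (rep x)"
      using covered_cong rep_diff by blast
    also have "\<dots> \<longleftrightarrow> rep x \<noteq> f"
      using f rep_in_reps[of x] by blast
    also have "\<dots> \<longleftrightarrow> rep x \<noteq> rep f"
      using f rep_of_reps[of f] by (metis (mono_tags, lifting) insertI1 mem_Collect_eq)
    finally show ?thesis
      by (simp add: rep_eq_iff)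
  qed
  then show ?thesis
    by (rule that)
qed

text \<open>Augmentations in \<open>coef_T_square\<close> give
  \<open>(2 n + 1) ^ 2 + (2 n + 1) = 2 (index - 1) + 2 n\<close>, which replaces a direct count of
  the sums.\<close>

lemma index_eq': "index = 2 * (n ^ 2 + n + 1)"
proof -
  obtain f where f: "\<And>x. covered x \<longleftrightarrow> x - f \<notin> K"
    by (rule exists_uncovered) blast
  have "aug (set_sum T ^ 2 + dilate 2 (set_sum T))
      = (\<Sum>r\<in>reps. 2 - 2 * (if r - f \<in> K then 1 else 0) + 2 * int n * (if r - 0 \<in> K then 1 else 0))"
    unfolding aug_def coef_T_square f by (intro sum.cong) auto
  also have "\<dots> = 2 * int index - 2 + 2 * int n"
    using sum_reps_delta[of "\<lambda>_. 1" f] sum_reps_delta[of "\<lambda>_. 1" 0]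
    by (simp add: sum.distrib sum_subtractf sum_distrib_left[symmetric] index_def)
  also have "aug (set_sum T ^ 2 + dilate 2 (set_sum T)) = (2 * int n + 1) ^ 2 + (2 * int n + 1)"
    by (simp add: aug_add aug_power aug_set_sum card_T)
  finally have "int index = int (2 * (n ^ 2 + n + 1))"
    by (simp add: power2_eq_square algebra_simps)
  then show ?thesis
    by linarith
qed

text \<open>
  The uncovered coset \<open>f\<close> is the only element of order \<open>2\<close>; the quotient by it has odd order
  \<open>M\<close>, and \<open>{x. M x \<in> K}\<close> is the complementary subgroup of index \<open>2\<close>.
\<close>

lemma exists_lee_pair:
  obtains L U V :: "'a set" where "lee_pair L n U V"
proof -
  obtain f where cov: "\<And>x. covered x \<longleftrightarrow> x - f \<notin> K"
    by (rule exists_uncovered) blast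
  have "\<not> covered f"
    by (simp add: cov zero_mem)
  \<comment> \<open>The covered cosets are symmetric, so the only uncovered one is its own
    negative.\<close>
  then have "\<not> covered (- f)"
    using covered_minus[of "- f"] by auto
  then have "- f - f \<in> K"
    by (simp add: cov)
  then have ff: "f + f \<in> K"
    using minus_mem[of "- f - f"] by simp
  have fK: "f \<notin> K"
  proof
    assume "f \<in> K"
    then have "f - (0 + 0) \<in> K" by simp
    then show False
      using \<open>\<not> covered f\<close> zero_T covered_def by blast
  qed
  have swap: "x + f \<in> K \<longleftrightarrow> x - f \<in> K" for x
    using add_mem_cancel[OF ff, of "x - f"] by (simp add: algebra_simps)
  define L where "L = {x. x \<in> K \<or> x - f \<in> K}"
  have "x - y \<in> L" if "x \<in> L" "y \<in> L" for x y
    using that diff_mem[of x y] diff_mem[of "x - f" y] diff_mem[of x "y - f"] diff_mem[of "x - f" "y - f"]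
      swap[of "x - y"]
    by (auto simp: L_def algebra_simps)
  then have L: "finite_index_subgroup L" and KL: "K \<subseteq> L"
    by (intro finite_index_superset) (auto simp: L_def)
  interpret L: finite_index_subgroup L
    by (rule L)
  have reps_L: "{r \<in> reps. r - x \<in> L} = {rep x, rep (x + f)}" for x
  proof (intro equalityI subsetI)
    fix r assume "r \<in> {r \<in> reps. r - x \<in> L}"
    then have r: "rep r = r" and "r - x \<in> K \<or> r - (x + f) \<in> K"
      by (auto simp: L_def rep_of_reps algebra_simps)
    then show "r \<in> {rep x, rep (x + f)}"
      by (auto simp: rep_eq_iff[symmetric])
  next
    fix r assume "r \<in> {rep x, rep (x + f)}"
    then show "r \<in> {r \<in> reps. r - x \<in> L}"
      using rep_diff[of x] rep_diff[of "x + f"] by (auto simp: L_def algebra_simps)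
  qed
  have rep_f: "rep x \<noteq> rep (x + f)" for x
    using fK by (simp add: rep_eq_iff minus_mem_iff)
  then have "card {r \<in> reps. r - x \<in> L} = 2" for x
    by (simp add: reps_L)
  from index_superset[OF L KL this] have index_L: "L.index = n ^ 2 + n + 1"
    by (simp add: index_eq')
  have coef_L: "L.coef P x = coef P x + coef P (x + f)" for P x
  proof -
    have "L.coef P x = (\<Sum>r\<in>{r \<in> reps. r - x \<in> L}. coef P r)"
      by (simp add: coef_superset[OF L KL] sum.If_cases Int_def)
    also have "\<dots> = coef P (rep x) + coef P (rep (x + f))"
      by (simp add: reps_L rep_f)
    also have "\<dots> = coef P x + coef P (x + f)"
      using coef_cong[OF rep_diff] by simp
    finally show ?thesis .
  qed
  define M where "M = n ^ 2 + n + 1"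
  define E where "E = {x. of_nat M * x \<in> K}"
  have E_add: "x + y \<in> E" if "x \<in> E" "y \<in> E" for x y
    using that add_mem by (simp add: E_def distrib_left)
  have E_minus: "- x \<in> E \<longleftrightarrow> x \<in> E" for x
    by (simp add: E_def minus_mem_iff)
  have E_diff: "x - y \<in> E" if "x \<in> E" "y \<in> E" for x y
    using E_add[of x "- y"] that E_minus by simp
  have KE: "x \<in> E" if "x \<in> K" for x
    using that of_nat_mult_mem by (simp add: E_def)
  have "odd M"
    by (simp add: M_def power2_eq_square)
  \<comment> \<open>As \<open>M\<close> is odd, multiplication by \<open>M\<close> fixes
    \<open>f\<close> modulo \<open>K\<close>, which keeps \<open>f\<close> out of
    \<open>E\<close>.\<close>
  then obtain i where "M = 2 * i + 1"
    by (rule oddE)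
  then have "of_nat M * f - f = of_nat i * (f + f)"
    by (simp add: algebra_simps)
  then have Mf: "of_nat M * f - f \<in> K"
    using of_nat_mult_mem[OF ff] by simp
  have fE: "f \<notin> E"
    using diff_mem[OF _ Mf, of "of_nat M * f"] fK by (auto simp: E_def)
  have E_f: "x + f \<in> E \<longleftrightarrow> x \<notin> E" for x
  proof
    assume "x + f \<in> E"
    then show "x \<notin> E"
      using E_diff[of "x + f" x] fE by auto
  next
    assume "x \<notin> E"
    moreover have "of_nat M * x \<in> L"
      using L.index_mult_mem[of x] unfolding index_L M_def .
    ultimately have "of_nat M * x + f \<in> K"
      unfolding swap E_def L_def by blast
    from add_mem[OF this Mf] show "x + f \<in> E"
      by (simp add: E_def algebra_simps)
  qed
  \<comment> \<open>Membership in \<open>E\<close> is a parity: in the square of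
    \<open>T = U + V\<close> the even part is \<open>U ^ 2 + V ^ 2\<close>, the odd part
    \<open>2 U V\<close>.\<close>
  have E_sum: "x + y \<in> E \<longleftrightarrow> (x \<in> E \<longleftrightarrow> y \<in> E)" for x y
  proof -
    have "x + y \<in> E" if "x \<notin> E" "y \<notin> E"
    proof -
      have "x + f \<in> E" "y + f \<in> E"
        using that by (simp_all only: E_f not_False_eq_True)
      from E_diff[OF E_add[OF this] KE[OF ff]] have "(x + f) + (y + f) - (f + f) \<in> E" .
      moreover have "(x + f) + (y + f) = (x + y) + (f + f)"
        by (simp only: ac_simps)
      ultimately show ?thesis
        by (simp only: add_diff_cancel_right')
    qed
    moreover have "x + y \<notin> E" if "x \<in> E \<longleftrightarrow> y \<notin> E"
      using that E_diff[of "x + y" x] E_diff[of "x + y" y] by auto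
    ultimately show ?thesis
      using E_add by blast
  qed
  have E_cong: "x \<in> E \<longleftrightarrow> y \<in> E" if "x - y \<in> K" for x y
    using that E_add[of "x - y" y] E_diff[of x "x - y"] KE[of "x - y"] by auto
  define U where "U = T \<inter> E"
  define V where "V = T - E"
  have fin: "finite U" "finite V"
    using finite_T by (simp_all add: U_def V_def)
  have T_UV: "set_sum T = set_sum U + set_sum V"
  proof -
    have "T = U \<union> V" "U \<inter> V = {}"
      by (auto simp: U_def V_def)
    then show ?thesis
      using fin by (simp add: set_sum_def sum.union_disjoint)
  qed
  have mult_0: "coef (set_sum A * set_sum A') x = 0"
    if "finite A" "finite A'" "\<And>s t. s \<in> A \<Longrightarrow> t \<in> A' \<Longrightarrow> s + t \<in> E \<longleftrightarrow> x \<notin> E" for A A' x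
  proof -
    have "{(a, b) \<in> A \<times> A'. x - (a + b) \<in> K} = {}"
      using that(3) E_cong[of x] by auto
    then show ?thesis
      by (simp only: coef_set_sum_mult[OF that(1,2)] card.empty of_nat_0)
  qed
  have UV_0: "coef (set_sum U * set_sum V) x = 0" if "x \<in> E" for x
    using that by (intro mult_0 fin) (auto simp: U_def V_def E_sum)
  have squares_0: "coef (set_sum U ^ 2 + set_sum V ^ 2 + dilate 2 (set_sum T)) x = 0" if "x \<notin> E" for x
  proof -
    have "coef (set_sum U * set_sum U) x = 0" "coef (set_sum V * set_sum V) x = 0"
      using that by (intro mult_0 fin; auto simp: U_def V_def E_sum)+
    moreover have "{s \<in> T. x - of_nat 2 * s \<in> K} = {}"
      using that E_cong[of x] E_sum unfolding of_nat_numeral mult_2 by blast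
    then have "coef (dilate 2 (set_sum T)) x = 0"
      using finite_T by (simp only: coef_dilate_set_sum) simp
    ultimately show ?thesis
      by (simp add: coef_add power2_eq_square)
  qed
  have T_square: "coef (set_sum U ^ 2 + set_sum V ^ 2 + dilate 2 (set_sum T)) x + 2 * coef (set_sum U * set_sum V) x
    = 2 * of_bool (x - f \<notin> K) + 2 * int n * of_bool (x \<in> K)" for x
  proof -
    have "set_sum T ^ 2 + dilate 2 (set_sum T)
      = set_sum U ^ 2 + set_sum V ^ 2 + dilate 2 (set_sum T) + 2 * (set_sum U * set_sum V)"
      unfolding T_UV by (simp add: power2_eq_square algebra_simps)
    then show ?thesis
      using coef_T_square[of x] by (simp add: coef_add coef_numeral_mult cov)
  qed
  have mem_K: "x \<in> L \<longleftrightarrow> x \<in> K" if "x \<in> E" for x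
    using that KE[of "x - f"] E_f[of "x - f"] by (auto simp: L_def)
  have mem_K': "x \<in> L \<longleftrightarrow> x - f \<in> K" if "x \<notin> E" for x
    using that KE[of x] by (auto simp: L_def)
  \<comment> \<open>The coefficient modulo \<open>L\<close> adds those at \<open>x\<close> and
    \<open>x + f\<close>. Exactly one of these lies in \<open>E\<close> and sees only the even part
    of the relation for \<open>T\<close>; the other sees only the odd part.\<close>
  have prod: "L.coef (set_sum U * set_sum V) x = 1 - of_bool (x \<in> L)" for x
  proof (cases "x \<in> E")
    case True
    then have "x + f \<notin> E" by (simp add: E_f)
    then have "2 * coef (set_sum U * set_sum V) (x + f) = 2 * of_bool (x \<notin> K)"
      using T_square[of "x + f"] squares_0[of "x + f"] KE[of "x + f"] by auto
    then show ?thesis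
      using True UV_0[of x] mem_K by (simp add: coef_L)
  next
    case False
    then have "2 * coef (set_sum U * set_sum V) x = 2 * of_bool (x - f \<notin> K)"
      using T_square[of x] squares_0[of x] KE[of x] by auto
    then show ?thesis
      using False UV_0[of "x + f"] mem_K' by (simp add: coef_L E_f)
  qed
  have squares: "L.coef (set_sum U ^ 2 + set_sum V ^ 2 + dilate 2 (set_sum U + set_sum V)) x
      = 2 + 2 * int n * of_bool (x \<in> L)" for x
  proof (cases "x \<in> E")
    case True
    then have "x - f \<notin> K"
      using KE[of "x - f"] E_f[of "x - f"] by auto
    then show ?thesis
      using True T_square[of x] UV_0[of x] squares_0[of "x + f"] mem_K
      by (simp add: coef_L E_f T_UV[symmetric])
  next
    case False
    then have "x \<notin> K"
      using KE[of x] by auto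
    then show ?thesis
      using False T_square[of "x + f"] UV_0[of "x + f"] squares_0[of x] mem_K' swap
      by (simp add: coef_L E_f T_UV[symmetric])
  qed
  \<comment> \<open>If \<open>x - y\<close> lay in the coset of \<open>f\<close>, the sum of
    \<open>x\<close> and \<open>- y\<close> would cover that coset.\<close>
  have distinct: "x = y" if xy: "x \<in> T" "y \<in> T" "x - y \<in> L" for x y
  proof -
    have "(x + - y) - (x + - y) \<in> K"
      by (simp add: zero_mem)
    then have "covered (x + - y)"
      using xy(1) minus_T[OF xy(2)] unfolding covered_def by blast
    then have "x - y - f \<notin> K"
      by (simp add: cov)
    then have "(x + 0) - (y + 0) \<in> K"
      using xy by (simp add: L_def)
    then show ?thesis
      using sums_distinct[OF xy(1) zero_T xy(2) zero_T] by auto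
  qed
  have card_sum: "card U + card V = 2 * n + 1"
    using card_Int_Diff[OF finite_T, of E] card_T by (simp add: U_def V_def)
  have "int (card U) * int (card V) = (\<Sum>r\<in>L.reps. 1 - of_bool (r \<in> L))"
    unfolding prod[symmetric] L.aug_def[symmetric] by (simp add: L.aug_mult L.aug_set_sum)
  also have "\<dots> = int L.index - 1"
    using L.sum_reps_delta[of "\<lambda>_. 1" 0] by (simp add: sum_subtractf L.index_def of_bool_def)
  finally have card_prod: "int (card U) * int (card V) = int n ^ 2 + int n"
    by (simp add: index_L)
  have "int (card V) = 2 * int n + 1 - int (card U)"
    using card_sum by linarith
  \<comment> \<open>The sizes have sum \<open>2 n + 1\<close> and product
    \<open>n ^ 2 + n\<close>.\<close>
  with card_prod have "(int (card U) - int n) * (int (card U) - (int n + 1)) = 0"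
    by (simp add: power2_eq_square algebra_simps)
  then have "card U = n \<or> card U = n + 1"
    by auto
  \<comment> \<open>The Frobenius congruence for 2 at \<open>0\<close>: the square of
    \<open>V\<close> counts the pairs \<open>(s, - s)\<close>, and the dilation contributes nothing
    because \<open>V\<close> omits \<open>0\<close>.\<close>
  moreover have "even (card V)"
  proof -
    obtain w where w: "set_sum V ^ 2 = dilate 2 (set_sum V) + of_nat 2 * w"
      using set_sum_power_prime[of 2 V] fin by auto
    have V: "0 \<notin> V"
      using KE[OF zero_mem] by (auto simp: V_def)
    have "s + t \<in> K \<longleftrightarrow> t = - s" if "s \<in> T" "t \<in> T" for s t
      using sums_distinct[OF that zero_T zero_T] zero_mem by (auto simp: eq_neg_iff_add_eq_0 add.commute)
    then have "{(s, t) \<in> V \<times> V. 0 - (s + t) \<in> K} = (\<lambda>s. (s, - s)) ` V"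
      using minus_T E_minus minus_mem_iff[of "_ + _"] by (auto simp: V_def image_iff)
    then have "coef (set_sum V ^ 2) 0 = int (card V)"
      using fin by (simp add: power2_eq_square coef_set_sum_mult card_image inj_on_def)
    moreover have "coef (dilate 2 (set_sum V)) 0 = 0"
    proof -
      have "{s \<in> V. 0 - of_nat 2 * s \<in> K} = {}"
      proof (rule ccontr)
        assume "\<not> ?thesis"
        then obtain s where s: "s \<in> V" "(s + s) - (0 + 0) \<in> K"
          using minus_mem[of "0 - of_nat 2 * _"] unfolding of_nat_numeral mult_2 by fastforce
        then have "s = 0"
          using sums_distinct[of s s 0 0] zero_T no_involution by (auto simp: V_def)
        then show False
          using s V by simp
      qed
      then show ?thesis
        using fin by (simp only: coef_dilate_set_sum) simp
    qed
    ultimately have "int (card V) = 2 * coef w 0"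
      unfolding w by (simp add: coef_add coef_numeral_mult)
    then show ?thesis
      by (metis dvd_triv_left even_of_nat_iff)
  qed
  moreover have "0 \<in> U"
    using zero_T KE[OF zero_mem] by (simp add: U_def)
  moreover have sym: "x \<in> U \<Longrightarrow> - x \<in> U" "x \<in> V \<Longrightarrow> - x \<in> V" for x
    using minus_T E_minus by (auto simp: U_def V_def)
  moreover have UVT: "U \<union> V = T" "U \<inter> V = {}"
    by (auto simp: U_def V_def)
  \<comment> \<open>The set of size \<open>n\<close> comes first. After a swap \<open>0\<close> lies
    in the set of size \<open>n + 1\<close>, and \<open>n = card V\<close> is even, so
    \<open>zero_in_odd\<close> holds vacuously.\<close>
  ultimately consider "lee_pair L n U V" | "lee_pair L n V U"
  proof (elim disjE)
    assume "card U = n"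
    then have "lee_pair L n U V"
      using fin card_sum index_L sym UVT distinct prod squares \<open>0 \<in> U\<close>
      by unfold_locales auto
    then show ?thesis
      using that by blast
  next
    assume "card U = n + 1" "even (card V)"
    then have "lee_pair L n V U"
      using fin card_sum index_L sym UVT distinct prod squares \<open>0 \<in> U\<close>
      by unfold_locales (auto simp: mult.commute add.commute)
    then show ?thesis
      using that by blast
  qed
  then show ?thesis
    by cases (rule that; assumption)+
qed

lemma n_exceptional: "n \<in> {0, 1, 2, 11}"
proof -
  obtain L and U V :: "'a set" where "lee_pair L n U V"
    by (rule exists_lee_pair)
  then show ?thesis
    by (rule lee_pair.n_exceptional)
qed

end

section \<open>Lee spheres\<close>

text \<open>Vectors take the value 0, not \<open>undefined\<close>, off the index set, so that they
  live in the ring \<open>nat \<Rightarrow> int\<close> with pointwise operations to which the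
  locales apply.\<close>

definition unit_vec :: "nat \<Rightarrow> int \<Rightarrow> nat \<Rightarrow> int" where
  "unit_vec i c = (\<lambda>j. if j = i then c else 0)"

text \<open>The Lee sphere of radius 1 in this encoding.\<close>

definition cross :: "nat \<Rightarrow> (nat \<Rightarrow> int) set" where
  "cross n = insert 0 ((\<lambda>(i, c). unit_vec i c) ` ({1..n} \<times> {1, - 1}))"

definition cross_sums :: "nat \<Rightarrow> (nat \<Rightarrow> int) set" where
  "cross_sums n = {x + y | x y. x \<in> cross n \<and> y \<in> cross n}"

lemma zero_in_cross: "0 \<in> cross n"
  by (simp add: cross_def)

lemma unit_vec_in_cross: "i \<in> {1..n} \<Longrightarrow> c = 1 \<or> c = - 1 \<Longrightarrow> unit_vec i c \<in> cross n"
  by (auto simp: cross_def)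

lemma cross_cases:
  assumes "x \<in> cross n"
  obtains "x = 0" | i c where "i \<in> {1..n}" "c = 1 \<or> c = - 1" "x = unit_vec i c"
proof -
  have "x = 0 \<or> (\<exists>i c. i \<in> {1..n} \<and> (c = 1 \<or> c = - 1) \<and> x = unit_vec i c)"
    using assms by (auto simp: cross_def)
  then show ?thesis
    using that by blast
qed

lemma uminus_unit_vec: "- unit_vec i c = unit_vec i (- c)"
  by (auto simp: unit_vec_def fun_eq_iff)

lemma minus_cross: "x \<in> cross n \<Longrightarrow> - x \<in> cross n"
  by (elim cross_cases) (auto simp: zero_in_cross uminus_unit_vec intro: unit_vec_in_cross)

lemma finite_cross: "finite (cross n)"
  by (simp add: cross_def)

lemma unit_vec_neq_0: "c \<noteq> 0 \<Longrightarrow> unit_vec i c \<noteq> 0"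
  by (auto simp: unit_vec_def fun_eq_iff)

lemma card_cross: "card (cross n) = 2 * n + 1"
proof -
  have "inj_on (\<lambda>(i, c). unit_vec i c) ({1..n} \<times> {1, - 1})"
    by (auto simp: inj_on_def unit_vec_def fun_eq_iff split: if_splits)
  then have "card ((\<lambda>(i, c). unit_vec i c) ` ({1..n} \<times> {1, - 1})) = card ({1..n} \<times> {1, - 1 :: int})"
    by (rule card_image)
  moreover have "card {1, - 1 :: int} = 2"
    by simp
  moreover have "0 \<notin> (\<lambda>(i, c). unit_vec i c) ` ({1..n} \<times> {1, - 1})"
    using unit_vec_neq_0 by (auto simp: eq_commute[of 0])
  ultimately show ?thesis
    by (simp add: cross_def card_cartesian_product)
qed

lemma cross_outside: "x \<in> cross n \<Longrightarrow> i \<notin> {1..n} \<Longrightarrow> x i = 0"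
  by (elim cross_cases) (auto simp: unit_vec_def)

lemma cross_sums_outside: "x \<in> cross_sums n \<Longrightarrow> i \<notin> {1..n} \<Longrightarrow> x i = 0"
  by (auto simp: cross_sums_def cross_outside)

lemma finite_cross_sums: "finite (cross_sums n)"
proof -
  have "cross_sums n = (\<lambda>(x, y). x + y) ` (cross n \<times> cross n)"
    by (auto simp: cross_sums_def)
  then show ?thesis
    by (simp add: finite_cross)
qed

lemma cross_eq_unit_vec:
  assumes "x \<in> cross n" "c = 1 \<or> c = - 1" "c * x i \<ge> 1"
  shows "x = unit_vec i c"
  using assms by (elim cross_cases) (auto simp: unit_vec_def split: if_splits)

text \<open>A nonzero sum \<open>x + y\<close> has the same sign as \<open>x\<close> at the support of \<open>x\<close>.\<close>

lemma cross_summand: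
  assumes "x \<in> cross n" "y \<in> cross n" "x' \<in> cross n" "y' \<in> cross n"
    and "x + y = x' + y'" "x + y \<noteq> 0" "x \<noteq> 0"
  shows "x = x' \<or> x = y'"
proof -
  obtain i c where c: "c = 1 \<or> c = - 1" "x = unit_vec i c"
    using assms(1,7) by (elim cross_cases) auto
  have "c * y i \<ge> 0"
  proof (rule ccontr)
    assume "\<not> ?thesis"
    then have "y = unit_vec i (- c)"
      using assms(2) c(1) by (intro cross_eq_unit_vec) auto
    then show False
      using assms(6) by (simp add: c(2) uminus_unit_vec[symmetric])
  qed
  moreover have "c * x i = 1"
    using c by (auto simp: unit_vec_def)
  moreover have "x i + y i = x' i + y' i"
    using assms(5) by (metis plus_fun_apply)
  then have "c * x i + c * y i = c * x' i + c * y' i"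
    by (metis distrib_left)
  ultimately have "c * x' i \<ge> 1 \<or> c * y' i \<ge> 1"
    by linarith
  then show ?thesis
    using cross_eq_unit_vec[of _ n c i] assms(3,4) c by blast
qed

lemma cross_sums_unique:
  assumes "x \<in> cross n" "y \<in> cross n" "x' \<in> cross n" "y' \<in> cross n" "x + y = x' + y'"
  shows "(x = x' \<and> y = y') \<or> (x = y' \<and> y = x') \<or> (x + y = 0 \<and> x' + y' = 0)"
proof (cases "x + y = 0")
  case False
  show ?thesis
  proof (cases "x = 0")
    case True
    then have "y = x' \<or> y = y'"
      using cross_summand[of y n x x' y'] assms False by (simp add: add.commute)
    then show ?thesis
      using assms(5) by (auto simp: add.commute)
  next
    case x: False
    then have "x = x' \<or> x = y'"
      using cross_summand[of x n y x' y'] assms False by simp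
    then show ?thesis
      using assms(5) by (auto simp: add.commute)
  qed
qed (use assms in auto)

lemma sum_abs_cross: "x \<in> cross n \<Longrightarrow> (\<Sum>i\<in>{1..n}. \<bar>x i\<bar>) \<le> 1"
  by (elim cross_cases) (auto simp: unit_vec_def if_distrib[of abs] cong: if_cong)

text \<open>A unit step towards 0 in a nonzero coordinate lowers the norm by one. Two such steps
  write a point of the sphere of radius 2 as a sum of two elements of
  \<open>cross n\<close>.\<close>

lemma cross_approx:
  fixes x :: "nat \<Rightarrow> int"
  assumes "(\<Sum>i\<in>{1..n}. \<bar>x i\<bar>) \<le> m + 1" "m \<ge> 0"
  obtains s where "s \<in> cross n" "(\<Sum>i\<in>{1..n}. \<bar>x i - s i\<bar>) \<le> m"
proof (cases "\<forall>i\<in>{1..n}. x i = 0")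
  case True
  then show ?thesis
    using assms by (intro that[of 0] zero_in_cross) simp
next
  case False
  then obtain i where i: "i \<in> {1..n}" "x i \<noteq> 0"
    by blast
  define c where "c = sgn (x i)"
  have c: "c = 1 \<or> c = - 1"
    using i by (auto simp: c_def sgn_if)
  have "(\<Sum>j\<in>{1..n}. \<bar>x j - unit_vec i c j\<bar>) = (\<Sum>j\<in>{1..n}. \<bar>x j\<bar> - (if j = i then 1 else 0))"
    using i by (intro sum.cong) (auto simp: unit_vec_def c_def sgn_if)
  also have "\<dots> = (\<Sum>j\<in>{1..n}. \<bar>x j\<bar>) - 1"
    using i by (simp add: sum_subtractf)
  finally show ?thesis
    using assms i c by (intro that[of "unit_vec i c"] unit_vec_in_cross) auto
qed

text \<open>The homomorphism onto \<open>Zn n\<close> along which the code is pulled back.\<close>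

definition proj :: "nat \<Rightarrow> (nat \<Rightarrow> int) \<Rightarrow> (nat \<Rightarrow> int)" where
  "proj n x = restrict x {1..n}"

lemma lee_sphere_2: "lee_sphere n 2 = proj n ` cross_sums n"
proof (intro equalityI subsetI)
  fix x assume x: "x \<in> lee_sphere n 2"
  then have "(\<Sum>i\<in>{1..n}. \<bar>x i\<bar>) \<le> 1 + 1"
    by (simp add: lee_sphere_def)
  then obtain s where s: "s \<in> cross n" "(\<Sum>i\<in>{1..n}. \<bar>x i - s i\<bar>) \<le> 0 + 1"
    by (rule cross_approx) auto
  from s(2) obtain t where t: "t \<in> cross n" "(\<Sum>i\<in>{1..n}. \<bar>(x i - s i) - t i\<bar>) \<le> 0"
    by (rule cross_approx) auto
  have "(\<Sum>i\<in>{1..n}. \<bar>(x i - s i) - t i\<bar>) = 0"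
    by (intro antisym[OF t(2)] sum_nonneg) simp
  then have "\<forall>i\<in>{1..n}. x i - s i = t i"
    by (simp add: sum_nonneg_eq_0_iff)
  then have "x i = s i + t i" if "i \<in> {1..n}" for i
    using that by (metis add.commute diff_add_cancel)
  moreover have "x \<in> extensional {1..n}"
    using x by (auto simp: lee_sphere_def Zn_def PiE_def)
  ultimately have "x = proj n (s + t)"
    by (auto simp: proj_def fun_eq_iff extensional_def)
  then show "x \<in> proj n ` cross_sums n"
    using s t by (auto simp: cross_sums_def)
next
  fix x assume "x \<in> proj n ` cross_sums n"
  then obtain s t where st: "s \<in> cross n" "t \<in> cross n" "x = proj n (s + t)"
    by (auto simp: cross_sums_def)
  have "(\<Sum>i\<in>{1..n}. \<bar>x i\<bar>) \<le> (\<Sum>i\<in>{1..n}. \<bar>s i\<bar> + \<bar>t i\<bar>)"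
    by (intro sum_mono) (auto simp: st(3) proj_def)
  also have "\<dots> \<le> 2"
    using sum_abs_cross[OF st(1)] sum_abs_cross[OF st(2)] by (simp add: sum.distrib)
  finally show "x \<in> lee_sphere n 2"
    by (simp add: lee_sphere_def Zn_def st(3) proj_def)
qed

lemma inj_on_proj: "inj_on (proj n) (cross_sums n)"
proof (rule inj_onI)
  fix x y assume xy: "x \<in> cross_sums n" "y \<in> cross_sums n" and "proj n x = proj n y"
  then have "x i = y i" if "i \<in> {1..n}" for i
    using that by (auto simp: proj_def fun_eq_iff split: if_splits)
  moreover have "x i = y i" if "i \<notin> {1..n}" for i
    using that cross_sums_outside xy by metis
  ultimately show "x = y"
    by blast
qed

section \<open>The code as a subgroup of finite index\<close>

lemma group_Zn: "group (Zn n)"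
  by (simp add: Zn_def)

lemma proj_carrier: "proj n x \<in> carrier (Zn n)"
  by (simp add: proj_def Zn_def)

lemma proj_add: "proj n (x + y) = proj n x \<otimes>\<^bsub>Zn n\<^esub> proj n y"
  by (auto simp: proj_def Zn_def)

lemma proj_0: "proj n 0 = \<one>\<^bsub>Zn n\<^esub>"
  by (auto simp: proj_def Zn_def)

lemma proj_minus: "proj n (- x) = inv\<^bsub>Zn n\<^esub> proj n x"
  using group.inv_equality[OF group_Zn, of n "proj n (- x)" "proj n x"]
  by (simp add: proj_carrier proj_add[symmetric] proj_0)

lemma proj_diff: "proj n (x - y) = proj n x \<otimes>\<^bsub>Zn n\<^esub> inv\<^bsub>Zn n\<^esub> proj n y"
  by (metis diff_conv_add_uminus proj_add proj_minus)

lemma carrier_proj: "x \<in> carrier (Zn n) \<Longrightarrow> proj n x = x"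
  by (auto simp: proj_def Zn_def fun_eq_iff PiE_def extensional_def)

lemma rcosets_proj: "rcosets\<^bsub>Zn n\<^esub> C = range (\<lambda>x. C #>\<^bsub>Zn n\<^esub> proj n x)"
proof -
  have "carrier (Zn n) = range (proj n)"
    using proj_carrier carrier_proj by (metis image_subsetI rangeI subsetI subset_antisym)
  then show ?thesis
    by (auto simp: RCOSETS_def)
qed

lemma coset_proj_eq_iff:
  assumes "subgroup C (Zn n)"
  shows "C #>\<^bsub>Zn n\<^esub> proj n x = C #>\<^bsub>Zn n\<^esub> proj n y \<longleftrightarrow> proj n (x - y) \<in> C"
proof -
  interpret group "Zn n"
    by (rule group_Zn)
  have xy: "proj n x = proj n (x - y) \<otimes>\<^bsub>Zn n\<^esub> proj n y"
    by (simp add: proj_add[symmetric])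
  show ?thesis
  proof
    assume "C #>\<^bsub>Zn n\<^esub> proj n x = C #>\<^bsub>Zn n\<^esub> proj n y"
    then have "proj n x \<in> C #>\<^bsub>Zn n\<^esub> proj n y"
      using rcos_self[OF proj_carrier assms] by metis
    then obtain h where h: "h \<in> C" "proj n x = h \<otimes>\<^bsub>Zn n\<^esub> proj n y"
      by (auto simp: r_coset_def)
    moreover have "h \<in> carrier (Zn n)"
      using h(1) subgroup.mem_carrier[OF assms] by blast
    ultimately have "proj n (x - y) = h"
      using xy proj_carrier right_cancel by metis
    then show "proj n (x - y) \<in> C"
      using h by simp
  next
    assume "proj n (x - y) \<in> C"
    then have "proj n x \<in> C #>\<^bsub>Zn n\<^esub> proj n y"
      unfolding r_coset_def using xy by blast
    then show "C #>\<^bsub>Zn n\<^esub> proj n x = C #>\<^bsub>Zn n\<^esub> proj n y"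
      using repr_independence[OF _ proj_carrier assms] by metis
  qed
qed

text \<open>Cosets of the preimage under \<open>proj n\<close> correspond to cosets of the code, so
  the index is preserved, and the packing property makes distinct points of the sphere
  incongruent.\<close>

lemma almost_perfect_imp_almost_tiling:
  assumes "almost_perfect_linear_lee_code n 2 C"
  shows "almost_tiling {x. proj n x \<in> C} n (cross n)"
proof -
  interpret G: group "Zn n"
    by (rule group_Zn)
  let ?S = "lee_sphere n 2"
  let ?R = "rcosets\<^bsub>Zn n\<^esub> C"
  let ?K = "{x. proj n x \<in> C}"
  let ?\<phi> = "\<lambda>x. C #>\<^bsub>Zn n\<^esub> proj n x"
  have C: "subgroup C (Zn n)" and fin: "finite ?R"
    and packing: "disjoint_family_on (\<lambda>c. ?S #>\<^bsub>Zn n\<^esub> c) C"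
    and density: "real (card ?S) / real (card ?R) = real (card ?S) / (real (card ?S) + 1)"
    using assms by (auto simp: almost_perfect_linear_lee_code_def lattice_packing_def
        linear_lee_code_def packing_density_def)
  have card_S: "card ?S = card (cross_sums n)"
    unfolding lee_sphere_2 by (rule card_image[OF inj_on_proj])
  \<comment> \<open>The sphere is nonempty, so the density equation reduces to an equation of
    denominators.\<close>
  have "0 + 0 \<in> cross_sums n"
    unfolding cross_sums_def using zero_in_cross by blast
  then have "card ?S > 0"
    unfolding card_S using finite_cross_sums card_gt_0_iff by blast
  then have "real (card ?R) = real (card ?S) + 1"
    using density by (simp add: divide_cancel_left)
  then have card_R: "card ?R = Suc (card (cross_sums n))"
    by (simp add: card_S)
  have K: "finite_index_subgroup ?K"
  proof
    show "0 \<in> ?K"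
      using subgroup.one_closed[OF C] by (simp add: proj_0)
    show "x - y \<in> ?K" if "x \<in> ?K" "y \<in> ?K" for x y
      using that subgroup.m_closed[OF C] subgroup.m_inv_closed[OF C] by (simp add: proj_diff)
    have "finite (range ?\<phi>)"
      using fin by (simp only: rcosets_proj)
    then obtain F where F: "finite F" "range ?\<phi> = ?\<phi> ` F"
      using finite_subset_image[of "range ?\<phi>" ?\<phi> UNIV] by blast
    have "\<exists>r\<in>F. x - r \<in> ?K" for x
    proof -
      have "?\<phi> x \<in> ?\<phi> ` F"
        using F(2) by blast
      then show ?thesis
        using coset_proj_eq_iff[OF C] by auto
    qed
    then show "\<exists>F. finite F \<and> (\<forall>x. \<exists>r\<in>F. x - r \<in> ?K)"
      using F(1) by blast
  qed
  interpret K: finite_index_subgroup ?K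
    by (rule K)
  have "bij_betw ?\<phi> K.reps ?R"
  proof (rule bij_betw_imageI)
    show "inj_on ?\<phi> K.reps"
    proof (rule inj_onI)
      fix x y assume "x \<in> K.reps" "y \<in> K.reps" "?\<phi> x = ?\<phi> y"
      then show "x = y"
        using coset_proj_eq_iff[OF C] K.rep_eq_iff[of x y] K.rep_of_reps by simp
    qed
    have "?\<phi> x = ?\<phi> (K.rep x)" for x
      using coset_proj_eq_iff[OF C] K.rep_diff[of x] by (metis mem_Collect_eq)
    then show "?\<phi> ` K.reps = ?R"
      unfolding rcosets_proj using K.rep_in_reps by blast
  qed
  then have index: "K.index = Suc (card (cross_sums n))"
    using card_R by (simp add: K.index_def bij_betw_same_card)
  \<comment> \<open>If \<open>x\<close> and \<open>y\<close> are congruent, the point of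
    \<open>x\<close> lies in the translates of the sphere by the code words of \<open>x - y\<close>
    and of \<open>0\<close>; disjointness makes these code words equal.\<close>
  have sums: "x = y" if "x \<in> cross_sums n" "y \<in> cross_sums n" "x - y \<in> ?K" for x y
  proof -
    let ?c = "proj n (x - y)"
    have S: "proj n x \<in> ?S" "proj n y \<in> ?S"
      using that by (auto simp: lee_sphere_2)
    have "proj n x = proj n y \<otimes>\<^bsub>Zn n\<^esub> ?c"
      by (simp add: proj_add[symmetric])
    then have "proj n x \<in> ?S #>\<^bsub>Zn n\<^esub> ?c"
      unfolding r_coset_def using S(2) by blast
    moreover have "proj n x = proj n x \<otimes>\<^bsub>Zn n\<^esub> proj n 0"
      by (simp add: proj_add[symmetric])
    then have "proj n x \<in> ?S #>\<^bsub>Zn n\<^esub> proj n 0"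
      unfolding r_coset_def using S(1) by blast
    moreover have "?c \<in> C" "proj n 0 \<in> C"
      using that(3) K.zero_mem by simp_all
    ultimately have "?c = proj n 0"
      using packing unfolding disjoint_family_on_def by blast
    then have "proj n x = proj n y"
      using \<open>proj n x = proj n y \<otimes>\<^bsub>Zn n\<^esub> ?c\<close> by (simp add: proj_add[symmetric])
    then show ?thesis
      using inj_on_proj that(1,2) by (auto dest: inj_onD)
  qed
  show ?thesis
  proof (intro almost_tiling.intro almost_tiling_axioms.intro K)
    show "x = 0" if "x + x = 0" for x :: "nat \<Rightarrow> int"
    proof
      fix i
      have "(x + x) i = 0"
        using that by simp
      then show "x i = 0 i"
        by simp
    qed
    show "(x = x' \<and> y = y') \<or> (x = y' \<and> y = x') \<or> (x + y = 0 \<and> x' + y' = 0)"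
      if "x \<in> cross n" "y \<in> cross n" "x' \<in> cross n" "y' \<in> cross n" "(x + y) - (x' + y') \<in> ?K"
      for x y x' y'
      using that sums[of "x + y" "x' + y'"] by (intro cross_sums_unique) (auto simp: cross_sums_def)
    show "K.index = Suc (card {x + y | x y. x \<in> cross n \<and> y \<in> cross n})"
      using index by (simp add: cross_sums_def)
  qed (auto simp: finite_cross card_cross zero_in_cross intro: minus_cross)
qed

theorem theorem1p2:
  fixes n :: nat
  assumes "n > 0"
    and "n \<notin> {1, 2, 11, 29, 47, 56, 67, 79, 104, 121, 134, 191}"
  shows "\<not> (\<exists>C. almost_perfect_linear_lee_code n 2 C)"
proof
  assume "\<exists>C. almost_perfect_linear_lee_code n 2 C"
  then obtain C where "almost_perfect_linear_lee_code n 2 C"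
    by blast
  then have "almost_tiling {x. proj n x \<in> C} n (cross n)"
    by (rule almost_perfect_imp_almost_tiling)
  then have "n \<in> {0, 1, 2, 11}"
    by (rule almost_tiling.n_exceptional)
  then show False
    using assms by auto
qed

end
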